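(* Let $f$ be an exponential polynomial, i.e. $f(z)=\sum_{j=1}^m P_j(z)e^{Q_j(z)}$ with $P_j,Q_j\in\mathbb{C}[z]$, $f\not\equiv 0$. If $f$ has an infinite zero-sequence $Z$ (the sequence of all zeros of $f$ in $\mathbb{C}$, listed according to multiplicity and ordered by increasing modulus), then $Z$ is regularly distributed.
   Context: Exponent of convergence: an infinite sequence $\{z_n\}$ of non-zero complex numbers with no finite limit point has exponent of convergence $\lambda\in(0,\infty)$ if $\sum_n|z_n|^{-(\lambda+\varepsilon)}<\infty$ and $\sum_n|z_n|^{-(\lambda-\varepsilon)}=\infty$ for every $\varepsilon\in(0,\lambda)$. If the value $0$ occurs finitely many times in the sequence, these occurrences are ignored in the definition. Regularly distributed sequences: let $Z=\{z_n\}$ be a sequence of points in $\mathbb{C}$ with exponent of convergence $\lambda\in(0,\infty)$, ordered by increasing modulus, whose counting function $n_Z(r)$ (the number of points $z_n$ with $|z_n|\le r$, with multiplicity) has at most finite type with respect to $\lambda$, i.e. $\limsup_{r\to\infty} r^{-\lambda}n_Z(r)<\infty$. For $\theta_1<\theta_2$ let $n_Z(r,\theta_1,\theta_2)$ be the number of points $z_n$, counting multiplicities, in $\{z\in\mathbb{C}: |z|<r,\ \theta_1<\arg(z)<\theta_2\}$. The sequence $Z$ has angular density with respect to $\lambda$ if for all $\theta_1,\theta_2$, with at most countably many possible exceptional angles, the limit $\lim_{r\to\infty}r^{-\lambda}n_Z(r,\theta_1,\theta_2)$ exists. The sequence $Z$ is regularly distributed if it has angular density with respect to $\lambda$ and either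 (1) $\lambda\notin\mathbb{N}$, or (2) $\lambda\in\mathbb{N}$ and, in addition, the limit $\lim_{r\to\infty}\sum_{0<|z_n|<r}z_n^{-\lambda}$ exists (as a finite complex number). *)

theory Defs
  imports "HOL-Complex_Analysis.Complex_Analysis"
begin

definition exponential_polynomial :: "(complex \<Rightarrow> complex) \<Rightarrow> bool" where
  "exponential_polynomial f \<longleftrightarrow>
     (\<exists>(m::nat) (P :: nat \<Rightarrow> complex poly) (Q :: nat \<Rightarrow> complex poly).
        \<forall>z. f z = (\<Sum>j=1..m. poly (P j) z * exp (poly (Q j) z)))"

text \<open>An enumeration of all zeros of \<open>f\<close>; each zero occurs as often as its multiplicity. Intended
  for entire \<open>f\<close> that do not vanish identically, so that \<open>zorder f w\<close> is the (positive) multiplicity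
  of the zero \<open>w\<close>.\<close>

definition zero_sequence :: "(complex \<Rightarrow> complex) \<Rightarrow> (nat \<Rightarrow> complex) \<Rightarrow> bool" where
  "zero_sequence f z \<longleftrightarrow>
     range z = {w. f w = 0} \<and>
     (\<forall>w. f w = 0 \<longrightarrow> int (card {n. z n = w}) = zorder f w) \<and>
     incseq (\<lambda>n. norm (z n))"

text \<open>Limit points are those of the sequence and not of its range: a value that is repeated
  infinitely often is a limit point.\<close>

definition no_finite_limit_point :: "(nat \<Rightarrow> complex) \<Rightarrow> bool" where
  "no_finite_limit_point z \<longleftrightarrow> (\<forall>w. \<exists>e>0. finite {n. dist (z n) w < e})"

definition has_exponent_of_convergence :: "(nat \<Rightarrow> complex) \<Rightarrow> real \<Rightarrow> bool" where
  "has_exponent_of_convergence z l \<longleftrightarrow>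
     0 < l \<and> no_finite_limit_point z \<and>
     (\<forall>e. 0 < e \<and> e < l \<longrightarrow>
        (\<lambda>n. norm (z n) powr - (l + e)) summable_on {n. z n \<noteq> 0} \<and>
        \<not> (\<lambda>n. norm (z n) powr - (l - e)) summable_on {n. z n \<noteq> 0})"

definition count_disc :: "(nat \<Rightarrow> complex) \<Rightarrow> real \<Rightarrow> nat" where
  "count_disc z r = card {n. norm (z n) \<le> r}"

definition finite_type :: "(nat \<Rightarrow> complex) \<Rightarrow> real \<Rightarrow> bool" where
  "finite_type z l \<longleftrightarrow>
     Limsup at_top (\<lambda>r::real. ereal (r powr (- l) * real (count_disc z r))) < \<infinity>"

text \<open>The argument is multivalued here: a nonzero point lies in the sector if one of its arguments
  lies between \<open>a\<close> and \<open>b\<close>. The origin, of which every \<open>t\<close> is an argument for \<open>is_Arg\<close>, is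
  excluded.\<close>

definition count_sector :: "(nat \<Rightarrow> complex) \<Rightarrow> real \<Rightarrow> real \<Rightarrow> real \<Rightarrow> nat" where
  "count_sector z r a b =
     card {n. z n \<noteq> 0 \<and> norm (z n) < r \<and> (\<exists>t. a < t \<and> t < b \<and> is_Arg (z n) t)}"

definition has_angular_density :: "(nat \<Rightarrow> complex) \<Rightarrow> real \<Rightarrow> bool" where
  "has_angular_density z l \<longleftrightarrow>
     (\<exists>E::real set. countable E \<and>
        (\<forall>a b. a \<notin> E \<and> b \<notin> E \<and> a < b \<longrightarrow>
           (\<exists>d::real. ((\<lambda>r::real. r powr (- l) * real (count_sector z r a b)) \<longlongrightarrow> d) at_top)))"

text \<open>The power \<open>z n powi - int p\<close> below is the \<open>-\<lambda>\<close>-th power for the integral exponent \<open>\<lambda> = p\<close>.\<close>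

definition regularly_distributed :: "(nat \<Rightarrow> complex) \<Rightarrow> bool" where
  "regularly_distributed z \<longleftrightarrow>
     (\<exists>l. has_exponent_of_convergence z l \<and> incseq (\<lambda>n. norm (z n)) \<and>
        finite_type z l \<and> has_angular_density z l \<and>
        (l \<notin> \<nat> \<or>
         (\<exists>p::nat. l = real p \<and>
            (\<exists>L::complex.
               ((\<lambda>r::real. \<Sum>n | 0 < norm (z n) \<and> norm (z n) < r. z n powi (- int p)) \<longlongrightarrow> L) at_top))))"

end

(* After division by a zero-free factor, f = sum over w in K of F_w(z) exp(w z^q) with at least two
   exponents w and entire F_w with log |F_w(z)| = o(|z|^q); the zeros then have exponent q.  On the
   circle |z| = r, away from a set of directions of small measure one term dominates, so
   r^(-q) log |f(r e^(it))| tends to h(t) = max Re (w e^(iqt)) in L^1: Jensen's formula for the F_w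
   bounds the bad set, and on it a Borel-Caratheodory estimate makes the negative part of log |f|
   uniformly integrable.  Hence all Fourier coefficients of log |f| on circles, divided by r^q,
   converge.  The coefficient of index 0 is the Jensen sum and gives the counting function; the one
   of index k combines sum (r/z_n)^k and sum (conj z_n / r)^k, and comparing two radii isolates the
   second sum.  For k = q this yields Lindeloef's sum, and for all k together, with trigonometric
   approximation, the angular density. *)
theory Submission
  imports Defs "HOL-Computational_Algebra.Fundamental_Theorem_Algebra"
begin

text \<open>Near a zero no pointwise lower bound for ln |f| can hold. Convergence in the mean
  tolerates such directions as long as the negative part of ln |f| cannot concentrate on a small
  set; the square integrability of the logarithmic kernel is what excludes this. The Fourier
  coefficients create a second obstacle: they weight zeros by powers of their moduli, whereas the
  angular density counts each zero once, and at index k they contain an unknown multiple of r^k. Two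
  radii of ratio b remove that multiple, with an error bounded by the number of zeros in the annulus
  between them. This is a small multiple of r^q for b near 1, but only once the counting function is
  known to be regular. At index q the unknown multiple has exactly the order of the normalisation.
  This is why Lindeloef's sum appears there, and since the exponent is the integer q, it is the
  second alternative of the definition that is proved. The directions have a limit distribution that
  may have atoms: for exp(z) - 1 it consists of the two directions of the imaginary axis. Sectors
  are therefore cut off only along non-atoms, and the countably many atoms supply the exceptional
  angles.\<close>

subsection \<open>Integrals over the unit circle\<close>

text \<open>Angles are measured in turns, as in \<open>circlepath\<close>: the circle has total
  measure 1 and mean values need no factor 2 pi.\<close>

definition circle_pt :: "real \<Rightarrow> complex" where
  "circle_pt t = cis (2 * pi * t)"

definition circ :: "real measure" where
  "circ = restrict_space lborel {0..1}"

abbreviation on_circle :: "real \<Rightarrow> real \<Rightarrow> complex" where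
  "on_circle r t \<equiv> of_real r * circle_pt t"

abbreviation ln_mod :: "(complex \<Rightarrow> complex) \<Rightarrow> real \<Rightarrow> real \<Rightarrow> real" where
  "ln_mod f r t \<equiv> ln (norm (f (on_circle r t)))"

lemma norm_circle_pt [simp]: "norm (circle_pt t) = 1"
  by (simp add: circle_pt_def)

lemma circle_pt_nonzero [simp]: "circle_pt t \<noteq> 0"
  by (simp add: circle_pt_def)

lemma continuous_on_circle_pt [continuous_intros]:
  "continuous_on A f \<Longrightarrow> continuous_on A (\<lambda>t. circle_pt (f t))"
  unfolding circle_pt_def by (intro continuous_intros)

lemma borel_measurable_circle_pt [measurable]: "circle_pt \<in> borel_measurable borel"
  by (intro borel_measurable_continuous_onI continuous_intros)

lemma cnj_circle_pt: "cnj (circle_pt t) = inverse (circle_pt t)"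
  by (simp add: circle_pt_def cis_cnj)

lemma circle_pt_polar: "\<exists>s\<in>{0..1}. z = of_real (norm z) * circle_pt s"
proof -
  have "0 \<le> Arg2pi z" "Arg2pi z < 2 * pi" using Arg2pi[of z] by auto
  moreover have "z = of_real (norm z) * circle_pt (Arg2pi z / (2*pi))"
    using Arg2pi_eq[of z] by (simp add: circle_pt_def cis_conv_exp)
  ultimately show ?thesis
    by (intro bexI[of _ "Arg2pi z / (2*pi)"]) (auto simp: field_simps)
qed

lemma space_circ [simp]: "space circ = {0..1}"
  by (simp add: circ_def space_restrict_space)

lemma finite_measure_circ: "finite_measure circ"
  by (rule finite_measureI) (simp add: circ_def emeasure_restrict_space space_restrict_space)

interpretation circ: finite_measure circ
  by (rule finite_measure_circ)

lemma measure_circ_space [simp]: "measure circ {0..1} = 1"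
  by (simp add: circ_def measure_restrict_space)

lemma measurable_circI: "f \<in> measurable borel N \<Longrightarrow> f \<in> measurable circ N"
  unfolding circ_def by (rule measurable_restrict_space1) simp

lemma integrable_circ_const [simp]: "integrable circ (\<lambda>_. c :: 'a :: {banach, second_countable_topology})"
  by (rule circ.integrable_const)

lemma integrable_circ_iff:
  fixes f :: "real \<Rightarrow> 'a :: {banach, second_countable_topology}"
  shows "integrable circ f \<longleftrightarrow> set_integrable lborel {0..1} f"
  unfolding circ_def by (rule set_integrable_eq [symmetric]) simp

lemma integral_circ_eq:
  fixes f :: "real \<Rightarrow> 'a :: {banach, second_countable_topology}"
  shows "(\<integral>t. f t \<partial>circ) = (LINT t:{0..1}|lborel. f t)"
  unfolding circ_def set_lebesgue_integral_def by (rule integral_restrict_space) simp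

lemma integrable_circ_continuous:
  fixes f :: "real \<Rightarrow> 'a :: euclidean_space"
  assumes "continuous_on {0..1} f"
  shows "integrable circ f"
  unfolding integrable_circ_iff by (rule borel_integrable_atLeastAtMost' [OF assms])

lemma integral_circ_has_integral:
  fixes f :: "real \<Rightarrow> 'a :: euclidean_space"
  assumes "integrable circ f"
  shows "(f has_integral (\<integral>t. f t \<partial>circ)) {0..1}"
  using set_borel_integral_eq_integral[of "{0..1}" f] assms
  unfolding integral_circ_eq integrable_circ_iff by (simp add: integrable_integral)

text \<open>Serves unbounded integrands: a gauge integral obtained from an antiderivative becomes a
  Lebesgue integral, because non-negativity gives absolute integrability.\<close>

lemma has_integral_nonneg_circ:
  fixes f :: "real \<Rightarrow> real"
  assumes "(f has_integral I) {0..1}" "f \<in> borel_measurable borel" "\<And>x. 0 \<le> f x"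
  shows "integrable circ f" "(\<integral>t. f t \<partial>circ) = I"
proof -
  have "f absolutely_integrable_on {0..1}"
    by (rule nonnegative_absolutely_integrable_1) (use assms in auto)
  hence "integrable lebesgue (\<lambda>x. indicator {0..1} x *\<^sub>R f x)"
    by (simp add: set_integrable_def)
  hence "integrable lborel (\<lambda>x. indicator {0..1} x *\<^sub>R f x)"
    by (subst (asm) integrable_completion) (use assms in auto)
  thus 1: "integrable circ f" by (simp add: integrable_circ_iff set_integrable_def)
  from integral_circ_has_integral[OF 1] assms(1) show "(\<integral>t. f t \<partial>circ) = I"
    by (rule has_integral_unique)
qed

section \<open>Null sets of directions\<close>

lemma AE_circ_notin_countable:
  assumes "countable A"
  shows "AE t in circ. t \<notin> A"
proof -
  have "AE t in lborel. t \<notin> A"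
    by (intro AE_not_in countable_imp_null_set_lborel assms)
  thus ?thesis
    unfolding circ_def by (subst AE_restrict_space_iff) auto
qed

lemma inj_on_circle_pt: "inj_on circle_pt {0..<1}"
proof (rule inj_onI)
  fix s t :: real assume *: "s \<in> {0..<1}" "t \<in> {0..<1}" "circle_pt s = circle_pt t"
  have "Arg2pi (circle_pt u) = 2 * pi * u" if "u \<in> {0..<1}" for u
    by (rule Arg2pi_unique[of 1]) (use that in \<open>auto simp: circle_pt_def cis_conv_exp\<close>)
  with * show "s = t" by (metis mult_cancel_left pi_neq_zero zero_neq_numeral mult_eq_0_iff)
qed

lemma AE_circ_circle_pt_notin:
  assumes "countable Z" "c \<noteq> 0"
  shows "AE t in circ. c * circle_pt t \<notin> Z"
proof -
  let ?A = "{t\<in>{0..<1}. c * circle_pt t \<in> Z}"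
  have "inj_on (\<lambda>t. c * circle_pt t) ?A"
    using inj_on_circle_pt assms(2) by (auto simp: inj_on_def)
  moreover have "countable ((\<lambda>t. c * circle_pt t) ` ?A)"
    by (rule countable_subset[OF _ assms(1)]) auto
  ultimately have "countable ?A" by (rule countable_image_inj_on[rotated])
  \<comment> \<open>The parameter 1 repeats the direction of 0; injectivity holds only on the
    half-open interval, so 1 joins the exceptional set by hand.\<close>
  hence "countable (insert 1 ?A)" by simp
  from AE_circ_notin_countable[OF this] AE_space[of circ] show ?thesis
    by eventually_elim auto
qed

lemma AE_circ_circle_pt_neq: "AE t in circ. circle_pt t \<noteq> w"
  using AE_circ_circle_pt_notin[of "{w}" 1] by simp

section \<open>The logarithmic kernel and the integral of its square\<close>

lemma sin_ge_half:
  fixes x :: real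
  assumes "0 \<le> x" "x \<le> pi / 2"
  shows "x / 2 \<le> sin x"
proof (cases "x \<le> pi / 3")
  case True
  have "(\<lambda>x. sin x - x / 2) 0 \<le> (\<lambda>x. sin x - x / 2) x"
  proof (rule DERIV_nonneg_imp_nondecreasing[OF assms(1)])
    fix y assume y: "0 \<le> y" "y \<le> x"
    have "cos (pi/3) \<le> cos y"
      by (rule cos_monotone_0_pi_le) (use y True in auto)
    hence "1/2 \<le> cos y" by (simp add: cos_60)
    thus "\<exists>d. ((\<lambda>x. sin x - x / 2) has_real_derivative d) (at y) \<and> 0 \<le> d"
      by (intro exI[of _ "cos y - 1/2"]) (auto intro!: derivative_eq_intros)
  qed
  thus ?thesis by simp
next
  case False
  \<comment> \<open>On this range sin x is at least sqrt 3 / 2 >= 0.8, while x / 2 <= pi / 4 <=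
    0.8.\<close>
  have "sin (pi/3) \<le> sin x"
    by (rule sin_monotone_2pi_le) (use assms False in \<open>auto simp: field_simps\<close>)
  moreover have "sin (pi/3) = sqrt 3 / 2" by (rule sin_60)
  moreover have "1.6 \<le> sqrt (3::real)" by (rule real_le_rsqrt) (simp add: power2_eq_square)
  moreover have "pi \<le> 3.2" using pi_approx by simp
  ultimately show ?thesis using assms by simp
qed

lemma norm_circle_pt_diff: "norm (circle_pt t - circle_pt s) = 2 * \<bar>sin (pi * (t - s))\<bar>"
proof -
  have "circle_pt t - circle_pt s = cis (pi * (t + s)) * (cis (pi * (t - s)) - cis (- (pi * (t - s))))"
    by (simp add: circle_pt_def right_diff_distrib cis_mult algebra_simps)
  also have "cis (pi * (t - s)) - cis (- (pi * (t - s))) = 2 * \<i> * of_real (sin (pi * (t - s)))"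
    by (auto simp: complex_eq_iff)
  finally show ?thesis by (simp add: norm_mult)
qed

text \<open>With m the distance of the parameters modulo 1, the chord is 2 sin (pi m) and m <= 1/2,
  so the bound on the sine already yields pi m.\<close>

lemma norm_circle_pt_diff_ge:
  assumes "s \<in> {0..1}" "t \<in> {0..1}"
  shows "min \<bar>t - s\<bar> (1 - \<bar>t - s\<bar>) \<le> norm (circle_pt t - circle_pt s)"
proof -
  define u where "u = \<bar>t - s\<bar>"
  have u: "0 \<le> u" "u \<le> 1" using assms by (auto simp: u_def)
  define m where "m = min u (1 - u)"
  have m: "0 \<le> m" "m \<le> 1/2" using u unfolding m_def by linarith+
  have "\<bar>sin (pi * (t - s))\<bar> = \<bar>sin (pi * u)\<bar>"
    by (auto simp: u_def abs_if algebra_simps sin_diff)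
  also have "sin (pi * u) = sin (pi * m)"
    by (auto simp: m_def min_def algebra_simps)
  finally have "\<bar>sin (pi * (t - s))\<bar> \<ge> sin (pi * m)" by simp
  moreover have "pi * m / 2 \<le> sin (pi * m)"
    by (rule sin_ge_half) (use m in \<open>auto simp: field_simps\<close>)
  moreover have "m \<le> pi * m" using m pi_gt3 by (simp add: mult_le_cancel_right1)
  ultimately show ?thesis
    unfolding norm_circle_pt_diff m_def u_def by simp
qed

text \<open>The antiderivative is continuous across the singularity, so \<open>c\<close> can be the
  one exceptional point of the strong fundamental theorem.\<close>

lemma has_integral_inverse_sqrt_dist:
  fixes c :: real
  defines "F \<equiv> \<lambda>t. 2 * sgn (t - c) * sqrt \<bar>t - c\<bar>"
  shows "((\<lambda>t. \<bar>t - c\<bar> powr (-1/2)) has_integral (F 1 - F 0)) {0..1}"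
proof (rule fundamental_theorem_of_calculus_strong[of "{c}"])
  show "continuous_on {0..1} F"
  proof -
    have "continuous_on {0..1} (\<lambda>t. 2 * (sqrt (max 0 (t - c)) - sqrt (max 0 (c - t))))"
      by (intro continuous_intros)
    also have "(\<lambda>t. 2 * (sqrt (max 0 (t - c)) - sqrt (max 0 (c - t)))) = F"
      by (auto simp: F_def fun_eq_iff sgn_if max_def)
    finally show ?thesis .
  qed
  fix x assume x: "x \<in> {0..1} - {c}"
  show "(F has_vector_derivative \<bar>x - c\<bar> powr (-1/2)) (at x)"
  proof (cases "x > c")
    case True
    have "((\<lambda>t. 2 * sqrt (t - c)) has_real_derivative \<bar>x - c\<bar> powr (-1/2)) (at x)"
      using True by (auto intro!: derivative_eq_intros simp: powr_minus powr_half_sqrt field_simps)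
    hence "(F has_real_derivative \<bar>x - c\<bar> powr (-1/2)) (at x)"
      by (rule DERIV_cong_ev[THEN iffD1, rotated -1, OF _ refl _ refl])
         (use True in \<open>auto simp: F_def intro!: eventually_mono[OF eventually_nhds_in_open[of "{c<..}"]]\<close>)
    thus ?thesis by (simp add: has_real_derivative_iff_has_vector_derivative)
  next
    case False
    hence lt: "x < c" using x by auto
    have "((\<lambda>t. - 2 * sqrt (c - t)) has_real_derivative \<bar>x - c\<bar> powr (-1/2)) (at x)"
      using lt by (auto intro!: derivative_eq_intros simp: powr_minus powr_half_sqrt field_simps)
    hence "(F has_real_derivative \<bar>x - c\<bar> powr (-1/2)) (at x)"
      by (rule DERIV_cong_ev[THEN iffD1, rotated -1, OF _ refl _ refl])
         (use lt in \<open>auto simp: F_def intro!: eventually_mono[OF eventually_nhds_in_open[of "{..<c}"]]\<close>)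
    thus ?thesis by (simp add: has_real_derivative_iff_has_vector_derivative)
  qed
qed auto

text \<open>The range of \<open>c\<close> covers s - 1, s and s + 1 for s in the unit interval, the
  periodic copies of one singularity.\<close>

lemma integral_inverse_sqrt_dist:
  fixes c :: real
  assumes "\<bar>c\<bar> \<le> 2"
  shows "integrable circ (\<lambda>t. \<bar>t - c\<bar> powr (-1/2))" "(\<integral>t. \<bar>t - c\<bar> powr (-1/2) \<partial>circ) \<le> 8"
proof -
  define F where "F = (\<lambda>t. 2 * sgn (t - c) * sqrt \<bar>t - c\<bar>)"
  note * = has_integral_nonneg_circ[OF has_integral_inverse_sqrt_dist[of c, folded F_def]]
  show "integrable circ (\<lambda>t. \<bar>t - c\<bar> powr (-1/2))" by (rule *) auto
  have F: "\<bar>F t\<bar> \<le> 4" if "t \<in> {0..1}" for t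
  proof -
    have "sqrt \<bar>t - c\<bar> \<le> 2" by (rule real_le_lsqrt) (use that assms in auto)
    thus ?thesis by (auto simp: F_def sgn_if abs_mult)
  qed
  have "(\<integral>t. \<bar>t - c\<bar> powr (-1/2) \<partial>circ) = F 1 - F 0"
    using *(2) by (simp add: F_def)
  also have "\<dots> \<le> 8" using F[of 1] F[of 0] by auto
  finally show "(\<integral>t. \<bar>t - c\<bar> powr (-1/2) \<partial>circ) \<le> 8" .
qed

text \<open>The numerator is the diameter of the circle, which makes the kernel non-negative. At the
  singularity itself the defaults for division by 0 and for \<open>ln 0\<close> give the value
  0.\<close>

definition log_kernel :: "real \<Rightarrow> real \<Rightarrow> real" where
  "log_kernel s t = ln (2 / norm (circle_pt t - circle_pt s))"

lemma borel_measurable_log_kernel [measurable]: "log_kernel s \<in> borel_measurable borel"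
  unfolding log_kernel_def by measurable

lemma norm_circle_pt_diff_le: "norm (circle_pt t - circle_pt s) \<le> 2"
  using norm_triangle_ineq4[of "circle_pt t" "circle_pt s"] by simp

lemma log_kernel_nonneg: "0 \<le> log_kernel s t"
proof (cases "circle_pt t = circle_pt s")
  case False
  thus ?thesis using norm_circle_pt_diff_le[of t s]
    by (auto simp: log_kernel_def field_simps)
qed (simp add: log_kernel_def)

text \<open>From ln y <= 4 y^(1/4) the square is at most 16 sqrt (2 / x) <= 32 / sqrt x, with x the
  chord. The chord dominates the distance to one of three periodic copies of \<open>s\<close>, each
  with integral at most 8, and 32 * 3 * 8 = 768.\<close>

lemma log_kernel_square:
  assumes s: "s \<in> {0..1}"
  shows "integrable circ (\<lambda>t. (log_kernel s t)\<^sup>2)" "(\<integral>t. (log_kernel s t)\<^sup>2 \<partial>circ) \<le> 768"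
proof -
  define g where "g = (\<lambda>t. 32 * (\<bar>t - s\<bar> powr (-1/2) + \<bar>t - (s - 1)\<bar> powr (-1/2) + \<bar>t - (s + 1)\<bar> powr (-1/2)))"
  have ints: "integrable circ (\<lambda>t. \<bar>t - s\<bar> powr (-1/2))" "integrable circ (\<lambda>t. \<bar>t - (s - 1)\<bar> powr (-1/2))"
    "integrable circ (\<lambda>t. \<bar>t - (s + 1)\<bar> powr (-1/2))"
    by (rule integral_inverse_sqrt_dist; use s in simp)+
  have int: "integrable circ g" unfolding g_def
    by (intro integrable_mult_right Bochner_Integration.integrable_add ints)
  have le: "(log_kernel s t)\<^sup>2 \<le> g t" if t: "t \<in> {0..1}" for t
  proof (cases "circle_pt t = circle_pt s")
    case True thus ?thesis by (simp add: log_kernel_def g_def)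
  next
    case False
    define x where "x = norm (circle_pt t - circle_pt s)"
    have x: "x > 0" "x \<le> 2" using False norm_circle_pt_diff_le by (auto simp: x_def)
    have "log_kernel s t \<le> (2/x) powr (1/4) / (1/4)"
      unfolding log_kernel_def x_def[symmetric] by (rule ln_powr_bound) (use x in auto)
    hence "(log_kernel s t)\<^sup>2 \<le> ((2/x) powr (1/4) / (1/4))\<^sup>2"
      by (intro power_mono log_kernel_nonneg)
    also have "\<dots> = 16 * (2/x) powr (1/2)"
      by (simp add: power2_eq_square powr_add[symmetric])
    also have "\<dots> = 16 * (2 powr (1/2) * x powr (-1/2))"
      using x by (simp add: powr_divide powr_minus field_simps)
    also have "\<dots> \<le> 16 * (2 powr 1 * x powr (-1/2))"
      by (intro mult_left_mono mult_right_mono powr_mono) auto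
    also have "\<dots> = 32 * x powr (-1/2)" by simp
    finally have 1: "(log_kernel s t)\<^sup>2 \<le> 32 * x powr (-1/2)" .
    define m where "m = min \<bar>t - s\<bar> (1 - \<bar>t - s\<bar>)"
    have "m \<le> x" using norm_circle_pt_diff_ge[OF s t] by (simp add: x_def m_def)
    have "t \<noteq> s" using False by auto
    have "\<bar>t - s\<bar> \<noteq> 1"
    proof
      assume "\<bar>t - s\<bar> = 1"
      hence "(t = 1 \<and> s = 0) \<or> (t = 0 \<and> s = 1)" using s t by auto
      thus False using False by (auto simp: circle_pt_def cis_2pi)
    qed
    hence m0: "m > 0" using \<open>t \<noteq> s\<close> s t by (auto simp: m_def)
    have "x powr (-1/2) \<le> m powr (-1/2)"
      by (rule powr_mono2') (use m0 \<open>m \<le> x\<close> in auto)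
    also have "m = \<bar>t - s\<bar> \<or> m = \<bar>t - (s - 1)\<bar> \<or> m = \<bar>t - (s + 1)\<bar>"
      using s t by (auto simp: m_def)
    hence "m powr (-1/2) \<le> \<bar>t - s\<bar> powr (-1/2) + \<bar>t - (s - 1)\<bar> powr (-1/2) + \<bar>t - (s + 1)\<bar> powr (-1/2)"
      by (elim disjE) (simp_all add: add_increasing add_increasing2)
    finally show ?thesis using 1 by (simp add: g_def)
  qed
  show 1: "integrable circ (\<lambda>t. (log_kernel s t)\<^sup>2)"
    by (rule Bochner_Integration.integrable_bound[OF int])
       (use le in \<open>auto intro!: measurable_circI AE_I2 order_trans[OF le]\<close>)
  have "(\<integral>t. (log_kernel s t)\<^sup>2 \<partial>circ) \<le> (\<integral>t. g t \<partial>circ)"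
    by (intro integral_mono 1 int) (use le in auto)
  also have "\<dots> = 32 * ((\<integral>t. \<bar>t - s\<bar> powr (-1/2) \<partial>circ) + (\<integral>t. \<bar>t - (s - 1)\<bar> powr (-1/2) \<partial>circ)
      + (\<integral>t. \<bar>t - (s + 1)\<bar> powr (-1/2) \<partial>circ))"
    unfolding g_def using ints by simp
  also have "\<dots> \<le> 32 * (8 + 8 + 8)"
    by (intro mult_left_mono add_mono integral_inverse_sqrt_dist) (use s in auto)
  finally show "(\<integral>t. (log_kernel s t)\<^sup>2 \<partial>circ) \<le> 768" by simp
qed

subsection \<open>Fourier coefficients of the logarithm of the modulus\<close>

text \<open>Cauchy's formula for the k-th derivative: on the unit circle conjugation is inversion,
  so the conjugate powers are the Cauchy kernel.\<close>

lemma integral_circ_holomorphic: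
  assumes "g holomorphic_on ball 0 R" "0 < r" "r < R"
  shows "(\<integral>t. g (on_circle r t) * cnj (circle_pt t) ^ k \<partial>circ) = (deriv ^^ k) g 0 / fact k * of_real r ^ k"
proof -
  have cont: "continuous_on (cball 0 r) g"
    by (rule holomorphic_on_imp_continuous_on[OF holomorphic_on_subset[OF assms(1)]]) (use assms in auto)
  have hol: "g holomorphic_on ball 0 r"
    by (rule holomorphic_on_subset[OF assms(1)]) (use assms in auto)
  have "((\<lambda>u. g u / (u - 0) ^ (Suc k)) has_contour_integral ((2 * pi * \<i>) / (fact k) * (deriv ^^ k) g 0)) (circlepath 0 r)"
    by (rule Cauchy_has_contour_integral_higher_derivative_circlepath[OF cont hol]) (use assms in auto)
  hence "((\<lambda>t. g (circlepath 0 r t) / (circlepath 0 r t) ^ Suc k * (2 * pi * \<i> * r * exp (2 * of_real pi * \<i> * t)))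
     has_integral (2 * pi * \<i>) / (fact k) * (deriv ^^ k) g 0) {0..1}"
    unfolding has_contour_integral_def
    by (rule has_integral_eq[rotated]) (auto simp: vector_derivative_circlepath01)
  note has_integral_mult_right[OF this, of "of_real r ^ k / (2 * pi * \<i>)"]
  also have "of_real r ^ k / (2 * pi * \<i>) * ((2 * pi * \<i>) / (fact k) * (deriv ^^ k) g 0)
      = (deriv ^^ k) g 0 / fact k * of_real r ^ k"
    by (simp add: field_simps)
  finally have "((\<lambda>t. of_real r ^ k / (2 * pi * \<i>) * (g (circlepath 0 r t) / (circlepath 0 r t) ^ Suc k *
            (2 * pi * \<i> * r * exp (2 * of_real pi * \<i> * t)))) has_integral
           (deriv ^^ k) g 0 / fact k * of_real r ^ k) {0..1}" .
  hence "((\<lambda>t. g (on_circle r t) * cnj (circle_pt t) ^ k) has_integral 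
           (deriv ^^ k) g 0 / fact k * of_real r ^ k) {0..1}"
  proof (rule has_integral_eq[rotated])
    fix t :: real
    have *: "circlepath 0 r t = on_circle r t" "exp (2 * of_real pi * \<i> * t) = circle_pt t"
      by (simp_all add: circlepath circle_pt_def cis_conv_exp mult_ac)
    show "of_real r ^ k / (2 * pi * \<i>) * (g (circlepath 0 r t) / (circlepath 0 r t) ^ Suc k *
            (2 * pi * \<i> * r * exp (2 * of_real pi * \<i> * t))) = g (on_circle r t) * cnj (circle_pt t) ^ k"
      unfolding * using assms(2) by (simp add: cnj_circle_pt field_simps)
  qed
  moreover have "integrable circ (\<lambda>t. g (on_circle r t) * cnj (circle_pt t) ^ k)"
    by (intro integrable_circ_continuous continuous_intros continuous_on_compose2[OF cont])
       (use assms in \<open>auto simp: norm_mult\<close>)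
  ultimately show ?thesis
    using integral_circ_has_integral has_integral_unique by blast
qed

definition fourier_log :: "(complex \<Rightarrow> complex) \<Rightarrow> nat \<Rightarrow> real \<Rightarrow> complex" where
  "fourier_log f k r = (\<integral>t. of_real (ln_mod f r t) * cnj (circle_pt t) ^ k \<partial>circ)"

text \<open>Here ln |F| is the real part of \<open>g\<close>, that is half of g plus its conjugate.
  The first half gives the Taylor coefficient of \<open>g\<close>; the second gives the conjugate of
  the mean of g(z) z^k, which vanishes for k > 0 by the mean value property.\<close>

lemma fourier_log_exp:
  assumes g: "g holomorphic_on ball 0 R" and r: "0 < r" "r < R"
    and F: "\<And>z. z \<in> ball 0 R \<Longrightarrow> norm (F z) = exp (Re (g z))"
  shows "fourier_log F k r = (if k = 0 then of_real (Re (g 0)) else (deriv ^^ k) g 0 / fact k * of_real r ^ k / 2)"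
proof -
  have cont: "continuous_on (cball 0 r) g"
    by (rule holomorphic_on_imp_continuous_on[OF holomorphic_on_subset[OF g]]) (use r in auto)
  define I where "I = (\<lambda>k. \<integral>t. g (on_circle r t) * cnj (circle_pt t) ^ k \<partial>circ)"
  define J where "J = (\<lambda>k. \<integral>t. g (on_circle r t) * circle_pt t ^ k \<partial>circ)"
  have I: "I k = (deriv ^^ k) g 0 / fact k * of_real r ^ k" for k
    unfolding I_def by (rule integral_circ_holomorphic[OF g r])
  have J: "J k = g 0 * 0 ^ k"
  proof -
    have "(\<integral>t. (\<lambda>z. g z * z ^ k) (on_circle r t) * cnj (circle_pt t) ^ 0 \<partial>circ) = 
        (deriv ^^ 0) (\<lambda>z. g z * z ^ k) 0 / fact 0 * of_real r ^ 0"
      by (rule integral_circ_holomorphic) (use g r in \<open>auto intro!: holomorphic_intros\<close>)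
    also have "(\<lambda>t. (\<lambda>z. g z * z ^ k) (on_circle r t) * cnj (circle_pt t) ^ 0)
       = (\<lambda>t. of_real r ^ k * (g (on_circle r t) * circle_pt t ^ k))"
      by (simp add: power_mult_distrib mult_ac)
    finally have "of_real r ^ k * J k = g 0 * 0 ^ k" by (simp add: J_def)
    thus ?thesis using r by (cases k) auto
  qed
  have int: "integrable circ (\<lambda>t. g (on_circle r t) * cnj (circle_pt t) ^ k)"
            "integrable circ (\<lambda>t. g (on_circle r t) * circle_pt t ^ k)"
    by (intro integrable_circ_continuous continuous_intros continuous_on_compose2[OF cont];
       use r in \<open>auto simp: norm_mult\<close>)+
  have "fourier_log F k r = (\<integral>t. (g (on_circle r t) * cnj (circle_pt t) ^ k + 
     cnj (g (on_circle r t) * circle_pt t ^ k)) / 2 \<partial>circ)"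
    unfolding fourier_log_def
  proof (rule Bochner_Integration.integral_cong[OF refl])
    fix t
    have "norm (F (on_circle r t)) = exp (Re (g (on_circle r t)))"
      by (rule F) (use r in \<open>auto simp: norm_mult\<close>)
    thus "of_real (ln_mod F r t) * cnj (circle_pt t) ^ k =
      (g (on_circle r t) * cnj (circle_pt t) ^ k + cnj (g (on_circle r t) * circle_pt t ^ k)) / 2"
      by (simp add: complex_eq_iff)
  qed
  also have "\<dots> = (I k + cnj (J k)) / 2"
    using int by (simp add: I_def J_def del: complex_cnj_mult complex_cnj_power)
  also have "\<dots> = (if k = 0 then of_real (Re (g 0)) else (deriv ^^ k) g 0 / fact k * of_real r ^ k / 2)"
    unfolding I J by (auto simp: complex_add_cnj)
  finally show ?thesis .
qed

section \<open>Linear factors with the zero outside, on and inside the circle\<close>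

lemma higher_deriv_Ln_one_minus:
  assumes "a \<noteq> 0" "z \<in> ball 0 (norm a)"
  shows "(deriv ^^ Suc k) (\<lambda>z. Ln (1 - z / a)) z = - fact k / (a - z) ^ Suc k"
  using assms(2)
proof (induction k arbitrary: z)
  case 0
  have "norm (z / a) < 1" using 0 assms by (simp add: norm_divide)
  hence "Re (1 - z / a) > 0" using complex_Re_le_cmod[of "z/a"] by simp
  hence "1 - z / a \<notin> \<real>\<^sub>\<le>\<^sub>0" using complex_nonpos_Reals_iff by auto
  moreover have "z \<noteq> a" using 0 by auto
  ultimately have "((\<lambda>z. Ln (1 - z / a)) has_field_derivative - 1 / (a - z)) (at z)"
    using assms by (auto intro!: derivative_eq_intros simp: field_simps)
  thus ?case by (simp add: DERIV_imp_deriv)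
next
  case (Suc k)
  have za: "a - z \<noteq> 0" using Suc.prems by auto
  have "(deriv ^^ Suc (Suc k)) (\<lambda>z. Ln (1 - z / a)) z = deriv ((deriv ^^ Suc k) (\<lambda>z. Ln (1 - z / a))) z"
    by simp
  also have "\<dots> = deriv (\<lambda>z. - fact k / (a - z) ^ Suc k) z"
  proof (rule deriv_cong_ev)
    have "eventually (\<lambda>w. w \<in> ball 0 (norm a)) (nhds z)"
      using Suc.prems by (intro eventually_nhds_in_open) auto
    thus "\<forall>\<^sub>F x in nhds z. (deriv ^^ Suc k) (\<lambda>z. Ln (1 - z / a)) x = - fact k / (a - x) ^ Suc k"
      by eventually_elim (rule Suc.IH)
  qed auto
  also have "\<dots> = - fact (Suc k) / (a - z) ^ Suc (Suc k)"
  proof (rule DERIV_imp_deriv)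
    have "((\<lambda>z. a - z) has_field_derivative - 1) (at z)"
      by (auto intro!: derivative_eq_intros)
    from DERIV_power[OF this, of "Suc k"]
    have P: "((\<lambda>z. (a - z) ^ Suc k) has_field_derivative of_nat (Suc k) * (a - z) ^ k * (- 1)) (at z)"
      by (simp add: mult_ac del: power_Suc of_nat_Suc)
    have "((\<lambda>z. - fact k * inverse ((a - z) ^ Suc k)) has_field_derivative
        - fact k * (- (inverse ((a - z) ^ Suc k) * (of_nat (Suc k) * (a - z) ^ k * (- 1)) * inverse ((a - z) ^ Suc k)))) (at z)"
      using P za by (intro DERIV_cmult DERIV_inverse') auto
    also have "- fact k * (- (inverse ((a - z) ^ Suc k) * (of_nat (Suc k) * (a - z) ^ k * (- 1)) * inverse ((a - z) ^ Suc k)))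
       = - fact (Suc k) / (a - z) ^ Suc (Suc k)"
    proof -
      define u where "u = a - z"
      define X where "X = u ^ k"
      have "u \<noteq> 0" "X \<noteq> 0" using za by (auto simp: u_def X_def)
      thus ?thesis unfolding u_def[symmetric] power_Suc X_def[symmetric]
        by (simp add: field_simps)
    qed
    finally show "((\<lambda>z. - fact k / (a - z) ^ Suc k) has_field_derivative - fact (Suc k) / (a - z) ^ Suc (Suc k)) (at z)"
      by (simp add: field_simps)
  qed
  finally show ?case .
qed

lemma fourier_log_linear_outside:
  assumes "0 < r" "r < norm a"
  shows "fourier_log (\<lambda>z. 1 - z / a) k r = (if k = 0 then 0 else - ((of_real r / a) ^ k / (2 * of_nat k)))"
proof -
  have a: "a \<noteq> 0" using assms by auto
  have pos: "1 - z / a \<noteq> 0 \<and> 1 - z / a \<notin> \<real>\<^sub>\<le>\<^sub>0" if "z \<in> ball 0 (norm a)" for z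
  proof -
    have "norm (z / a) < 1" using that a by (simp add: norm_divide)
    hence "Re (1 - z / a) > 0" using complex_Re_le_cmod[of "z/a"] by simp
    thus ?thesis using complex_nonpos_Reals_iff by force
  qed
  have "fourier_log (\<lambda>z. 1 - z / a) k r = (if k = 0 then of_real (Re (Ln (1 - 0 / a))) 
      else (deriv ^^ k) (\<lambda>z. Ln (1 - z / a)) 0 / fact k * of_real r ^ k / 2)"
    by (rule fourier_log_exp[OF _ assms]) (use pos a in \<open>auto intro!: holomorphic_intros\<close>)
  also have "\<dots> = (if k = 0 then 0 else - ((of_real r / a) ^ k / (2 * of_nat k)))"
  proof (cases k)
    case (Suc j)
    show ?thesis unfolding Suc
      using a by (subst higher_deriv_Ln_one_minus)
        (simp_all add: power_divide fact_Suc del: of_nat_Suc power_Suc)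
  qed simp
  finally show ?thesis .
qed

text \<open>Reflection of the zero in the circle of radius \<open>r\<close>. The constant factor r /
  |a| that it produces is the origin of the terms in Jensen's formula.\<close>

lemma norm_linear_factor_reflect:
  assumes "a \<noteq> 0" "r > 0"
  shows "norm (1 - on_circle r t / a) = (r / norm a) * norm (1 - on_circle r t / (of_real (r\<^sup>2) / cnj a))"
proof -
  have "norm (1 - on_circle r t / (of_real (r\<^sup>2) / cnj a)) = norm (cnj (1 - on_circle r t / (of_real (r\<^sup>2) / cnj a)))"
    by (rule complex_mod_cnj[symmetric])
  also have "cnj (1 - on_circle r t / (of_real (r\<^sup>2) / cnj a)) = 1 - a * inverse (circle_pt t) / of_real r"
    using assms by (simp add: cnj_circle_pt power2_eq_square field_simps)
  also have "\<dots> = (- a / (on_circle r t)) * (1 - on_circle r t / a)"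
    using assms by (simp add: field_simps)
  finally have "norm (1 - on_circle r t / (of_real (r\<^sup>2) / cnj a)) =
      norm a / r * norm (1 - on_circle r t / a)"
    using assms by (simp add: norm_mult norm_divide)
  thus ?thesis using assms by simp
qed

lemma log_kernel_integrable:
  assumes "s \<in> {0..1}"
  shows "integrable circ (log_kernel s)"
proof (rule Bochner_Integration.integrable_bound)
  show "integrable circ (\<lambda>t. 1 + (log_kernel s t)\<^sup>2)"
    by (intro Bochner_Integration.integrable_add integrable_circ_const log_kernel_square assms)
  have "x \<le> 1 + x\<^sup>2" for x :: real
    using zero_le_power2[of "x - 1/2"] by (simp add: power2_eq_square algebra_simps)
  thus "AE t in circ. norm (log_kernel s t) \<le> norm (1 + (log_kernel s t)\<^sup>2)"
    using log_kernel_nonneg by (auto intro!: AE_I2)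
qed (auto intro!: measurable_circI)

text \<open>The bound must not depend on the radius. Moving the point radially from radius r to |a|
  costs at most | |a| - r |, which is itself at most its distance from \<open>a\<close>; hence the
  factor 1/2.\<close>

lemma norm_linear_factor_ge:
  assumes "a = of_real (norm a) * circle_pt s" "a \<noteq> 0" "0 \<le> r"
  shows "norm (circle_pt t - circle_pt s) / 2 \<le> norm (1 - on_circle r t / a)"
proof -
  define R where "R = norm a"
  have R: "R > 0" using assms by (simp add: R_def)
  define d where "d = norm (of_real R * circle_pt s - on_circle r t)"
  have "\<bar>R - r\<bar> \<le> d"
    unfolding d_def using norm_triangle_ineq3[of "of_real R * circle_pt s" "on_circle r t"] R assms(3)
    by (simp add: norm_mult)
  have "R * norm (circle_pt t - circle_pt s) = norm (of_real R * circle_pt s - on_circle R t)"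
    using R by (simp add: norm_minus_commute norm_mult flip: right_diff_distrib)
  also have "\<dots> \<le> d + norm (on_circle r t - on_circle R t)"
    unfolding d_def using norm_triangle_ineq[of "of_real R * circle_pt s - on_circle r t"
        "on_circle r t - on_circle R t"] by simp
  also have "norm (on_circle r t - on_circle R t) = \<bar>R - r\<bar>"
    by (simp add: norm_mult flip: left_diff_distrib of_real_diff)
  finally have "R * norm (circle_pt t - circle_pt s) \<le> 2 * d" using \<open>\<bar>R - r\<bar> \<le> d\<close> by simp
  moreover have "norm (1 - on_circle r t / a) = d / R"
  proof -
    have "1 - on_circle r t / a = (a - on_circle r t) / a"
      using assms by (simp add: diff_divide_distrib)
    thus ?thesis using assms(1) by (simp add: norm_divide d_def R_def)
  qed
  moreover from calculation have "norm (circle_pt t - circle_pt s) \<le> 2 * d / R"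
    using R by (simp add: pos_le_divide_eq mult.commute)
  ultimately show ?thesis by (simp add: mult.commute)
qed

lemma ln_linear_factor_ge:
  assumes "a = of_real (norm a) * circle_pt s" "a \<noteq> 0" "0 \<le> r" "circle_pt t \<noteq> circle_pt s"
  shows "- log_kernel s t \<le> ln (norm (1 - on_circle r t / a))"
proof -
  have "ln (norm (circle_pt t - circle_pt s) / 2) \<le> ln (norm (1 - on_circle r t / a))"
    by (intro ln_mono norm_linear_factor_ge assms) (use assms in auto)
  moreover have "log_kernel s t = - ln (norm (circle_pt t - circle_pt s) / 2)"
    using assms(4) by (simp add: log_kernel_def ln_div)
  ultimately show ?thesis by simp
qed

lemma ln_linear_factor_le:
  assumes "0 \<le> r"
  shows "ln (norm (1 - on_circle r t / a)) \<le> ln (1 + r / norm a)"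
proof (cases "1 - on_circle r t / a = 0")
  case False
  have "norm (1 - on_circle r t / a) \<le> 1 + r / norm a"
    using norm_triangle_ineq4[of 1 "on_circle r t / a"] assms by (simp add: norm_mult norm_divide)
  moreover have "0 < 1 + r / norm a" using assms by (intro add_pos_nonneg) auto
  ultimately show ?thesis using False by (subst ln_le_cancel_iff) auto
qed (use assms in auto)

text \<open>The only exceptional direction is that of \<open>a\<close>, the same for every radius.
  The right-hand side serves as an integrable majorant.\<close>

lemma AE_abs_ln_linear_factor_le:
  assumes "a = of_real (norm a) * circle_pt s" "a \<noteq> 0"
  shows "AE t in circ. \<forall>r\<ge>0. \<bar>ln (norm (1 - on_circle r t / a))\<bar> \<le> log_kernel s t + ln (1 + r / norm a)"
  using AE_circ_circle_pt_neq[of "circle_pt s"]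
proof eventually_elim
  case (elim t)
  show ?case
  proof (intro allI impI)
    fix r :: real assume r: "r \<ge> 0"
    have "0 \<le> ln (1 + r / norm a)" using r by simp
    thus "\<bar>ln (norm (1 - on_circle r t / a))\<bar> \<le> log_kernel s t + ln (1 + r / norm a)"
      using ln_linear_factor_ge[OF assms r elim] ln_linear_factor_le[OF r, of t a] log_kernel_nonneg[of s t] by linarith
  qed
qed

lemma integrable_ln_linear_factor:
  assumes "a \<noteq> 0" "0 \<le> r"
  shows "integrable circ (\<lambda>t. ln (norm (1 - on_circle r t / a)))"
proof -
  obtain s where s: "s \<in> {0..1}" "a = of_real (norm a) * circle_pt s" using circle_pt_polar by blast
  show ?thesis
  proof (rule Bochner_Integration.integrable_bound)
    show "integrable circ (\<lambda>t. log_kernel s t + ln (1 + r / norm a))"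
      by (intro Bochner_Integration.integrable_add integrable_circ_const log_kernel_integrable s)
    show "AE t in circ. norm (ln (norm (1 - on_circle r t / a))) \<le> norm (log_kernel s t + ln (1 + r / norm a))"
      using AE_abs_ln_linear_factor_le[OF s(2) assms(1)] by eventually_elim (use assms(2) in force)
  qed (auto intro!: measurable_circI)
qed

lemma borel_measurable_cnj_circle_pt [measurable]: "(\<lambda>t. cnj (circle_pt t)) \<in> borel_measurable borel"
  by (intro borel_measurable_continuous_onI continuous_intros)

lemma integrable_mult_circle_pt_power:
  assumes "integrable circ (u :: real \<Rightarrow> real)"
  shows "integrable circ (\<lambda>t. of_real (u t) * cnj (circle_pt t) ^ k)"
proof (rule Bochner_Integration.integrable_bound[OF assms])
  show "(\<lambda>t. of_real (u t) * cnj (circle_pt t) ^ k) \<in> borel_measurable circ"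
    using borel_measurable_integrable[OF assms] measurable_circI[OF borel_measurable_cnj_circle_pt] by measurable
qed (auto simp: norm_mult norm_power)

lemma integral_cnj_circle_pt_power: "(\<integral>t. cnj (circle_pt t) ^ k \<partial>circ) = (if k = 0 then 1 else 0)"
  using integral_circ_holomorphic[of "\<lambda>_. 1" 2 1 k] by (cases k) (auto simp del: funpow.simps simp: higher_deriv_const)

text \<open>One closed form for zeros inside, on and outside the circle: reflection exchanges r /
  |a| and |a| / r, and only a zero inside contributes to the mean value.\<close>

definition linear_factor_coeff :: "nat \<Rightarrow> real \<Rightarrow> complex \<Rightarrow> complex" where
  "linear_factor_coeff k r a = (if k = 0 then of_real (max 0 (ln (r / norm a)))
     else - (cnj (sgn a) ^ k * of_real (min (r / norm a) (norm a / r)) ^ k / (2 * of_nat k)))"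

lemma of_real_div_eq_sgn: "of_real r / a = of_real (r / norm a) * cnj (sgn a)"
proof (cases "a = 0")
  case False
  have "a * cnj a = of_real (norm a) * of_real (norm a)" 
    using complex_norm_square[of a] by (simp add: power2_eq_square)
  thus ?thesis using False by (simp add: sgn_div_norm scaleR_conv_of_real field_simps)
qed auto

text \<open>Approach from smaller radii. The logarithmic kernel dominates all of them at once, so
  the formula for a zero outside passes to the limit.\<close>

lemma fourier_log_linear_boundary:
  assumes "r = norm a" "a \<noteq> 0"
  shows "fourier_log (\<lambda>z. 1 - z / a) k r = (if k = 0 then 0 else - ((of_real r / a) ^ k / (2 * of_nat k)))"
proof -
  obtain s where s: "s \<in> {0..1}" "a = of_real (norm a) * circle_pt s" using circle_pt_polar by blast
  \<comment> \<open>The two successors make the subtracted fraction at most 1/2, so that already the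
    first radius is positive.\<close>
  define \<rho> where "\<rho> = (\<lambda>n::nat. r * (1 - inverse (real (Suc (Suc n)))))"
  have r: "r > 0" using assms by auto
  have \<rho>: "0 < \<rho> n" "\<rho> n < r" for n using r by (auto simp: \<rho>_def field_simps add_pos_nonneg)
  have lim: "\<rho> \<longlonglongrightarrow> r"
  proof -
    have "(\<lambda>n. r * (1 - inverse (real (Suc (Suc n))))) \<longlonglongrightarrow> r * (1 - 0)"
      by (intro tendsto_intros LIMSEQ_Suc[OF LIMSEQ_inverse_real_of_nat])
    thus ?thesis by (simp add: \<rho>_def)
  qed
  have lim1: "(\<lambda>n. fourier_log (\<lambda>z. 1 - z / a) k (\<rho> n)) \<longlonglongrightarrow> fourier_log (\<lambda>z. 1 - z / a) k r"
    unfolding fourier_log_def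
  proof (rule integral_dominated_convergence)
    show "integrable circ (\<lambda>t. log_kernel s t + ln 2)"
      by (intro Bochner_Integration.integrable_add integrable_circ_const log_kernel_integrable s)
    show "AE t in circ. (\<lambda>n. of_real (ln (norm (1 - on_circle (\<rho> n) t / a))) * cnj (circle_pt t) ^ k)
       \<longlonglongrightarrow> of_real (ln (norm (1 - on_circle r t / a))) * cnj (circle_pt t) ^ k"
      using AE_circ_circle_pt_neq[of "a / of_real r"]
    proof eventually_elim
      case (elim t)
      hence "1 - on_circle r t / a \<noteq> 0" using r assms by (auto simp: field_simps)
      thus ?case using assms(2) by (intro tendsto_intros lim) simp_all
    qed
    show "AE t in circ. norm (of_real (ln (norm (1 - on_circle (\<rho> n) t / a))) * cnj (circle_pt t) ^ k) \<le> log_kernel s t + ln 2" for n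
      using AE_abs_ln_linear_factor_le[OF s(2) assms(2)]
    proof eventually_elim
      case (elim t)
      have "\<rho> n / norm a \<le> 1" using \<rho>[of n] r assms by auto
      hence "ln (1 + \<rho> n / norm a) \<le> ln 2" using \<rho>[of n] by (subst ln_le_cancel_iff) (auto intro: add_pos_nonneg)
      with elim[rule_format, of "\<rho> n"] \<rho>[of n] show ?case by (simp add: norm_mult norm_power)
    qed
  qed (auto intro!: measurable_circI)
  have eq: "fourier_log (\<lambda>z. 1 - z / a) k (\<rho> n) = (if k = 0 then 0 else - ((of_real (\<rho> n) / a) ^ k / (2 * of_nat k)))" for n
    by (rule fourier_log_linear_outside) (use \<rho> assms in auto)
  have lim2: "(\<lambda>n. if k = 0 then 0 else - ((of_real (\<rho> n) / a) ^ k / (2 * of_nat k))) \<longlonglongrightarrow>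
     (if k = 0 then 0 else - ((of_real r / a) ^ k / (2 * of_nat k)))"
  proof (cases "k = 0")
    case False
    have "(\<lambda>n. - ((of_real (\<rho> n) / a) ^ k / (2 * of_nat k))) \<longlonglongrightarrow> - ((of_real r / a) ^ k / (2 * of_nat k))"
      by (intro tendsto_intros lim) (use False assms(2) in simp_all)
    thus ?thesis using False by simp
  qed simp
  show ?thesis by (rule LIMSEQ_unique[OF lim1[unfolded eq] lim2])
qed

lemma fourier_log_linear:
  assumes "a \<noteq> 0" "0 < r"
  shows "fourier_log (\<lambda>z. 1 - z / a) k r = linear_factor_coeff k r a"
proof (cases "r \<le> norm a")
  case True
  hence "min (r / norm a) (norm a / r) = r / norm a"
    using assms by (smt (verit) divide_le_eq_1_pos le_divide_eq_1_pos zero_less_norm_iff)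
  moreover have "fourier_log (\<lambda>z. 1 - z / a) k r = (if k = 0 then 0 else - ((of_real r / a) ^ k / (2 * of_nat k)))"
    using True fourier_log_linear_outside[of r a k] fourier_log_linear_boundary[of r a k] assms by force
  moreover have "ln (r / norm a) \<le> 0" using True assms by (simp add: ln_le_zero_iff)
  moreover have "(of_real r / a) ^ k = cnj (sgn a) ^ k * of_real (r / norm a) ^ k"
    by (subst of_real_div_eq_sgn) (simp add: power_mult_distrib mult_ac power_divide)
  ultimately show ?thesis by (simp add: linear_factor_coeff_def max_def)
next
  case False
  \<comment> \<open>The mirror image of \<open>a\<close> lies outside the circle, where the formula
    from the holomorphic logarithm applies; the constant from the reflection enters the coefficient
    of index 0 alone.\<close>
  define b where "b = of_real (r\<^sup>2) / cnj a"
  have b: "b \<noteq> 0" using assms by (simp add: b_def)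
  have nb: "norm b = r\<^sup>2 / norm a" using assms by (simp add: b_def norm_divide norm_power)
  have "1 < r / norm a" using False assms by simp
  hence rb: "r < norm b" using mult_strict_left_mono[of 1 "r / norm a" r] assms nb by (simp add: power2_eq_square)
  have nz: "1 - on_circle r t / b \<noteq> 0" for t
  proof
    assume "1 - on_circle r t / b = 0"
    hence "on_circle r t = b" using b by (simp add: field_simps)
    hence "norm b = r" using assms(2) by (auto simp: norm_mult)
    thus False using rb by simp
  qed
  have eq: "of_real (ln (norm (1 - on_circle r t / a))) * cnj (circle_pt t) ^ k =
     of_real (ln (r / norm a)) * cnj (circle_pt t) ^ k + of_real (ln (norm (1 - on_circle r t / b))) * cnj (circle_pt t) ^ k" for t
  proof -
    have "ln (norm (1 - on_circle r t / a)) = ln (r / norm a) + ln (norm (1 - on_circle r t / b))"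
      by (subst norm_linear_factor_reflect[OF assms, of t], subst ln_mult)
         (use nz[of t] assms in \<open>simp_all add: b_def\<close>)
    thus ?thesis by (simp add: ring_distribs)
  qed
  have "fourier_log (\<lambda>z. 1 - z / a) k r = of_real (ln (r / norm a)) * (\<integral>t. cnj (circle_pt t) ^ k \<partial>circ) + fourier_log (\<lambda>z. 1 - z / b) k r"
    unfolding fourier_log_def eq
    by (subst Bochner_Integration.integral_add)
       (use b assms in \<open>auto intro!: integrable_mult_circle_pt_power integrable_ln_linear_factor integrable_circ_const\<close>)
  also have "fourier_log (\<lambda>z. 1 - z / b) k r = (if k = 0 then 0 else - ((of_real r / b) ^ k / (2 * of_nat k)))"
    by (rule fourier_log_linear_outside) (use rb assms in auto)
  also have "of_real r / b = of_real (norm a / r) * cnj (sgn a)"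
    using assms by (simp add: b_def sgn_div_norm scaleR_conv_of_real field_simps power2_eq_square)
  finally have "fourier_log (\<lambda>z. 1 - z / a) k r = of_real (ln (r / norm a)) * (if k = 0 then 1 else 0) +
     (if k = 0 then 0 else - ((of_real (norm a / r) * cnj (sgn a)) ^ k / (2 * of_nat k)))"
    by (simp add: integral_cnj_circle_pt_power)
  moreover have "min (r / norm a) (norm a / r) = norm a / r"
    using False assms by (smt (verit) divide_le_eq_1_pos le_divide_eq_1_pos zero_less_norm_iff)
  moreover have "ln (r / norm a) \<ge> 0" using False assms by simp
  ultimately show ?thesis
    by (simp add: linear_factor_coeff_def power_mult_distrib power_divide mult_ac max_def)
qed

lemma borel_measurable_circ_continuous:
  fixes f :: "real \<Rightarrow> 'a :: topological_space"
  assumes "continuous_on {0..1} f"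
  shows "f \<in> borel_measurable circ"
proof -
  have "sets circ = sets (restrict_space borel {0..1})"
    by (simp add: circ_def sets_restrict_space)
  thus ?thesis
    using borel_measurable_continuous_on_restrict[OF assms] measurable_cong_sets by blast
qed

text \<open>Zeros on the circle itself are allowed: the logarithm of the product splits in all but
  finitely many directions, and each singular summand is integrable.\<close>

lemma fourier_log_product:
  assumes f: "\<And>w. w \<in> ball 0 R \<Longrightarrow> f w = w ^ m * G w * (\<Prod>i\<in>S. 1 - w / a i)"
    and G: "G holomorphic_on ball 0 R" "\<And>w. w \<in> ball 0 R \<Longrightarrow> G w \<noteq> 0"
    and S: "finite S" "\<And>i. i \<in> S \<Longrightarrow> a i \<noteq> 0" and r: "0 < r" "r < R"
  shows "AE t in circ. ln_mod f r t = m * ln r + ln_mod G r t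
            + (\<Sum>i\<in>S. ln (norm (1 - on_circle r t / a i)))" (is ?ae)
    and "integrable circ (\<lambda>t. ln_mod f r t)"
    and "fourier_log f k r = (if k = 0 then of_real (m * ln r) else 0) + fourier_log G k r + (\<Sum>i\<in>S. linear_factor_coeff k r (a i))"
proof -
  have in_ball: "on_circle r t \<in> ball 0 R" for t
    using r by (simp add: norm_mult)
  have "AE t in circ. \<forall>i\<in>S. circle_pt t \<noteq> a i / of_real r"
    by (intro AE_finite_allI S AE_circ_circle_pt_neq)
  thus ae: ?ae
  proof eventually_elim
    case (elim t)
    let ?w = "on_circle r t"
    have nz: "1 - ?w / a i \<noteq> 0" if "i \<in> S" for i
      using elim[rule_format, OF that] S(2)[OF that] r by (auto simp: field_simps)
    have "norm (f ?w) = r ^ m * norm (G ?w) * (\<Prod>i\<in>S. norm (1 - ?w / a i))"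
      using r by (simp add: f[OF in_ball] norm_mult norm_power prod_norm)
    also have "ln \<dots> = ln (r ^ m) + ln (norm (G ?w)) + ln (\<Prod>i\<in>S. norm (1 - ?w / a i))"
    proof -
      have "(\<Prod>i\<in>S. norm (1 - ?w / a i)) \<noteq> 0" using S nz by (simp add: prod_zero_iff)
      moreover have "(\<Prod>i\<in>S. norm (1 - ?w / a i)) \<ge> 0" by (intro prod_nonneg) auto
      ultimately have "(\<Prod>i\<in>S. norm (1 - ?w / a i)) > 0" by linarith
      thus ?thesis using r G(2)[OF in_ball, of t] by (simp add: ln_mult_pos)
    qed
    also have "ln (\<Prod>i\<in>S. norm (1 - ?w / a i)) = (\<Sum>i\<in>S. ln (norm (1 - ?w / a i)))"
      by (rule ln_prod) (use S nz in auto)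
    also have "ln (r ^ m) = m * ln r" using r by (simp add: ln_realpow)
    finally show ?case .
  qed
  have contG: "continuous_on {0..1} (\<lambda>t. ln_mod G r t)"
    using G(2)[OF in_ball]
    by (intro continuous_intros continuous_on_compose2[OF holomorphic_on_imp_continuous_on[OF G(1)]])
       (use in_ball in auto)
  have intG: "integrable circ (\<lambda>t. ln_mod G r t)"
    by (rule integrable_circ_continuous[OF contG])
  have intS: "integrable circ (\<lambda>t. ln (norm (1 - on_circle r t / a i)))" if "i \<in> S" for i
    by (rule integrable_ln_linear_factor) (use that S r in auto)
  let ?h = "\<lambda>t. m * ln r + ln_mod G r t + (\<Sum>i\<in>S. ln (norm (1 - on_circle r t / a i)))"
  have inth: "integrable circ ?h"
    by (intro Bochner_Integration.integrable_add Bochner_Integration.integrable_sum integrable_circ_const intG intS)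
  have contf: "continuous_on {0..1} (\<lambda>t. norm (f (on_circle r t)))"
  proof -
    have "continuous_on {0..1} (\<lambda>t. norm ((on_circle r t) ^ m * G (on_circle r t) * (\<Prod>i\<in>S. 1 - on_circle r t / a i)))"
      by (intro continuous_intros continuous_on_compose2[OF holomorphic_on_imp_continuous_on[OF G(1)]])
         (use in_ball S in auto)
    thus ?thesis using f[OF in_ball] by simp
  qed
  have meas: "(\<lambda>t. ln_mod f r t) \<in> borel_measurable circ"
    using borel_measurable_circ_continuous[OF contf] by measurable
  show "integrable circ (\<lambda>t. ln_mod f r t)"
    using integrable_cong_AE[OF meas borel_measurable_integrable[OF inth] ae] inth by simp
  have "fourier_log f k r = (\<integral>t. of_real (?h t) * cnj (circle_pt t) ^ k \<partial>circ)"
    unfolding fourier_log_def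
  proof (rule integral_cong_AE)
    show "AE t in circ. of_real (ln_mod f r t) * cnj (circle_pt t) ^ k = 
              of_real (?h t) * cnj (circle_pt t) ^ k"
      using ae by eventually_elim simp
  qed (use meas borel_measurable_integrable[OF inth] measurable_circI[OF borel_measurable_cnj_circle_pt] in measurable)
  also have "\<dots> = (\<integral>t. of_real (m * ln r) * cnj (circle_pt t) ^ k +
       of_real (ln_mod G r t) * cnj (circle_pt t) ^ k +
       (\<Sum>i\<in>S. of_real (ln (norm (1 - on_circle r t / a i))) * cnj (circle_pt t) ^ k) \<partial>circ)"
    by (intro Bochner_Integration.integral_cong) (auto simp: ring_distribs sum_distrib_right)
  also have "\<dots> = of_real (m * ln r) * (\<integral>t. cnj (circle_pt t) ^ k \<partial>circ) + fourier_log G k r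
       + (\<Sum>i\<in>S. fourier_log (\<lambda>z. 1 - z / a i) k r)"
  proof -
    note int1 = integrable_mult_circle_pt_power[OF integrable_circ_const[of "m * ln r"], of k]
    note int2 = integrable_mult_circle_pt_power[OF intG, of k]
    note int3 = integrable_mult_circle_pt_power[OF intS, of _ k]
    show ?thesis unfolding fourier_log_def
      by (subst Bochner_Integration.integral_add Bochner_Integration.integral_sum, 
          (intro Bochner_Integration.integrable_add Bochner_Integration.integrable_sum int1 int2 int3; assumption)+)+ simp
  qed
  also have "(\<Sum>i\<in>S. fourier_log (\<lambda>z. 1 - z / a i) k r) = (\<Sum>i\<in>S. linear_factor_coeff k r (a i))"
    by (intro sum.cong refl fourier_log_linear) (use S r in auto)
  finally show "fourier_log f k r = (if k = 0 then of_real (m * ln r) else 0) + fourier_log G k r + (\<Sum>i\<in>S. linear_factor_coeff k r (a i))"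
    by (simp add: integral_cnj_circle_pt_power)
qed

lemma holomorphic_log_ball:
  assumes "G holomorphic_on ball 0 R" "\<And>w. w \<in> ball 0 R \<Longrightarrow> G w \<noteq> 0"
  obtains g where "g holomorphic_on ball 0 R" "\<And>w. w \<in> ball 0 R \<Longrightarrow> G w = exp (g w)"
  using contractible_imp_holomorphic_log[OF assms(1) convex_imp_contractible[OF convex_ball] assms(2)] by blast

text \<open>The point is that a single \<open>C\<close> serves all radii below
  \<open>R\<close>.\<close>

lemma fourier_log_nonvanishing:
  assumes G: "G holomorphic_on ball 0 R" "\<And>w. w \<in> ball 0 R \<Longrightarrow> G w \<noteq> 0"
  obtains C where "\<And>r. 0 < r \<Longrightarrow> r < R \<Longrightarrow> fourier_log G k r = (if k = 0 then of_real (ln (norm (G 0))) else C * of_real r ^ k)"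
proof -
  obtain g where g: "g holomorphic_on ball 0 R" "\<And>w. w \<in> ball 0 R \<Longrightarrow> G w = exp (g w)"
    using holomorphic_log_ball[OF G] by blast
  show ?thesis
  proof (rule that[of "(deriv ^^ k) g 0 / fact k / 2"])
    fix r assume r: "0 < r" "r < R"
    have "fourier_log G k r = (if k = 0 then of_real (Re (g 0)) else (deriv ^^ k) g 0 / fact k * of_real r ^ k / 2)"
      by (rule fourier_log_exp[OF g(1) r]) (simp add: g)
    moreover have "Re (g 0) = ln (norm (G 0))" using g(2)[of 0] r by simp
    ultimately show "fourier_log G k r = (if k = 0 then of_real (ln (norm (G 0))) else (deriv ^^ k) g 0 / fact k / 2 * of_real r ^ k)"
      by simp
  qed
qed

text \<open>The map u / (2 A - u) sends the half-plane Re u < A into the unit disc and fixes 0, so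
  Schwarz's lemma applies. On the disc of half the radius it gives |u| <= (2 A + |u|) / 2, that is
  |u| <= 2 A.\<close>

lemma borel_caratheodory:
  assumes g: "g holomorphic_on ball 0 R" and R: "0 < R" and A: "0 < A"
    and le: "\<And>w. w \<in> ball 0 R \<Longrightarrow> Re (g w) < Re (g 0) + A" and z: "norm z \<le> R / 2"
  shows "Re (g z) \<ge> Re (g 0) - 2 * A"
proof -
  define u where "u = (\<lambda>w. g (of_real R * w) - g 0)"
  define \<phi> where "\<phi> = (\<lambda>w. u w / (of_real (2 * A) - u w))"
  have inb: "of_real R * w \<in> ball 0 R" if "norm w < 1" for w :: complex
    using that R by (simp add: norm_mult)
  have Re_u: "Re (u w) < A" if "norm w < 1" for w
    using le[OF inb[OF that]] by (simp add: u_def)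
  have nz: "of_real (2 * A) - u w \<noteq> 0" if "norm w < 1" for w
    using Re_u[OF that] A by (auto simp: complex_eq_iff)
  have hol_u: "u holomorphic_on ball 0 1" unfolding u_def
    by (intro holomorphic_intros holomorphic_on_compose_gen[OF _ g, unfolded o_def]) (use inb in auto)
  have hol: "\<phi> holomorphic_on ball 0 1" unfolding \<phi>_def
    by (intro holomorphic_intros hol_u) (use nz in auto)
  have no: "norm (\<phi> w) < 1" if "norm w < 1" for w
  proof -
    have "(norm (of_real (2 * A) - u w))\<^sup>2 - (norm (u w))\<^sup>2 = 4 * A * (A - Re (u w))"
      unfolding cmod_power2 by (simp add: power2_eq_square algebra_simps)
    moreover have "4 * A * (A - Re (u w)) > 0" using A Re_u[OF that] by simp
    ultimately have "(norm (u w))\<^sup>2 < (norm (of_real (2 * A) - u w))\<^sup>2" by linarith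
    hence "norm (u w) < norm (of_real (2 * A) - u w)" by (rule power2_less_imp_less) simp
    thus ?thesis using nz[OF that] by (simp add: \<phi>_def norm_divide)
  qed
  define w where "w = z / of_real R"
  have w: "norm w \<le> 1 / 2" "of_real R * w = z" using z R by (auto simp: w_def norm_divide field_simps)
  have "norm (\<phi> w) \<le> norm w"
    by (rule Schwarz_Lemma(1)[OF hol _ no]) (use w in \<open>auto simp: \<phi>_def u_def\<close>)
  hence "norm (\<phi> w) \<le> 1 / 2" using w by simp
  hence "norm (u w) \<le> norm (of_real (2 * A) - u w) / 2"
    using nz[of w] w by (simp add: \<phi>_def norm_divide divide_le_eq)
  also have "norm (of_real (2 * A) - u w) \<le> 2 * A + norm (u w)"
    using norm_triangle_ineq4[of "of_real (2 * A)" "u w"] A by simp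
  finally have "norm (u w) \<le> 2 * A" by simp
  moreover have "- Re (u w) \<le> norm (u w)" using abs_Re_le_cmod[of "u w"] by linarith
  ultimately show ?thesis by (simp add: u_def w(2))
qed

subsection \<open>Zeros of entire functions and Jensen's formula\<close>

text \<open>The index type stays open because the theorem supplies a sequence, while auxiliary
  functions enumerate their zeros by \<open>zero_index\<close>.\<close>

locale enumerated_zeros =
  fixes f :: "complex \<Rightarrow> complex" and I :: "'i set" and a :: "'i \<Rightarrow> complex"
  assumes holo: "f holomorphic_on UNIV" and nonzero: "\<exists>w. f w \<noteq> 0"
    and zero: "\<And>i. i \<in> I \<Longrightarrow> f (a i) = 0"
    and mult: "\<And>w. f w = 0 \<Longrightarrow> int (card {i\<in>I. a i = w}) = zorder f w"
begin

definition below :: "real \<Rightarrow> 'i set" where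
  "below r = {i\<in>I. 0 < norm (a i) \<and> norm (a i) < r}"

definition mult0 :: nat where
  "mult0 = card {i\<in>I. a i = 0}"

lemma zorder_pos: "f w = 0 \<Longrightarrow> zorder f w > 0"
  using zorder_exist_zero[OF holo open_UNIV connected_UNIV, of w] nonzero by auto

lemma finite_fibre: "finite {i\<in>I. a i = w}"
proof (cases "f w = 0")
  case True
  \<comment> \<open>A positive cardinality also certifies finiteness, since infinite sets have
    cardinality 0.\<close>
  hence "card {i\<in>I. a i = w} > 0" using mult[OF True] zorder_pos[OF True] by linarith
  thus ?thesis by (rule card_ge_0_finite)
next
  case False
  hence "{i\<in>I. a i = w} = {}" using zero by auto
  thus ?thesis by (simp only: finite.emptyI)
qed

lemma finite_le: "finite {i\<in>I. norm (a i) \<le> r}"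
proof -
  obtain w0 where w0: "f w0 \<noteq> 0" using nonzero by blast
  have "finite {w \<in> cball 0 (r + norm w0). f w = 0}"
  proof (cases "\<exists>w. f w = 0")
    case True
    then obtain w1 where "f w1 = 0" by blast
    hence "\<not> f constant_on UNIV" using w0 unfolding constant_on_def by (metis UNIV_I)
    thus ?thesis using holomorphic_compact_finite_zeros[OF holo open_UNIV connected_UNIV, of "cball 0 (r + norm w0)"] by auto
  qed simp
  hence "finite {w. norm w \<le> r \<and> f w = 0}"
    by (rule finite_subset[rotated]) (auto intro: add_increasing2)
  hence "finite (\<Union>w\<in>{w. norm w \<le> r \<and> f w = 0}. {i\<in>I. a i = w})" using finite_fibre by blast
  thus ?thesis by (rule finite_subset[rotated]) (use zero in auto)
qed

lemma finite_below [simp, intro]: "finite (below r)"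
  by (rule finite_subset[OF _ finite_le[of r]]) (auto simp: below_def)

lemma below_nonzero: "i \<in> below r \<Longrightarrow> a i \<noteq> 0"
  by (auto simp: below_def)

lemma zorder_canonical:
  assumes "norm w0 < R"
  shows "zorder (\<lambda>w. w ^ mult0 * (\<Prod>i\<in>below R. 1 - w / a i)) w0 = int (card {i\<in>I. a i = w0})"
proof (cases "w0 = 0")
  case True
  have "zorder (\<lambda>w. w ^ mult0 * (\<Prod>i\<in>below R. 1 - w / a i)) 0 = int mult0"
    by (rule zorder_eqI[of UNIV _ "\<lambda>w. \<Prod>i\<in>below R. 1 - w / a i"]) 
       (auto intro!: holomorphic_intros simp: below_nonzero)
  thus ?thesis by (simp add: True mult0_def)
next
  case False
  define T where "T = {i\<in>I. a i = w0}"
  have T: "T \<subseteq> below R" using False assms by (auto simp: T_def below_def)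
  \<comment> \<open>This is the constant with 1 - w / w0 = c (w - w0).\<close>
  define c where "c = - 1 / w0"
  define g where "g = (\<lambda>w. w ^ mult0 * c ^ card T * (\<Prod>i\<in>below R - T. 1 - w / a i))"
  have "zorder (\<lambda>w. w ^ mult0 * (\<Prod>i\<in>below R. 1 - w / a i)) w0 = int (card T)"
  proof (rule zorder_eqI[of UNIV _ g])
    show "g holomorphic_on UNIV" unfolding g_def
      by (intro holomorphic_intros) (auto simp: below_nonzero False)
    have "1 - w0 / a i \<noteq> 0" if "i \<in> below R - T" for i
      using that by (auto simp: T_def below_def)
    thus "g w0 \<noteq> 0" using False by (auto simp: g_def c_def)
    fix w :: complex
    have "(\<Prod>i\<in>below R. 1 - w / a i) = (\<Prod>i\<in>below R - T. 1 - w / a i) * (\<Prod>i\<in>T. 1 - w / a i)"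
      by (rule prod.subset_diff[OF T finite_below])
    also have "(\<Prod>i\<in>T. 1 - w / a i) = (\<Prod>i\<in>T. c * (w - w0))"
      by (intro prod.cong refl) (use False in \<open>auto simp: c_def T_def field_simps\<close>)
    finally show "w ^ mult0 * (\<Prod>i\<in>below R. 1 - w / a i) = g w * (w - w0) powi int (card T)"
      by (simp add: g_def power_mult_distrib mult_ac)
  qed auto
  thus ?thesis by (simp add: T_def)
qed

text \<open>A disc contains finitely many zeros, so a polynomial with the same zeros and orders can
  be divided out. Its factors are normalised to the value 1 at the origin.\<close>

lemma factorization_exists:
  assumes "R > 0"
  obtains G where "G holomorphic_on ball 0 R" "\<And>w. w \<in> ball 0 R \<Longrightarrow> G w \<noteq> 0"
    "\<And>w. w \<in> ball 0 R \<Longrightarrow> f w = w ^ mult0 * G w * (\<Prod>i\<in>below R. 1 - w / a i)"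
proof -
  let ?p = "\<lambda>w. w ^ mult0 * (\<Prod>i\<in>below R. 1 - w / a i)"
  have card_pos: "card {i\<in>I. a i = w} > 0 \<longleftrightarrow> f w = 0" for w
  proof
    assume "card {i\<in>I. a i = w} > 0"
    thus "f w = 0" using zero by (auto simp: card_gt_0_iff)
  next
    assume "f w = 0" thus "card {i\<in>I. a i = w} > 0" using mult zorder_pos[of w] by force
  qed
  obtain G where G: "G holomorphic_on ball 0 R" "\<And>w. w \<in> ball 0 R \<Longrightarrow> G w \<noteq> 0"
      "\<And>w. w \<in> ball 0 R \<Longrightarrow> f w = G w * ?p w"
  proof (rule holomorphic_zorder_factorization[of f "ball 0 R" ?p])
    show "f holomorphic_on ball 0 R" using holo holomorphic_on_subset by blast
    show "?p holomorphic_on ball 0 R" by (intro holomorphic_intros) (auto simp: below_nonzero)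
    fix w :: complex assume w: "w \<in> ball 0 R"
    have "(\<Prod>i\<in>below R. 1 - w / a i) = 0 \<longleftrightarrow> (\<exists>i\<in>below R. a i = w)"
      using below_nonzero by (auto simp: prod_zero_iff)
    hence "?p w = 0 \<longleftrightarrow> (w = 0 \<and> mult0 > 0) \<or> (\<exists>i\<in>below R. a i = w)" by simp
    also have "mult0 > 0 \<longleftrightarrow> {i\<in>I. a i = 0} \<noteq> {}" 
      unfolding mult0_def using finite_fibre[of 0] by (simp only: card_gt_0_iff simp_thms)
    also have "(w = 0 \<and> {i\<in>I. a i = 0} \<noteq> {}) \<or> (\<exists>i\<in>below R. a i = w) \<longleftrightarrow> {i\<in>I. a i = w} \<noteq> {}"
      using w by (auto simp: below_def)
    also have "\<dots> \<longleftrightarrow> f w = 0" using card_pos[of w] finite_fibre[of w] by (auto simp: card_gt_0_iff)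
    finally show eq: "?p w = 0 \<longleftrightarrow> f w = 0" .
    have "zorder f w = int (card {i\<in>I. a i = w})"
    proof (cases "f w = 0")
      case False
      have "zorder f w = 0"
        using zorder_exist_zero[OF holo open_UNIV connected_UNIV, of w] nonzero False by auto
      thus ?thesis using card_pos[of w] False by simp
    qed (simp add: mult)
    thus "zorder ?p w = zorder f w" using zorder_canonical[of w R] w by simp
  qed auto
  show ?thesis by (rule that[OF G(1,2)]) (auto simp: G(3) mult_ac)
qed

text \<open>The first non-zero Taylor coefficient of \<open>f\<close> at the origin. The limit
  characterises it independently of the disc on which \<open>f\<close> is factorised.\<close>

definition lead :: complex where
  "lead = (THE c. ((\<lambda>w. f w / w ^ mult0) \<longlongrightarrow> c) (at 0))"

lemma lead_eqI:
  assumes "R > 0" "G holomorphic_on ball 0 R" "\<And>w. w \<in> ball 0 R \<Longrightarrow> f w = w ^ mult0 * G w * (\<Prod>i\<in>below R. 1 - w / a i)"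
  shows "lead = G 0"
proof -
  have "isCont G 0"
    using holomorphic_on_imp_continuous_on[OF assms(2)] assms(1) by (simp add: continuous_on_eq_continuous_at)
  hence "((\<lambda>w. G w * (\<Prod>i\<in>below R. 1 - w / a i)) \<longlongrightarrow> G 0 * (\<Prod>i\<in>below R. 1 - 0 / a i)) (at 0)"
    unfolding isCont_def by (intro tendsto_intros) (auto simp: below_nonzero)
  hence "((\<lambda>w. f w / w ^ mult0) \<longlongrightarrow> G 0) (at 0)"
    unfolding div_0 diff_zero prod.neutral_const mult_1_right
  proof (rule Lim_transform_eventually)
    show "\<forall>\<^sub>F w in at 0. G w * (\<Prod>i\<in>below R. 1 - w / a i) = f w / w ^ mult0"
      using eventually_at_in_open[OF open_ball, of 0 0 R] assms(1)
      by (auto elim!: eventually_mono simp: assms(3))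
  qed
  thus ?thesis unfolding lead_def
    by (intro the_equality) (auto dest: tendsto_unique[rotated])
qed

lemma factorization:
  assumes "R > 0"
  obtains G where "G holomorphic_on ball 0 R" "\<And>w. w \<in> ball 0 R \<Longrightarrow> G w \<noteq> 0"
    "\<And>w. w \<in> ball 0 R \<Longrightarrow> f w = w ^ mult0 * G w * (\<Prod>i\<in>below R. 1 - w / a i)" "G 0 = lead"
proof -
  obtain G where G: "G holomorphic_on ball 0 R" "\<And>w. w \<in> ball 0 R \<Longrightarrow> G w \<noteq> 0"
    "\<And>w. w \<in> ball 0 R \<Longrightarrow> f w = w ^ mult0 * G w * (\<Prod>i\<in>below R. 1 - w / a i)"
    using factorization_exists[OF assms] by blast
  thus ?thesis using that lead_eqI[OF assms G(1,3)] by metis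
qed

lemma integrable_ln_norm:
  assumes "0 < r"
  shows "integrable circ (\<lambda>t. ln_mod f r t)"
proof -
  have R: "0 < r + 1" "r < r + 1" using assms by auto
  obtain G where G: "G holomorphic_on ball 0 (r+1)" "\<And>w. w \<in> ball 0 (r+1) \<Longrightarrow> G w \<noteq> 0"
    "\<And>w. w \<in> ball 0 (r+1) \<Longrightarrow> f w = w ^ mult0 * G w * (\<Prod>i\<in>below (r+1). 1 - w / a i)" "G 0 = lead"
    using factorization[OF R(1)] by blast
  show ?thesis
    by (rule fourier_log_product(2)[OF G(3,1,2) finite_below below_nonzero assms R(2)])
qed

lemma jensen:
  assumes "0 < r"
  shows "(\<integral>t. ln_mod f r t \<partial>circ) = 
           mult0 * ln r + ln (norm lead) + (\<Sum>i\<in>below r. ln (r / norm (a i)))"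
proof -
  \<comment> \<open>The larger disc takes in the zeros on the circle, which also make ln |f|
    singular; outside \<open>below r\<close> the coefficients of index 0 vanish.\<close>
  have R: "0 < r + 1" "r < r + 1" using assms by auto
  obtain G where G: "G holomorphic_on ball 0 (r+1)" "\<And>w. w \<in> ball 0 (r+1) \<Longrightarrow> G w \<noteq> 0"
    "\<And>w. w \<in> ball 0 (r+1) \<Longrightarrow> f w = w ^ mult0 * G w * (\<Prod>i\<in>below (r+1). 1 - w / a i)" "G 0 = lead"
    using factorization[OF R(1)] by blast
  obtain C where C: "\<And>r'. 0 < r' \<Longrightarrow> r' < r + 1 \<Longrightarrow> fourier_log G 0 r' = of_real (ln (norm (G 0)))"
    using fourier_log_nonvanishing[OF G(1,2), of 0] by auto
  have "of_real (\<integral>t. ln_mod f r t \<partial>circ) = fourier_log f 0 r"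
    by (simp add: fourier_log_def)
  also have "\<dots> = of_real (mult0 * ln r) + fourier_log G 0 r + (\<Sum>i\<in>below (r+1). linear_factor_coeff 0 r (a i))"
    by (subst fourier_log_product(3)[OF G(3,1,2) finite_below below_nonzero assms R(2)]) auto
  also have "(\<Sum>i\<in>below (r+1). linear_factor_coeff 0 r (a i)) = (\<Sum>i\<in>below (r+1). of_real (max 0 (ln (r / norm (a i)))))"
    by (simp add: linear_factor_coeff_def)
  also have "\<dots> = (\<Sum>i\<in>below r. of_real (max 0 (ln (r / norm (a i)))))"
  proof (rule sum.mono_neutral_right)
    show "\<forall>i\<in>below (r + 1) - below r. complex_of_real (max 0 (ln (r / norm (a i)))) = 0"
      using assms by (auto simp: below_def max_def)
    show "finite (below (r + 1))" by (rule finite_below)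
  qed (auto simp: below_def)
  also have "\<dots> = (\<Sum>i\<in>below r. of_real (ln (r / norm (a i))))"
    using assms by (intro sum.cong refl) (auto simp: below_def max_def)
  also have "fourier_log G 0 r = of_real (ln (norm lead))" using C[OF assms R(2)] G(4) by simp
  finally have "complex_of_real (\<integral>t. ln_mod f r t \<partial>circ) = 
      of_real (mult0 * ln r + ln (norm lead) + (\<Sum>i\<in>below r. ln (r / norm (a i))))"
    by simp
  thus ?thesis by (simp only: of_real_eq_iff)
qed

text \<open>A zero outside the circle contributes a multiple of r^k. If the same multiple is split
  off from the zeros inside, all these multiples merge with the zero-free part into one coefficient,
  and only the zeros inside remain in the sum.\<close>

lemma fourier_log_formula:
  assumes k: "k > 0"
  obtains \<alpha> where "\<And>r. 0 < r \<Longrightarrow> fourier_log f k r = 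
     \<alpha> * of_real r ^ k + (\<Sum>i\<in>below r. ((of_real r / a i) ^ k - (cnj (a i) / of_real r) ^ k) / (2 * of_nat k))"
proof -
  define T where "T = (\<lambda>r. \<Sum>i\<in>below r. ((of_real r / a i) ^ k - (cnj (a i) / of_real r) ^ k) / (2 * of_nat k))"
  have ex: "\<exists>\<alpha>. \<forall>r. 0 < r \<and> r < R \<longrightarrow> fourier_log f k r = \<alpha> * of_real r ^ k + T r" if R: "R > 0" for R
  proof -
    obtain G where G: "G holomorphic_on ball 0 R" "\<And>w. w \<in> ball 0 R \<Longrightarrow> G w \<noteq> 0"
      "\<And>w. w \<in> ball 0 R \<Longrightarrow> f w = w ^ mult0 * G w * (\<Prod>i\<in>below R. 1 - w / a i)"
      by (rule factorization_exists[OF R]) blast+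
    obtain C where "\<And>r. 0 < r \<Longrightarrow> r < R \<Longrightarrow>
        fourier_log G k r = (if k = 0 then of_real (ln (norm (G 0))) else C * of_real r ^ k)"
      by (rule fourier_log_nonvanishing[OF G(1,2), of k]) blast+
    with k have C: "fourier_log G k r = C * of_real r ^ k" if "0 < r" "r < R" for r
      using that by simp
    show ?thesis
    proof (intro exI allI impI)
      fix r assume r: "0 < r \<and> r < R"
      have coeff: "linear_factor_coeff k r (a i) = - (of_real r ^ k * (1 / a i ^ k / (2 * of_nat k))) + 
         (if norm (a i) < r then ((of_real r / a i) ^ k - (cnj (a i) / of_real r) ^ k) / (2 * of_nat k) else 0)" if "i \<in> below R" for i
      proof (cases "norm (a i) < r")
        case True
        have "min (r / norm (a i)) (norm (a i) / r) = norm (a i) / r"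
          using True r below_nonzero[OF that] by (smt (verit) divide_le_eq_1_pos le_divide_eq_1_pos zero_less_norm_iff)
        moreover have "cnj (a i) = of_real (norm (a i)) * cnj (sgn (a i))"
          using below_nonzero[OF that] by (simp add: sgn_div_norm scaleR_conv_of_real)
        ultimately show ?thesis using True k
          by (simp add: linear_factor_coeff_def power_mult_distrib power_divide diff_divide_distrib)
      next
        case False
        have "min (r / norm (a i)) (norm (a i) / r) = r / norm (a i)"
          using False r below_nonzero[OF that] by (smt (verit) divide_le_eq_1_pos le_divide_eq_1_pos zero_less_norm_iff)
        moreover have "of_real r / a i = of_real (r / norm (a i)) * cnj (sgn (a i))"
          by (rule of_real_div_eq_sgn)
        hence "(of_real r / a i) ^ k = cnj (sgn (a i)) ^ k * of_real (r / norm (a i)) ^ k"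
          by (simp add: power_mult_distrib power_divide mult_ac)
        ultimately have "linear_factor_coeff k r (a i) = - ((of_real r / a i) ^ k / (2 * of_nat k))"
          using k by (simp only: linear_factor_coeff_def) simp
        thus ?thesis using False by (simp add: power_divide)
      qed
      have "fourier_log f k r = C * of_real r ^ k + (\<Sum>i\<in>below R. linear_factor_coeff k r (a i))"
        using fourier_log_product(3)[where r = r and k = k, OF G(3,1,2) finite_below below_nonzero] r k C by simp
      also have "(\<Sum>i\<in>below R. linear_factor_coeff k r (a i)) = - (of_real r ^ k * (\<Sum>i\<in>below R. 1 / a i ^ k / (2 * of_nat k))) + 
         (\<Sum>i\<in>below R. (if norm (a i) < r then ((of_real r / a i) ^ k - (cnj (a i) / of_real r) ^ k) / (2 * of_nat k) else 0))"
        by (subst sum.cong[OF refl coeff], assumption)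
           (simp only: sum.distrib sum_negf sum_distrib_left)
      also have "(\<Sum>i\<in>below R. (if norm (a i) < r then ((of_real r / a i) ^ k - (cnj (a i) / of_real r) ^ k) / (2 * of_nat k) else 0)) = T r"
        unfolding T_def using r by (intro sum.mono_neutral_cong_right finite_below) (auto simp: below_def)
      finally show "fourier_log f k r = (C - (\<Sum>i\<in>below R. 1 / a i ^ k / (2 * of_nat k))) * of_real r ^ k + T r"
        by (simp add: algebra_simps)
    qed
  qed
  \<comment> \<open>The coefficient found this way depends on the disc. Every disc containing radius
    1/2 yields the same one, because the formulas can be compared at that radius.\<close>
  obtain \<alpha> where \<alpha>: "\<And>r. 0 < r \<Longrightarrow> r < 1 \<Longrightarrow> fourier_log f k r = \<alpha> * of_real r ^ k + T r"
    using ex[of 1] by auto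
  show ?thesis
  proof (rule that[of \<alpha>])
    fix r :: real assume r: "0 < r"
    then obtain \<beta> where \<beta>: "\<And>s. 0 < s \<Longrightarrow> s < r + 1 \<Longrightarrow> fourier_log f k s = \<beta> * of_real s ^ k + T s"
      using ex[of "r+1"] by auto
    have "\<alpha> = \<beta>" using \<alpha>[of "1/2"] \<beta>[of "1/2"] r by simp
    thus "fourier_log f k r = \<alpha> * of_real r ^ k + (\<Sum>i\<in>below r. ((of_real r / a i) ^ k - (cnj (a i) / of_real r) ^ k) / (2 * of_nat k))"
      using \<beta>[of r] r by (simp add: T_def)
  qed
qed

end

section \<open>Lower bounds for ln |f| from an upper bound on a larger circle\<close>

lemma ln_norm_le:
  assumes "norm w \<le> exp B" "0 \<le> B"
  shows "ln (norm w) \<le> B"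
proof (cases "w = 0")
  case False
  hence "ln (norm w) \<le> ln (exp B)" using assms by (subst ln_le_cancel_iff) auto
  thus ?thesis by simp
qed (use assms in auto)

lemma norm_prod_ge_1:
  fixes g :: "'i \<Rightarrow> complex"
  assumes "\<And>i. i \<in> S \<Longrightarrow> 1 \<le> norm (g i)"
  shows "1 \<le> norm (\<Prod>i\<in>S. g i)"
  unfolding prod_norm[symmetric] by (rule prod_ge_1) (use assms in auto)

context enumerated_zeros
begin

text \<open>In Jensen's formula at radius 4 r each zero of modulus at most 2 r contributes at least
  ln 2, and the mean on the left is at most \<open>B\<close>.\<close>

lemma card_near_bound:
  assumes r: "1 \<le> r" and B: "0 \<le> B" "\<And>w. norm w = 4 * r \<Longrightarrow> norm (f w) \<le> exp B"
  shows "card {i\<in>I. a i \<noteq> 0 \<and> norm (a i) \<le> 2 * r} * ln 2 \<le> B - ln (norm lead)"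
proof -
  define S where "S = {i\<in>I. a i \<noteq> 0 \<and> norm (a i) \<le> 2 * r}"
  have S: "S \<subseteq> below (4 * r)" using r by (auto simp: S_def below_def)
  have "card S * ln 2 = (\<Sum>i\<in>S. ln 2)" by simp
  also have "\<dots> \<le> (\<Sum>i\<in>S. ln (4 * r / norm (a i)))"
    using r by (intro sum_mono) (auto simp: S_def field_simps)
  also have "\<dots> \<le> (\<Sum>i\<in>below (4 * r). ln (4 * r / norm (a i)))"
    by (rule sum_mono2[OF finite_below S]) (auto simp: below_def)
  also have "\<dots> = (\<integral>t. ln_mod f (4 * r) t \<partial>circ) - mult0 * ln (4 * r) - ln (norm lead)"
    using jensen[of "4 * r"] r by simp
  also have "\<dots> \<le> (\<integral>t. ln_mod f (4 * r) t \<partial>circ) - ln (norm lead)"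
    using r by simp
  also have "(\<integral>t. ln_mod f (4 * r) t \<partial>circ) \<le> (\<integral>t. B \<partial>circ)"
    by (intro integral_mono integrable_ln_norm integrable_circ_const ln_norm_le B)
       (use r in \<open>auto simp: norm_mult\<close>)
  finally show ?thesis by (simp add: S_def)
qed

definition angle :: "'i \<Rightarrow> real" where
  "angle i = (SOME s. s \<in> {0..1} \<and> a i = of_real (norm (a i)) * circle_pt s)"

lemma angle: "angle i \<in> {0..1}" "a i = of_real (norm (a i)) * circle_pt (angle i)"
proof -
  have "\<exists>s. s \<in> {0..1} \<and> a i = of_real (norm (a i)) * circle_pt s"
    using circle_pt_polar by blast
  from someI_ex[OF this] show "angle i \<in> {0..1}" "a i = of_real (norm (a i)) * circle_pt (angle i)"
    unfolding angle_def by blast+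
qed

text \<open>Dividing out the zeros of modulus at most 2 r leaves \<open>H\<close>, zero-free on that
  disc and still bounded by exp B. Borel-Caratheodory bounds ln |H| below at radius r; the removed
  factors cost one logarithmic kernel each.\<close>

lemma ln_norm_ge:
  assumes r: "1 \<le> r" and B: "0 \<le> B" "\<And>w. norm w = 4 * r \<Longrightarrow> norm (f w) \<le> exp B"
  shows "AE t in circ. ln_mod f r t \<ge> 3 * ln (norm lead) - 2 * B - 2
           - (\<Sum>i\<in>{i\<in>I. a i \<noteq> 0 \<and> norm (a i) \<le> 2 * r}. log_kernel (angle i) t)"
proof -
  define S where "S = {i\<in>I. a i \<noteq> 0 \<and> norm (a i) \<le> 2 * r}"
  have R: "5 * r > 0" using r by simp
  have S: "S \<subseteq> below (5 * r)" using r by (auto simp: S_def below_def)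
  have finS: "finite S" by (rule finite_subset[OF S finite_below])
  obtain G where G: "G holomorphic_on ball 0 (5 * r)" "\<And>w. w \<in> ball 0 (5 * r) \<Longrightarrow> G w \<noteq> 0"
    "\<And>w. w \<in> ball 0 (5 * r) \<Longrightarrow> f w = w ^ mult0 * G w * (\<Prod>i\<in>below (5 * r). 1 - w / a i)" "G 0 = lead"
    by (rule factorization[OF R]) blast+
  define H where "H = (\<lambda>w. G w * (\<Prod>i\<in>below (5 * r) - S. 1 - w / a i))"
  have holH: "H holomorphic_on ball 0 (5 * r)" unfolding H_def
    by (intro holomorphic_intros G) (auto simp: below_nonzero)
  have fH: "f w = w ^ mult0 * H w * (\<Prod>i\<in>S. 1 - w / a i)" if "w \<in> ball 0 (5 * r)" for w
    unfolding G(3)[OF that] H_def by (subst prod.subset_diff[OF S finite_below]) (simp add: mult_ac)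
  have fH2: "f w = w ^ mult0 * H w * (\<Prod>i\<in>S. 1 - w / a i)" if "w \<in> ball 0 (2 * r)" for w
    by (rule fH) (use that r in auto)
  have H0: "H 0 = lead" by (simp add: H_def G(4))
  have Hnz: "H w \<noteq> 0" if "w \<in> ball 0 (2 * r)" for w
  proof -
    have "1 - w / a i \<noteq> 0" if i: "i \<in> below (5 * r) - S" for i
      using i \<open>w \<in> ball 0 (2 * r)\<close> by (auto simp: S_def below_def)
    thus ?thesis using that G(2)[of w] r by (auto simp: H_def)
  qed
  have Hbd: "norm (H w) \<le> exp B" if "norm w = 4 * r" for w
  proof -
    have w: "w \<in> ball 0 (5 * r)" using that r by auto
    \<comment> \<open>On |w| = 4 r the removed factors satisfy |w / a| >= 2 and so have modulus at
      least 1: removing them keeps the bound.\<close>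
    have "1 \<le> norm (\<Prod>i\<in>S. 1 - w / a i)"
    proof (rule norm_prod_ge_1)
      fix i assume i: "i \<in> S"
      hence "norm (w / a i) \<ge> 2" using that r by (auto simp: S_def norm_divide field_simps)
      thus "1 \<le> norm (1 - w / a i)" using norm_triangle_ineq2[of "w / a i" 1] by (simp add: norm_minus_commute)
    qed
    moreover have "1 \<le> norm (w ^ mult0)" unfolding norm_power by (rule one_le_power) (use that r in simp)
    ultimately have "1 * norm (H w) * 1 \<le> norm (w ^ mult0) * norm (H w) * norm (\<Prod>i\<in>S. 1 - w / a i)"
      by (intro mult_mono) auto
    also have "\<dots> = norm (f w)" by (simp add: fH[OF w] norm_mult)
    also have "\<dots> \<le> exp B" by (rule B(2)[OF that])
    finally show ?thesis by simp
  qed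
  have Hbd': "norm (H w) \<le> exp B" if "norm w \<le> 4 * r" for w
  proof (rule maximum_modulus_frontier[of H "cball 0 (4 * r)"])
    show "H holomorphic_on interior (cball 0 (4 * r))"
      by (rule holomorphic_on_subset[OF holH]) (use r in auto)
    show "continuous_on (closure (cball 0 (4 * r))) H"
      by (rule continuous_on_subset[OF holomorphic_on_imp_continuous_on[OF holH]]) (use r in auto)
    show "norm (H w) \<le> exp B" if "w \<in> frontier (cball 0 (4 * r))" for w
      by (rule Hbd) (use that r in \<open>auto simp: frontier_cball\<close>)
  qed (use that in auto)
  have holH2: "H holomorphic_on ball 0 (2 * r)"
    by (rule holomorphic_on_subset[OF holH]) (use r in auto)
  obtain g where g: "g holomorphic_on ball 0 (2 * r)" "\<And>w. w \<in> ball 0 (2 * r) \<Longrightarrow> H w = exp (g w)"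
    using holomorphic_log_ball[OF holH2 Hnz] by blast
  have lnH: "ln (norm (H w)) = Re (g w)" if "w \<in> ball 0 (2 * r)" for w
    using g(2)[OF that] by simp
  have lnH_le: "ln (norm (H w)) \<le> B" if "w \<in> ball 0 (2 * r)" for w
    by (rule ln_norm_le[OF Hbd' B(1)]) (use that r in auto)
  have Re_g0: "Re (g 0) = ln (norm lead)" using lnH[of 0] r by (simp add: H0)
  \<comment> \<open>The summand 1 provides the strict inequality that the Moebius map
    requires.\<close>
  define A where "A = B - ln (norm lead) + 1"
  have A: "A > 0" using lnH_le[of 0] lnH[of 0] r by (simp add: A_def H0)
  have lower: "Re (g w) \<ge> Re (g 0) - 2 * A" if "norm w \<le> 2 * r / 2" for w
  proof (rule borel_caratheodory[OF g(1) _ A _ that])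
    fix w :: complex assume "w \<in> ball 0 (2 * r)"
    thus "Re (g w) < Re (g 0) + A" using lnH_le[of w] lnH[of w] by (simp add: Re_g0 A_def)
  qed (use r in simp)
  have "AE t in circ. ln_mod f r t = mult0 * ln r + ln_mod H r t
            + (\<Sum>i\<in>S. ln (norm (1 - on_circle r t / a i)))"
    by (rule fourier_log_product(1)[OF fH2 holH2 Hnz finS]) (use r in \<open>auto simp: S_def\<close>)
  moreover have "AE t in circ. \<forall>i\<in>S. circle_pt t \<noteq> circle_pt (angle i)"
    by (intro AE_finite_allI finS AE_circ_circle_pt_neq)
  ultimately show ?thesis unfolding S_def[symmetric]
  proof eventually_elim
    case (elim t)
    have "- (\<Sum>i\<in>S. log_kernel (angle i) t) \<le> (\<Sum>i\<in>S. ln (norm (1 - on_circle r t / a i)))"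
      unfolding sum_negf[symmetric]
    proof (rule sum_mono)
      fix i assume i: "i \<in> S"
      show "- log_kernel (angle i) t \<le> ln (norm (1 - on_circle r t / a i))"
        by (rule ln_linear_factor_ge[OF angle(2)]) (use i elim r in \<open>auto simp: S_def\<close>)
    qed
    moreover have "ln_mod H r t \<ge> ln (norm lead) - 2 * A"
      using lower[of "on_circle r t"] lnH[of "on_circle r t"] r by (simp add: norm_mult Re_g0)
    moreover have "mult0 * ln r \<ge> 0" using r by simp
    ultimately show ?case using elim by (simp add: A_def)
  qed
qed

text \<open>On a small set of directions the negative part of \<open>ln \<bar>f\<bar>\<close> has a small integral: a logarithmic
  kernel \<open>l\<close> satisfies \<open>l \<le> M + l\<^sup>2 / M\<close>.\<close>

lemma integral_neg_ln_small_set: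
  obtains K where "K > 0" "\<And>r B E M. 1 \<le> r \<Longrightarrow> 1 \<le> B \<Longrightarrow> (\<And>w. norm w = 4 * r \<Longrightarrow> norm (f w) \<le> exp B) \<Longrightarrow>
    E \<in> sets circ \<Longrightarrow> 0 < M \<Longrightarrow>
    (\<integral>t. indicator E t * - ln_mod f r t \<partial>circ) \<le> K * B * (measure circ E * (1 + M) + 768 / M)"
proof (rule that[of "4 + 3 * \<bar>ln (norm lead)\<bar>"])
  define L where "L = \<bar>ln (norm lead)\<bar>"
  fix r B M :: real and E :: "real set"
  assume r: "1 \<le> r" and B: "1 \<le> B" "\<And>w. norm w = 4 * r \<Longrightarrow> norm (f w) \<le> exp B" and E[measurable]: "E \<in> sets circ" and M: "0 < M"
  define S where "S = {i\<in>I. a i \<noteq> 0 \<and> norm (a i) \<le> 2 * r}"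
  define D where "D = 2 * B + 2 + 3 * L"
  have B0: "0 \<le> B" using B by simp
  have int1: "integrable circ (\<lambda>t. indicator E t * - ln_mod f r t)"
    using integrable_real_mult_indicator[OF E, of "\<lambda>t. - ln_mod f r t"] integrable_ln_norm[of r] r
    by (simp add: mult.commute)
  have intE: "integrable circ (indicator E :: real \<Rightarrow> real)"
    by (intro integrable_real_indicator E) (simp add: less_top[symmetric] circ.emeasure_eq_measure)
  let ?u = "\<lambda>t. D * indicator E t + (\<Sum>i\<in>S. M * indicator E t + (log_kernel (angle i) t)\<^sup>2 / M)"
  have int2: "integrable circ ?u"
    by (intro Bochner_Integration.integrable_add Bochner_Integration.integrable_sum integrable_mult_right 
        integrable_divide log_kernel_square angle intE)
  have ae: "AE t in circ. ln_mod f r t \<ge> 3 * ln (norm lead) - 2 * B - 2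
           - (\<Sum>i\<in>S. log_kernel (angle i) t)"
    unfolding S_def by (rule ln_norm_ge[OF r B0 B(2)])
  have "(\<integral>t. indicator E t * - ln_mod f r t \<partial>circ) \<le> (\<integral>t. ?u t \<partial>circ)"
  proof (rule integral_mono_AE[OF int1 int2])
    show "AE t in circ. indicator E t * - ln_mod f r t \<le> ?u t"
      using ae
    proof eventually_elim
      case (elim t)
      show ?case
      proof (cases "t \<in> E")
        case True
        have "x \<le> M + x\<^sup>2 / M" if "x \<ge> 0" for x
        proof (cases "x \<le> M")
          case False
          hence "M * x \<le> x * x" using that by (intro mult_right_mono) auto
          hence "x \<le> x\<^sup>2 / M" using M by (simp add: power2_eq_square field_simps)
          thus ?thesis using M by simp
        qed (use M in \<open>simp add: add_increasing2\<close>)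
        hence "(\<Sum>i\<in>S. log_kernel (angle i) t) \<le> (\<Sum>i\<in>S. M + (log_kernel (angle i) t)\<^sup>2 / M)"
          by (intro sum_mono) (use log_kernel_nonneg in auto)
        moreover have "3 * ln (norm lead) \<ge> - 3 * L" by (simp add: L_def)
        ultimately show ?thesis using True elim by (simp add: D_def)
      next
        case False thus ?thesis using M by (simp add: sum_nonneg)
      qed
    qed
  qed
  also have "(\<integral>t. ?u t \<partial>circ) = D * measure circ E + (\<Sum>i\<in>S. M * measure circ E + (\<integral>t. (log_kernel (angle i) t)\<^sup>2 \<partial>circ) / M)"
    using log_kernel_square(1)[OF angle(1)] intE sets.sets_into_space[OF E]
    by (simp add: Bochner_Integration.integral_sum Int_absorb2)
  also have "\<dots> \<le> D * measure circ E + (\<Sum>i\<in>S. M * measure circ E + 768 / M)"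
    using M log_kernel_square(2)[OF angle(1)] by (intro add_mono sum_mono divide_right_mono order.refl) auto
  also have "\<dots> = D * measure circ E + card S * (M * measure circ E + 768 / M)" by simp
  \<comment> \<open>As B >= 1 absorbs additive constants, both \<open>D\<close> and the number of
    nearby zeros are at most (4 + 3 L) B.\<close>
  also have "\<dots> \<le> (4 + 3 * L) * B * measure circ E + (4 + 3 * L) * B * (M * measure circ E + 768 / M)"
  proof (intro add_mono mult_right_mono)
    have "L \<le> L * B" using B by (simp add: L_def mult_le_cancel_left1)
    thus "D \<le> (4 + 3 * L) * B" using B by (simp add: D_def algebra_simps)
    have "card S * (1/2) \<le> card S * ln (2::real)"
      using ln2_ge_two_thirds by (intro mult_left_mono) auto
    also have "\<dots> \<le> B - ln (norm lead)" using card_near_bound[OF r B0 B(2)] by (simp add: S_def)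
    also have "\<dots> \<le> B + L" by (simp add: L_def)
    finally have "card S \<le> 2 * (B + L)" by simp
    also have "2 * (B + L) \<le> (4 + 3 * L) * B" using \<open>L \<le> L * B\<close> B by (simp add: L_def algebra_simps)
    finally show "card S \<le> (4 + 3 * L) * B" .
  qed (use M in auto)
  also have "\<dots> = (4 + 3 * L) * B * (measure circ E * (1 + M) + 768 / M)" by (simp add: algebra_simps)
  finally show "(\<integral>t. indicator E t * - ln_mod f r t \<partial>circ) \<le>
     (4 + 3 * \<bar>ln (norm lead)\<bar>) * B * (measure circ E * (1 + M) + 768 / M)" by (simp add: L_def)
qed auto

end

subsection \<open>Sums of exponentials with a common leading degree\<close>

text \<open>The second component numbers the copies of a multiple zero.\<close>

definition zero_index :: "(complex \<Rightarrow> complex) \<Rightarrow> (complex \<times> nat) set" where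
  "zero_index g = (SIGMA w:{w. g w = 0}. {..<nat (zorder g w)})"

lemma enumerated_zeros_exists:
  assumes "g holomorphic_on UNIV" "\<exists>w. g w \<noteq> 0"
  shows "enumerated_zeros g (zero_index g) fst"
proof
  fix w assume w: "g w = 0"
  have "zorder g w > 0"
    using zorder_exist_zero[OF assms(1) open_UNIV connected_UNIV, of w] assms(2) w by auto
  moreover have "{i \<in> zero_index g. fst i = w} = Pair w ` {..<nat (zorder g w)}"
    using w by (auto simp: zero_index_def)
  ultimately show "int (card {i \<in> zero_index g. fst i = w}) = zorder g w"
    by (simp add: card_image inj_on_def)
qed (use assms in \<open>auto simp: zero_index_def\<close>)

lemma borel_measurable_entire_circle:
  assumes "g holomorphic_on UNIV"
  shows "(\<lambda>t. g (on_circle r t)) \<in> borel_measurable borel"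
  by (intro borel_measurable_continuous_onI continuous_on_compose2[OF holomorphic_on_imp_continuous_on[OF assms]]
        continuous_intros) auto

text \<open>At most order \<open>q\<close> and, at that order, minimal type.\<close>

definition log_growth_less :: "nat \<Rightarrow> (complex \<Rightarrow> complex) \<Rightarrow> bool" where
  "log_growth_less q g \<longleftrightarrow> (\<forall>\<delta>>0. \<exists>C. \<forall>z. norm (g z) \<le> C * exp (\<delta> * norm z ^ q))"

lemma filterlim_power_at_top_real: "q > 0 \<Longrightarrow> filterlim (\<lambda>r::real. r ^ q) at_top at_top"
  by (rule filterlim_pow_at_top) (auto intro: filterlim_ident)

lemma eventually_power_ge:
  assumes "q > 0" shows "eventually (\<lambda>r::real. r ^ q \<ge> C) at_top"
  using filterlim_power_at_top_real[OF assms] unfolding filterlim_at_top by blast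

lemma eventually_norm_le_exp:
  assumes "log_growth_less q g" "q > 0" "\<delta> > 0"
  shows "\<forall>\<^sub>F r in at_top. \<forall>z. norm z = r \<longrightarrow> norm (g z) \<le> exp (\<delta> * r ^ q)"
proof -
  obtain C where C: "\<And>z. norm (g z) \<le> C * exp (\<delta> / 2 * norm z ^ q)"
    using assms unfolding log_growth_less_def by (meson half_gt_zero)
  show ?thesis
    using eventually_power_ge[OF assms(2), of "ln (\<bar>C\<bar> + 1) / (\<delta> / 2)"]
  proof eventually_elim
    case (elim r)
    hence "ln (\<bar>C\<bar> + 1) \<le> \<delta> / 2 * r ^ q" using assms(3) by (simp add: field_simps)
    hence "exp (ln (\<bar>C\<bar> + 1)) \<le> exp (\<delta> / 2 * r ^ q)" by (simp only: exp_le_cancel_iff)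
    hence "C \<le> exp (\<delta> / 2 * r ^ q)" by simp
    hence "C * exp (\<delta> / 2 * r ^ q) \<le> exp (\<delta> / 2 * r ^ q) * exp (\<delta> / 2 * r ^ q)"
      by (intro mult_right_mono) auto
    also have "\<dots> = exp (\<delta> * r ^ q)" by (simp flip: exp_add)
    finally show ?case using C order.trans by blast
  qed
qed

text \<open>Jensen's formula bounds the mean of ln |g| below by a constant for r >= 1. So the
  non-negative function \<open>u\<close> has mean at most 2 \<open>\<delta>'\<close> r^q, and
  Markov's inequality with \<open>\<delta>'\<close> = \<open>\<delta>\<close> \<open>\<mu>\<close> /
  2 gives measure at most \<open>\<mu>\<close>.\<close>

lemma measure_small_values:
  assumes g: "g holomorphic_on UNIV" "\<exists>w. g w \<noteq> 0" and gr: "log_growth_less q g" and q: "q > 0" and \<delta>: "\<delta> > 0" and \<mu>: "\<mu> > 0"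
  shows "\<forall>\<^sub>F r in at_top. measure circ {t\<in>{0..1}. norm (g (on_circle r t)) < exp (- \<delta> * r ^ q)} \<le> \<mu>"
proof -
  interpret enumerated_zeros g "zero_index g" fst
    by (rule enumerated_zeros_exists[OF g])
  define \<delta>' where "\<delta>' = \<delta> * \<mu> / 2"
  have \<delta>': "\<delta>' > 0" using \<delta> \<mu> by (simp add: \<delta>'_def)
  show ?thesis
    using eventually_norm_le_exp[OF gr q \<delta>'] eventually_ge_at_top[of 1]
      eventually_power_ge[OF q, of "- ln (norm lead) / \<delta>'"]
  proof eventually_elim
    case (elim r)
    have r: "r \<ge> 1" using elim by auto
    define u where "u = (\<lambda>t. \<delta>' * r ^ q - ln_mod g r t)"
    have u0: "0 \<le> u t" for t
      unfolding u_def using r \<delta>' elim(1)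
      by (auto simp: norm_mult intro!: ln_norm_le)
    have intu: "integrable circ u" unfolding u_def
      by (intro Bochner_Integration.integrable_diff integrable_circ_const integrable_ln_norm) (use r in auto)
    \<comment> \<open>At a zero of \<open>g\<close> the default \<open>ln 0 = 0\<close> hides the
      small value, so these directions are excluded.\<close>
    have "countable {w. g w = 0}"
    proof (cases "g constant_on UNIV")
      case True
      then obtain c where "\<And>w. g w = c" by (auto simp: constant_on_def)
      with g(2) show ?thesis by simp
    next
      case False
      show ?thesis using holomorphic_countable_zeros[OF g(1) open_UNIV connected_UNIV _ False] by simp
    qed
    hence ae: "AE t in circ. on_circle r t \<notin> {w. g w = 0}"
      by (rule AE_circ_circle_pt_notin) (use r in auto)
    let ?A = "{t\<in>{0..1}. norm (g (on_circle r t)) < exp (- \<delta> * r ^ q)}"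
    let ?B = "{t\<in>space circ. u t \<ge> \<delta> * r ^ q}"
    have [measurable]: "(\<lambda>t. g (on_circle r t)) \<in> borel_measurable circ"
      by (intro measurable_circI borel_measurable_entire_circle g)
    have setsB: "?B \<in> sets circ"
      using borel_measurable_integrable[OF intu] by measurable
    have "measure circ ?A \<le> measure circ ?B"
    proof (rule circ.finite_measure_mono_AE[OF _ setsB])
      show "AE t in circ. t \<in> ?A \<longrightarrow> t \<in> ?B" using ae
      proof eventually_elim
        case (elim t)
        show ?case
        proof
          assume t: "t \<in> ?A"
          hence "ln_mod g r t < ln (exp (- \<delta> * r ^ q))"
            using elim by (subst ln_less_cancel_iff) auto
          moreover have "\<delta>' * r ^ q \<ge> 0" using \<delta>' r by simp
          ultimately show "t \<in> ?B" using t by (auto simp: u_def)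
        qed
      qed
    qed
    also have "\<dots> \<le> (\<integral>t. u t \<partial>circ) / (\<delta> * r ^ q)"
      using integral_Markov_inequality_measure[OF intu sets.top, of "\<delta> * r ^ q"] u0 \<delta> r by simp
    also have "(\<integral>t. u t \<partial>circ) = \<delta>' * r ^ q - (\<integral>t. ln_mod g r t \<partial>circ)"
      unfolding u_def using integrable_ln_norm[of r] r by simp
    also have "\<dots> \<le> \<delta>' * r ^ q - ln (norm lead)"
    proof -
      have "0 \<le> (\<Sum>i\<in>below r. ln (r / norm (fst i)))"
        by (intro sum_nonneg) (auto simp: below_def)
      moreover have "0 \<le> mult0 * ln r" using r by simp
      ultimately show ?thesis using jensen[of r] r by linarith
    qed
    also have "\<dots> \<le> 2 * \<delta>' * r ^ q" using elim \<delta>' by (simp add: field_simps)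
    also have "2 * \<delta>' * r ^ q / (\<delta> * r ^ q) = \<mu>" using \<delta> r by (simp add: \<delta>'_def)
    finally show "measure circ ?A \<le> \<mu>" using \<delta> r by (simp add: divide_right_mono)
  qed
qed

section \<open>Directions in which two exponents compete\<close>

lemma AE_Re_circle_pt_power_nonzero:
  assumes "c \<noteq> 0" "q > 0"
  shows "AE t in circ. Re (c * circle_pt t ^ q) \<noteq> 0"
proof -
  \<comment> \<open>A number of modulus |c| with vanishing real part is one of the two points i |c|
    and - i |c|, so the bad directions are roots of two equations of degree q.\<close>
  define Z where "Z = {x::complex. x ^ q = \<i> * norm c / c} \<union> {x. x ^ q = - \<i> * norm c / c}"
  have "countable Z" unfolding Z_def using finite_nth_roots[OF assms(2)] by (auto intro: countable_finite)
  from AE_circ_circle_pt_notin[OF this one_neq_zero] show ?thesis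
  proof eventually_elim
    case (elim t)
    show ?case
    proof
      assume 0: "Re (c * circle_pt t ^ q) = 0"
      define y where "y = c * circle_pt t ^ q"
      have "norm y = norm c" by (simp add: y_def norm_mult norm_power)
      moreover have "norm y = \<bar>Im y\<bar>" using 0 by (simp add: y_def[symmetric] cmod_def)
      ultimately have "\<bar>Im y\<bar> = norm c" by simp
      hence "y = \<i> * norm c \<or> y = - \<i> * norm c"
        using 0 by (auto simp: y_def[symmetric] complex_eq_iff abs_if split: if_splits)
      hence "circle_pt t \<in> Z" using assms by (auto simp: Z_def y_def field_simps)
      thus False using elim by simp
    qed
  qed
qed

text \<open>As \<open>\<eta>\<close> decreases to 0, each of these sets shrinks to the directions
  with equal real parts, a null set; continuity of the measure from above does the rest.\<close>

lemma measure_near_critical: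
  assumes "finite K" "q > 0" "\<mu> > 0"
  obtains \<eta> where "\<eta> > 0" "measure circ (\<Union>v\<in>K. \<Union>w\<in>K-{v}. {t\<in>{0..1}. \<bar>Re ((w - v) * circle_pt t ^ q)\<bar> < \<eta>}) \<le> \<mu>"
proof -
  define N where "N = (\<lambda>\<eta> v w. {t\<in>{0..1}. \<bar>Re ((w - v) * circle_pt t ^ q)\<bar> < \<eta>})"
  have sets[measurable]: "N \<eta> v w \<in> sets circ" for \<eta> v w
  proof -
    have "(\<lambda>t. \<bar>Re ((w - v) * circle_pt t ^ q)\<bar>) \<in> borel_measurable borel" 
      by (intro borel_measurable_continuous_onI continuous_intros)
    from measurable_circI[OF this] show ?thesis unfolding N_def space_circ[symmetric] by measurable
  qed
  have lim0: "(\<lambda>n. measure circ (N (inverse (real (Suc n))) v w)) \<longlonglongrightarrow> 0" if "w \<noteq> v" for v w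
  proof -
    have "(\<lambda>n. measure circ (N (inverse (real (Suc n))) v w)) \<longlonglongrightarrow> measure circ (\<Inter>n. N (inverse (real (Suc n))) v w)"
    proof (rule circ.finite_Lim_measure_decseq)
      show "decseq (\<lambda>n. N (inverse (real (Suc n))) v w)"
      proof (rule decseq_SucI, rule subsetI)
        fix n t assume "t \<in> N (inverse (real (Suc (Suc n)))) v w"
        moreover have "inverse (real (Suc (Suc n))) \<le> inverse (real (Suc n))" by simp
        ultimately show "t \<in> N (inverse (real (Suc n))) v w"
          unfolding N_def mem_Collect_eq by (meson less_le_trans)
      qed
      show "range (\<lambda>n. N (inverse (real (Suc n))) v w) \<subseteq> sets circ" using sets by blast
    qed
    also have "measure circ (\<Inter>n. N (inverse (real (Suc n))) v w) = 0"
    proof -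
      have "AE t in circ. t \<notin> (\<Inter>n. N (inverse (real (Suc n))) v w)"
      proof -
        have "AE t in circ. Re ((w - v) * circle_pt t ^ q) \<noteq> 0"
          by (rule AE_Re_circle_pt_power_nonzero) (use that assms(2) in auto)
        thus ?thesis
        proof eventually_elim
          case (elim t)
          then obtain n where "inverse (real (Suc n)) < \<bar>Re ((w - v) * circle_pt t ^ q)\<bar>"
            using reals_Archimedean[of "\<bar>Re ((w - v) * circle_pt t ^ q)\<bar>"] by (metis zero_less_abs_iff)
          hence "t \<notin> N (inverse (real (Suc n))) v w"
            unfolding N_def mem_Collect_eq using less_asym by blast
          thus ?case by blast
        qed
      qed
      hence ae: "AE t in circ. (t \<in> (\<Inter>n. N (inverse (real (Suc n))) v w)) = (t \<in> {})"
        by eventually_elim (simp only: empty_iff)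
      have "(\<Inter>n. N (inverse (real (Suc n))) v w) \<in> sets circ"
        by (intro sets.countable_INT' image_subsetI sets) simp_all
      hence "measure circ (\<Inter>n. N (inverse (real (Suc n))) v w) = measure circ {}"
        by (intro measure_eq_AE ae) simp_all
      thus ?thesis by simp
    qed
    finally show ?thesis .
  qed
  have "(\<lambda>n. \<Sum>v\<in>K. \<Sum>w\<in>K-{v}. measure circ (N (inverse (real (Suc n))) v w)) \<longlonglongrightarrow> (\<Sum>v\<in>K. \<Sum>w\<in>K-{v}. 0)"
    by (intro tendsto_sum lim0) auto
  hence "eventually (\<lambda>n. (\<Sum>v\<in>K. \<Sum>w\<in>K-{v}. measure circ (N (inverse (real (Suc n))) v w)) < \<mu>) sequentially"
    using assms(3) by (simp add: order_tendstoD)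
  then obtain n where n: "(\<Sum>v\<in>K. \<Sum>w\<in>K-{v}. measure circ (N (inverse (real (Suc n))) v w)) < \<mu>"
    by (auto simp: eventually_sequentially)
  show ?thesis
  proof (rule that[of "inverse (real (Suc n))"])
    have "measure circ (\<Union>v\<in>K. \<Union>w\<in>K-{v}. N (inverse (real (Suc n))) v w) \<le> (\<Sum>v\<in>K. measure circ (\<Union>w\<in>K-{v}. N (inverse (real (Suc n))) v w))"
      using assms(1) by (intro circ.finite_measure_subadditive_finite) auto
    also have "\<dots> \<le> (\<Sum>v\<in>K. \<Sum>w\<in>K-{v}. measure circ (N (inverse (real (Suc n))) v w))"
      using assms(1) by (intro sum_mono circ.finite_measure_subadditive_finite) auto
    finally have "measure circ (\<Union>v\<in>K. \<Union>w\<in>K-{v}. N (inverse (real (Suc n))) v w) \<le> \<mu>" using n by simp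
    thus "measure circ (\<Union>v\<in>K. \<Union>w\<in>K-{v}. {t\<in>{0..1}. \<bar>Re ((w - v) * circle_pt t ^ q)\<bar> < inverse (real (Suc n))}) \<le> \<mu>"
      by (simp only: N_def)
  qed simp
qed

text \<open>Having \<open>0 \<in> K\<close> costs only a zero-free factor and makes the limit function nonnegative, so that
  upper bounds for \<open>ln \<bar>f\<bar>\<close> survive the convention \<open>ln 0 = 0\<close> at the zeros of \<open>f\<close>.\<close>

locale leading_exponents =
  fixes q :: nat and K :: "complex set" and F :: "complex \<Rightarrow> complex \<Rightarrow> complex" and f :: "complex \<Rightarrow> complex"
  assumes q: "q > 0" and K: "finite K" "0 \<in> K"
    and F_holo: "\<And>w. w \<in> K \<Longrightarrow> F w holomorphic_on UNIV"
    and F_nonzero: "\<And>w. w \<in> K \<Longrightarrow> \<exists>z. F w z \<noteq> 0"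
    and F_growth: "\<And>w. w \<in> K \<Longrightarrow> log_growth_less q (F w)"
    and f_eq: "\<And>z. f z = (\<Sum>w\<in>K. F w z * exp (w * z ^ q))"
begin

text \<open>The support function of the convex hull of the conjugates of \<open>K\<close>, evaluated
  in direction \<open>circle_pt t ^ q\<close>.\<close>

definition indicator_fun :: "real \<Rightarrow> real" where
  "indicator_fun t = Max ((\<lambda>w. Re (w * circle_pt t ^ q)) ` K)"

definition Kmax :: real where
  "Kmax = (\<Sum>w\<in>K. norm w)"

lemma indicator_fun_ge: "w \<in> K \<Longrightarrow> Re (w * circle_pt t ^ q) \<le> indicator_fun t"
  unfolding indicator_fun_def using K by (intro Max_ge) auto

lemma indicator_fun_attained: "\<exists>w\<in>K. indicator_fun t = Re (w * circle_pt t ^ q)"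
proof -
  have "indicator_fun t \<in> (\<lambda>w. Re (w * circle_pt t ^ q)) ` K"
    unfolding indicator_fun_def using K by (intro Max_in) auto
  thus ?thesis by auto
qed

lemma indicator_fun_nonneg: "0 \<le> indicator_fun t"
  using indicator_fun_ge[OF K(2), of t] by simp

lemma indicator_fun_le: "indicator_fun t \<le> Kmax"
proof -
  obtain w where w: "w \<in> K" "indicator_fun t = Re (w * circle_pt t ^ q)"
    using indicator_fun_attained by blast
  have "Re (w * circle_pt t ^ q) \<le> norm w"
    using complex_Re_le_cmod[of "w * circle_pt t ^ q"] by (simp add: norm_mult norm_power)
  also have "\<dots> \<le> Kmax" unfolding Kmax_def using K w by (intro member_le_sum) auto
  finally show ?thesis using w by simp
qed

lemma Kmax_nonneg: "0 \<le> Kmax"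
  by (simp add: Kmax_def sum_nonneg)

lemma integrable_indicator_fun: "integrable circ indicator_fun"
proof (rule circ.integrable_const_bound[of _ Kmax])
  have "(\<lambda>t. Max ((\<lambda>w. Re (w * circle_pt t ^ q)) ` K)) \<in> borel_measurable borel"
  proof (rule borel_measurable_Max)
    show "(\<lambda>t. Re (w * circle_pt t ^ q)) \<in> borel_measurable borel" for w
      by (intro borel_measurable_continuous_onI continuous_intros)
  qed (rule K)
  thus "indicator_fun \<in> borel_measurable circ"
    unfolding indicator_fun_def[abs_def] by (rule measurable_circI)
qed (use indicator_fun_nonneg indicator_fun_le in auto)

lemma F_growth_circles:
  "\<delta> > 0 \<Longrightarrow> \<forall>\<^sub>F r in at_top. \<forall>w\<in>K. \<forall>z. norm z = r \<longrightarrow> norm (F w z) \<le> exp (\<delta> * r ^ q)"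
  by (intro eventually_ball_finite K ballI eventually_norm_le_exp F_growth q)

lemma f_upper:
  assumes "\<delta> > 0"
  shows "\<forall>\<^sub>F r in at_top. \<forall>t. norm (f (on_circle r t)) \<le> exp ((indicator_fun t + \<delta>) * r ^ q)"
proof -
  have "\<forall>\<^sub>F r in at_top. \<forall>w\<in>K. \<forall>z. norm z = r \<longrightarrow> norm (F w z) \<le> exp (\<delta> / 2 * r ^ q)"
    by (rule F_growth_circles) (use assms in simp)
  thus ?thesis
    using eventually_gt_at_top[of 0] eventually_power_ge[OF q, of "2 * ln (card K) / \<delta>"]
  proof eventually_elim
    case (elim r)
    show ?case
    proof
      fix t
      define z where "z = on_circle r t"
      have z: "norm z = r" using elim by (simp add: z_def norm_mult)
      have cK: "card K > 0" using K by (auto simp: card_gt_0_iff)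
      have "norm (f z) \<le> (\<Sum>w\<in>K. norm (F w z * exp (w * z ^ q)))"
        unfolding f_eq by (rule norm_sum)
      also have "\<dots> \<le> (\<Sum>w\<in>K. exp (\<delta> / 2 * r ^ q) * exp (indicator_fun t * r ^ q))"
      proof (rule sum_mono)
        fix w assume w: "w \<in> K"
        have "Re (w * z ^ q) = Re (w * circle_pt t ^ q) * r ^ q"
          by (simp add: z_def power_mult_distrib algebra_simps flip: of_real_power)
        also have "\<dots> \<le> indicator_fun t * r ^ q"
          using elim by (intro mult_right_mono indicator_fun_ge w) auto
        finally show "norm (F w z * exp (w * z ^ q)) \<le> exp (\<delta> / 2 * r ^ q) * exp (indicator_fun t * r ^ q)"
          using elim w z unfolding norm_mult by (intro mult_mono) auto
      qed
      also have "\<dots> = card K * exp ((indicator_fun t + \<delta> / 2) * r ^ q)"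
        by (simp add: ring_distribs flip: exp_add)
      also have "card K \<le> exp (\<delta> / 2 * r ^ q)"
      proof -
        have "ln (card K) \<le> \<delta> / 2 * r ^ q" using elim assms by (simp add: field_simps)
        hence "exp (ln (card K)) \<le> exp (\<delta> / 2 * r ^ q)" by simp
        thus ?thesis using cK by simp
      qed
      hence "card K * exp ((indicator_fun t + \<delta> / 2) * r ^ q) \<le> exp (\<delta> / 2 * r ^ q) * exp ((indicator_fun t + \<delta> / 2) * r ^ q)"
        by (intro mult_right_mono) auto
      also have "\<dots> = exp ((indicator_fun t + \<delta>) * r ^ q)"
        by (simp add: algebra_simps flip: exp_add)
      finally show "norm (f (on_circle r t)) \<le> exp ((indicator_fun t + \<delta>) * r ^ q)"
        by (simp add: z_def)
    qed
  qed
qed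

lemma f_holo: "f holomorphic_on UNIV"
  unfolding f_eq[abs_def] using F_holo by (intro holomorphic_intros) auto

text \<open>In a direction without near ties, and where no coefficient is unusually small, the
  leading term has at least twice the modulus of the sum of the others.\<close>

lemma f_lower:
  assumes \<eta>: "\<eta> > 0" and \<delta>: "\<delta> > 0" "\<delta> \<le> \<eta> / 4"
  shows "\<forall>\<^sub>F r in at_top. \<forall>t. 
     (\<forall>v\<in>K. \<forall>w\<in>K-{v}. \<bar>Re ((w - v) * circle_pt t ^ q)\<bar> \<ge> \<eta>) \<longrightarrow>
     (\<forall>w\<in>K. norm (F w (on_circle r t)) \<ge> exp (- \<delta> * r ^ q)) \<longrightarrow>
     ln_mod f r t \<ge> (indicator_fun t - 2 * \<delta>) * r ^ q"
proof -
  have "\<forall>\<^sub>F r in at_top. \<forall>w\<in>K. \<forall>z. norm z = r \<longrightarrow> norm (F w z) \<le> exp (\<eta> / 4 * r ^ q)"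
    by (rule F_growth_circles) (use \<eta> in simp)
  thus ?thesis
    using eventually_gt_at_top[of 0] eventually_power_ge[OF q, of "2 * ln (2 * card K) / \<eta>"]
      eventually_power_ge[OF q, of "ln 2 / \<delta>"]
  proof eventually_elim
    case (elim r)
    show ?case
    proof (intro allI impI)
      fix t
      define z where "z = on_circle r t"
      assume sep: "\<forall>v\<in>K. \<forall>w\<in>K-{v}. \<bar>Re ((w - v) * circle_pt t ^ q)\<bar> \<ge> \<eta>"
        and big: "\<forall>w\<in>K. norm (F w (on_circle r t)) \<ge> exp (- \<delta> * r ^ q)"
      have z: "norm z = r" using elim by (simp add: z_def norm_mult)
      have cK: "card K > 0" using K by (auto simp: card_gt_0_iff)
      define h where "h = indicator_fun t"
      define \<rho> where "\<rho> = r ^ q"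
      have \<rho>: "\<rho> > 0" "\<eta> / 2 * \<rho> \<ge> ln (2 * card K)" "\<delta> * \<rho> \<ge> ln 2"
        using elim \<eta> \<delta> by (auto simp: \<rho>_def field_simps)
      have Re_eq: "Re (w * z ^ q) = Re (w * circle_pt t ^ q) * \<rho>" for w
        by (simp add: z_def \<rho>_def power_mult_distrib algebra_simps flip: of_real_power)
      obtain w where w: "w \<in> K" "h = Re (w * circle_pt t ^ q)"
        using indicator_fun_attained by (auto simp: h_def)
      have others: "Re (v * circle_pt t ^ q) \<le> h - \<eta>" if v: "v \<in> K - {w}" for v
      proof -
        have "\<bar>Re ((v - w) * circle_pt t ^ q)\<bar> \<ge> \<eta>" using sep w v by blast
        moreover have "Re (v * circle_pt t ^ q) \<le> h" using indicator_fun_ge[of v t] v by (simp add: h_def)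
        moreover have "Re ((v - w) * circle_pt t ^ q) = Re (v * circle_pt t ^ q) - h"
          by (simp add: w(2) left_diff_distrib)
        ultimately show ?thesis by linarith
      qed
      have rest: "norm (\<Sum>v\<in>K-{w}. F v z * exp (v * z ^ q)) \<le> exp ((h - \<delta>) * \<rho>) / 2"
      proof -
        have "norm (\<Sum>v\<in>K-{w}. F v z * exp (v * z ^ q)) \<le> (\<Sum>v\<in>K-{w}. exp (\<eta> / 4 * \<rho>) * exp ((h - \<eta>) * \<rho>))"
        proof (rule order.trans[OF norm_sum sum_mono])
          fix v assume v: "v \<in> K - {w}"
          have "Re (v * z ^ q) \<le> (h - \<eta>) * \<rho>"
            unfolding Re_eq using \<rho> others[OF v] by (intro mult_right_mono) auto
          thus "norm (F v z * exp (v * z ^ q)) \<le> exp (\<eta> / 4 * \<rho>) * exp ((h - \<eta>) * \<rho>)"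
            using elim v z unfolding norm_mult by (intro mult_mono) (auto simp: \<rho>_def)
        qed
        also have "\<dots> \<le> card K * exp (\<eta> / 4 * \<rho> + (h - \<eta>) * \<rho>)"
          using card_mono[OF K(1), of "K - {w}"] by (auto simp: exp_add intro!: mult_right_mono)
        \<comment> \<open>The gap \<open>\<eta>\<close> is spent in three portions: a quarter on the
          growth of the coefficients, a half on the number of terms, and the last quarter dominates
          \<open>\<delta>\<close>.\<close>
        also have "\<eta> / 4 * \<rho> + (h - \<eta>) * \<rho> = (h - \<eta> / 4) * \<rho> - \<eta> / 2 * \<rho>"
          by (simp add: algebra_simps)
        also have "exp \<dots> = exp ((h - \<eta> / 4) * \<rho>) / exp (\<eta> / 2 * \<rho>)" by (rule exp_diff)
        also have "card K * (exp ((h - \<eta> / 4) * \<rho>) / exp (\<eta> / 2 * \<rho>)) \<le> exp ((h - \<delta>) * \<rho>) / 2"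
        proof -
          have "exp (ln (2 * real (card K))) \<le> exp (\<eta> / 2 * \<rho>)" using \<rho> by simp
          hence 1: "2 * real (card K) \<le> exp (\<eta> / 2 * \<rho>)" using cK by simp
          have 2: "exp ((h - \<eta> / 4) * \<rho>) \<le> exp ((h - \<delta>) * \<rho>)"
            using \<delta> \<rho> by (simp add: mult_right_mono)
          have "card K * exp ((h - \<eta> / 4) * \<rho>) * 2 = (2 * real (card K)) * exp ((h - \<eta> / 4) * \<rho>)" by simp
          also have "\<dots> \<le> exp (\<eta> / 2 * \<rho>) * exp ((h - \<delta>) * \<rho>)"
            by (rule mult_mono[OF 1 2]) auto
          finally show ?thesis by (simp add: divide_simps mult_ac)
        qed
        finally show ?thesis .
      qed
      have main: "norm (F w z * exp (w * z ^ q)) \<ge> exp ((h - \<delta>) * \<rho>)"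
      proof -
        have "exp ((h - \<delta>) * \<rho>) = exp (- \<delta> * \<rho>) * exp (h * \<rho>)"
          by (simp add: algebra_simps flip: exp_add)
        also have "\<dots> \<le> norm (F w z) * exp (h * \<rho>)"
          using big w by (intro mult_right_mono) (auto simp: z_def \<rho>_def)
        also have "\<dots> = norm (F w z * exp (w * z ^ q))" by (simp only: norm_mult norm_exp_eq_Re Re_eq w(2))
        finally show ?thesis .
      qed
      have "f z = F w z * exp (w * z ^ q) + (\<Sum>v\<in>K-{w}. F v z * exp (v * z ^ q))"
        unfolding f_eq using K(1) w(1) by (rule sum.remove)
      hence "norm (f z) \<ge> norm (F w z * exp (w * z ^ q)) - norm (\<Sum>v\<in>K-{w}. F v z * exp (v * z ^ q))"
        using norm_diff_ineq by metis
      hence "norm (f z) \<ge> exp ((h - \<delta>) * \<rho>) / 2" using main rest by linarith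
      moreover have "exp ((h - 2 * \<delta>) * \<rho>) \<le> exp ((h - \<delta>) * \<rho>) / 2"
      proof -
        have "exp ((h - 2 * \<delta>) * \<rho>) \<le> exp ((h - \<delta>) * \<rho> - ln 2)" using \<rho>(3) by (simp add: algebra_simps)
        thus ?thesis by (simp add: exp_diff)
      qed
      ultimately have le: "exp ((h - 2 * \<delta>) * \<rho>) \<le> norm (f z)" by linarith
      have "ln (exp ((h - 2 * \<delta>) * \<rho>)) \<le> ln (norm (f z))"
        by (intro ln_mono le) (use less_le_trans[OF exp_gt_zero le] in auto)
      thus "ln_mod f r t \<ge> (indicator_fun t - 2 * \<delta>) * r ^ q"
        by (simp add: h_def \<rho>_def z_def)
    qed
  qed
qed

lemma ln_f_converges_L1:
  assumes nz: "\<exists>z. f z \<noteq> 0"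
  shows "((\<lambda>r. \<integral>t. \<bar>ln_mod f r t / r ^ q - indicator_fun t\<bar> \<partial>circ) \<longlongrightarrow> 0) at_top"
proof -
  interpret enumerated_zeros f "zero_index f" fst
    by (rule enumerated_zeros_exists[OF f_holo nz])
  obtain C where C: "C > 0" "\<And>r B E M. 1 \<le> r \<Longrightarrow> 1 \<le> B \<Longrightarrow> (\<And>w. norm w = 4 * r \<Longrightarrow> norm (f w) \<le> exp B) \<Longrightarrow>
    E \<in> sets circ \<Longrightarrow> 0 < M \<Longrightarrow>
    (\<integral>t. indicator E t * - ln_mod f r t \<partial>circ) \<le> C * B * (measure circ E * (1 + M) + 768 / M)"
    by (rule integral_neg_ln_small_set) blast
  \<comment> \<open>The power of 4 arises because the lower estimate at radius r uses an upper bound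
    for |f| at radius 4 r.\<close>
  define C' where "C' = C * (Kmax + 1) * 4 ^ q"
  have C': "C' > 0" using C(1) Kmax_nonneg by (simp add: C'_def)
  have bound: "\<forall>\<^sub>F r in at_top. (\<integral>t. \<bar>ln_mod f r t / r ^ q - indicator_fun t\<bar> \<partial>circ) \<le> 6 * \<epsilon>"
    if \<epsilon>: "\<epsilon> > 0" for \<epsilon>
  proof -
    \<comment> \<open>\<open>M\<close> makes C' 768 / M equal to \<open>\<epsilon>\<close>; then
      \<open>\<mu>\<close> makes all terms proportional to the measure of the exceptional set add up
      to at most \<open>\<epsilon>\<close>.\<close>
    define M where "M = 768 * C' / \<epsilon>"
    have M: "M > 0" using C' \<epsilon> by (simp add: M_def)
    define \<mu> where "\<mu> = \<epsilon> / (Kmax + \<epsilon> + C' * (1 + M))"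
    have den: "Kmax + \<epsilon> + C' * (1 + M) > 0"
      using Kmax_nonneg \<epsilon> C' M by (intro add_nonneg_pos add_pos_pos mult_pos_pos) auto
    have \<mu>: "\<mu> > 0" using \<epsilon> den by (simp add: \<mu>_def)
    obtain \<eta> where \<eta>: "\<eta> > 0" "measure circ (\<Union>v\<in>K. \<Union>w\<in>K-{v}. {t\<in>{0..1}. \<bar>Re ((w - v) * circle_pt t ^ q)\<bar> < \<eta>}) \<le> \<mu> / 2"
      using measure_near_critical[OF K(1) q, of "\<mu> / 2"] \<mu> by auto
    define \<delta> where "\<delta> = min \<epsilon> (\<eta> / 4)"
    have \<delta>: "\<delta> > 0" "\<delta> \<le> \<eta> / 4" "\<delta> \<le> \<epsilon>" using \<epsilon> \<eta> by (auto simp: \<delta>_def)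
    define N where "N = (\<Union>v\<in>K. \<Union>w\<in>K-{v}. {t\<in>{0..1}. \<bar>Re ((w - v) * circle_pt t ^ q)\<bar> < \<eta>})"
    define P where "P = (\<lambda>r w. {t\<in>{0..1}. norm (F w (on_circle r t)) < exp (- \<delta> * r ^ q)})"
    have cK: "card K > 0" using K by (auto simp: card_gt_0_iff)
    have "\<forall>\<^sub>F r in at_top. \<forall>w\<in>K. measure circ (P r w) \<le> \<mu> / (2 * card K)"
      unfolding P_def using \<mu> cK
      by (intro eventually_ball_finite K ballI measure_small_values F_holo F_nonzero F_growth q \<delta>) auto
    moreover have "\<forall>\<^sub>F r in at_top. \<forall>t. norm (f (on_circle (4 * r) t)) \<le> exp ((indicator_fun t + 1) * (4 * r) ^ q)"
      using f_upper[of 1] by (rule eventually_compose_filterlim) 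
        (auto intro!: filterlim_tendsto_pos_mult_at_top[OF tendsto_const] filterlim_ident)
    ultimately show ?thesis
      using f_upper[OF \<epsilon>] f_lower[OF \<eta>(1) \<delta>(1,2)] eventually_ge_at_top[of 1]
    proof eventually_elim
      case (elim r)
      define \<rho> where "\<rho> = r ^ q"
      have r: "r \<ge> 1" and \<rho>: "\<rho> \<ge> 1" using elim by (auto simp: \<rho>_def)
      define X where "X = (\<lambda>t. ln_mod f r t / \<rho>)"
      define E where "E = N \<union> (\<Union>w\<in>K. P r w)"
      have intX: "integrable circ X" unfolding X_def
        by (intro integrable_divide integrable_ln_norm) (use r in auto)
      have setsN: "N \<in> sets circ" unfolding N_def
      proof (intro sets.finite_UN K finite_Diff)
        fix v w assume "v \<in> K" "w \<in> K - {v}"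
        have "(\<lambda>t. \<bar>Re ((w - v) * circle_pt t ^ q)\<bar>) \<in> borel_measurable borel" 
          by (intro borel_measurable_continuous_onI continuous_intros)
        from measurable_circI[OF this] show "{t\<in>{0..1}. \<bar>Re ((w - v) * circle_pt t ^ q)\<bar> < \<eta>} \<in> sets circ"
          unfolding space_circ[symmetric] by measurable
      qed
      have setsP: "P r w \<in> sets circ" if "w \<in> K" for w
      proof -
        have [measurable]: "(\<lambda>t. F w (on_circle r t)) \<in> borel_measurable circ"
          by (intro measurable_circI borel_measurable_entire_circle F_holo that)
        show ?thesis unfolding P_def space_circ[symmetric] by measurable
      qed
      have setsE: "E \<in> sets circ" unfolding E_def
        by (intro sets.Un setsN sets.finite_UN K setsP)
      have mE: "measure circ E \<le> \<mu>"
      proof -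
        have "measure circ E \<le> measure circ N + measure circ (\<Union>w\<in>K. P r w)"
          unfolding E_def by (intro measure_Un_le setsN sets.finite_UN K setsP)
        also have "measure circ (\<Union>w\<in>K. P r w) \<le> (\<Sum>w\<in>K. measure circ (P r w))"
          by (intro circ.finite_measure_subadditive_finite K) (use setsP in auto)
        also have "\<dots> \<le> (\<Sum>w\<in>K. \<mu> / (2 * card K))"
          using elim by (intro sum_mono) auto
        also have "\<dots> = \<mu> / 2" using cK by simp
        finally show ?thesis using \<eta>(2) by (simp add: N_def)
      qed
      have up: "X t \<le> indicator_fun t + \<epsilon>" for t
      proof -
        have "ln_mod f r t \<le> (indicator_fun t + \<epsilon>) * \<rho>"
          using elim \<rho> \<epsilon> indicator_fun_nonneg[of t] by (intro ln_norm_le) (auto simp: \<rho>_def)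
        thus ?thesis using \<rho> by (simp add: X_def divide_le_eq)
      qed
      have low: "indicator_fun t - 2 * \<epsilon> \<le> X t" if "t \<in> {0..1}" "t \<notin> E" for t
      proof -
        have "ln_mod f r t \<ge> (indicator_fun t - 2 * \<delta>) * r ^ q"
        proof (rule elim(4)[rule_format])
          show "\<bar>Re ((w - v) * circle_pt t ^ q)\<bar> \<ge> \<eta>" if "v \<in> K" "w \<in> K - {v}" for v w
            using \<open>t \<notin> E\<close> \<open>t \<in> {0..1}\<close> that unfolding E_def N_def by (force simp only: not_less[symmetric] UN_iff Un_iff mem_Collect_eq)
          show "exp (- \<delta> * r ^ q) \<le> norm (F w (on_circle r t))" if "w \<in> K" for w
            using \<open>t \<notin> E\<close> \<open>t \<in> {0..1}\<close> that unfolding E_def P_def by (force simp only: not_less[symmetric] UN_iff Un_iff mem_Collect_eq)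
        qed
        hence "indicator_fun t - 2 * \<delta> \<le> X t" using \<rho> by (simp add: X_def \<rho>_def le_divide_eq)
        thus ?thesis using \<delta> by simp
      qed
      have intE: "integrable circ (indicator E :: real \<Rightarrow> real)"
        by (intro integrable_real_indicator setsE) (simp add: less_top[symmetric] circ.emeasure_eq_measure)
      have intEX: "integrable circ (\<lambda>t. indicator E t * - X t)"
        using integrable_real_mult_indicator[OF setsE, of "\<lambda>t. - X t"] intX by (simp add: mult.commute)
      \<comment> \<open>Off \<open>E\<close> both one-sided bounds hold. On \<open>E\<close> the
        upper bound alone gives |X - h| <= h - X + 2 \<open>\<epsilon>\<close>, so only the integral
        of - X over \<open>E\<close> has to be controlled.\<close>
      have "(\<integral>t. \<bar>X t - indicator_fun t\<bar> \<partial>circ) \<le> (\<integral>t. 4 * \<epsilon> + (Kmax + \<epsilon>) * indicator E t + indicator E t * - X t \<partial>circ)"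
      proof (intro integral_mono integrable_abs Bochner_Integration.integrable_diff intX integrable_indicator_fun
            Bochner_Integration.integrable_add integrable_circ_const integrable_mult_right intE intEX)
        fix t assume t: "t \<in> space circ"
        show "\<bar>X t - indicator_fun t\<bar> \<le> 4 * \<epsilon> + (Kmax + \<epsilon>) * indicator E t + indicator E t * - X t"
          using up[of t] low[of t] t \<epsilon> indicator_fun_le[of t] indicator_fun_nonneg[of t]
          by (cases "t \<in> E") auto
      qed
      also have "\<dots> = 4 * \<epsilon> + (Kmax + \<epsilon>) * measure circ E + (\<integral>t. indicator E t * - X t \<partial>circ)"
        using intE intEX sets.sets_into_space[OF setsE] by (simp add: Int_absorb2)
      also have "(\<integral>t. indicator E t * - X t \<partial>circ) = (\<integral>t. indicator E t * - ln_mod f r t \<partial>circ) / \<rho>"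
        by (simp add: X_def)
      also have "(\<integral>t. indicator E t * - ln_mod f r t \<partial>circ) \<le> 
          C * ((Kmax + 1) * (4 * r) ^ q) * (measure circ E * (1 + M) + 768 / M)"
      proof (rule C(2)[OF r _ _ setsE M])
        have "1 * 1 \<le> (Kmax + 1) * (4 * r) ^ q"
          using Kmax_nonneg r by (intro mult_mono one_le_power) auto
        thus "1 \<le> (Kmax + 1) * (4 * r) ^ q" by simp
        fix w :: complex assume w: "norm w = 4 * r"
        obtain s where s: "w = of_real (norm w) * circle_pt s" using circle_pt_polar by blast
        have "norm (f w) \<le> exp ((indicator_fun s + 1) * (4 * r) ^ q)"
          using elim(2) s w by metis
        also have "\<dots> \<le> exp ((Kmax + 1) * (4 * r) ^ q)"
          using indicator_fun_le[of s] r by (simp add: mult_right_mono)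
        finally show "norm (f w) \<le> exp ((Kmax + 1) * (4 * r) ^ q)" .
      qed
      hence "(\<integral>t. indicator E t * - ln_mod f r t \<partial>circ) / \<rho> \<le> 
          C * ((Kmax + 1) * (4 * r) ^ q) * (measure circ E * (1 + M) + 768 / M) / \<rho>"
        using \<rho> by (intro divide_right_mono) auto
      also have "\<dots> = C' * (measure circ E * (1 + M) + 768 / M)"
        using r by (simp add: C'_def \<rho>_def power_mult_distrib)
      also have "4 * \<epsilon> + (Kmax + \<epsilon>) * measure circ E + C' * (measure circ E * (1 + M) + 768 / M)
          = 4 * \<epsilon> + (Kmax + \<epsilon> + C' * (1 + M)) * measure circ E + C' * 768 / M"
        by (simp add: algebra_simps)
      also have "\<dots> \<le> 4 * \<epsilon> + (Kmax + \<epsilon> + C' * (1 + M)) * \<mu> + C' * 768 / M"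
        using den mE by (intro add_mono mult_left_mono order.refl) auto
      also have "(Kmax + \<epsilon> + C' * (1 + M)) * \<mu> = \<epsilon>" using den by (simp add: \<mu>_def)
      also have "C' * 768 / M = \<epsilon>" using C' by (simp add: M_def)
      finally show ?case by (simp add: X_def \<rho>_def)
    qed
  qed
  show ?thesis
  proof (rule tendstoI)
    fix e :: real assume e: "e > 0"
    show "\<forall>\<^sub>F r in at_top. dist (\<integral>t. \<bar>ln_mod f r t / r ^ q - indicator_fun t\<bar> \<partial>circ) 0 < e"
      \<comment> \<open>With \<open>\<epsilon>\<close> = e / 7 the bound 6 \<open>\<epsilon>\<close>
        stays strictly below \<open>e\<close>.\<close>
      using bound[OF divide_pos_pos[OF e, of 7, OF zero_less_numeral]]
    proof eventually_elim
      case (elim r)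
      have "0 \<le> (\<integral>t. \<bar>ln_mod f r t / r ^ q - indicator_fun t\<bar> \<partial>circ)"
        by simp
      with elim e show ?case by (simp add: dist_real_def)
    qed
  qed
qed

end

subsection \<open>Asymptotics of the zeros\<close>

lemma tendsto_at_top_scale:
  fixes g :: "real \<Rightarrow> 'b :: topological_space"
  assumes "(g \<longlongrightarrow> L) at_top" "b > 0"
  shows "((\<lambda>r. g (b * r)) \<longlongrightarrow> L) at_top"
  by (rule filterlim_compose[OF assms(1)])
     (use assms(2) in \<open>auto intro!: filterlim_tendsto_pos_mult_at_top[OF tendsto_const] filterlim_ident\<close>)

lemma tendsto_at_top_scale_power:
  fixes g :: "real \<Rightarrow> 'b :: real_normed_vector"
  assumes "((\<lambda>r. g r /\<^sub>R r ^ q) \<longlongrightarrow> L) at_top" "b > 0"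
  shows "((\<lambda>r. g (b * r) /\<^sub>R r ^ q) \<longlongrightarrow> b ^ q *\<^sub>R L) at_top"
proof -
  have "((\<lambda>r. b ^ q *\<^sub>R (g (b * r) /\<^sub>R (b * r) ^ q)) \<longlongrightarrow> b ^ q *\<^sub>R L) at_top"
    by (intro tendsto_intros tendsto_at_top_scale[OF assms])
  moreover have "(\<lambda>r. b ^ q *\<^sub>R (g (b * r) /\<^sub>R (b * r) ^ q)) = (\<lambda>r. g (b * r) /\<^sub>R r ^ q)"
    using assms(2) by (simp add: power_mult_distrib fun_eq_iff)
  ultimately show ?thesis by simp
qed

text \<open>The approximate limit may change with \<open>\<epsilon>\<close>, as it does when an
  auxiliary ratio of radii is chosen for each \<open>\<epsilon>\<close>; completeness supplies the
  true limit.\<close>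

lemma convergent_at_top_if_approx:
  fixes x :: "real \<Rightarrow> 'b :: complete_space"
  assumes "\<And>\<epsilon>. \<epsilon> > 0 \<Longrightarrow> \<exists>L. \<forall>\<^sub>F r in at_top. dist (x r) L \<le> \<epsilon>"
  shows "\<exists>L. (x \<longlongrightarrow> L) at_top"
proof -
  have "cauchy_filter (filtermap x at_top)"
    unfolding cauchy_filter_metric_filtermap
  proof (intro allI impI)
    fix e :: real assume e: "e > 0"
    then obtain L where L: "\<forall>\<^sub>F r in at_top. dist (x r) L \<le> e / 3" using assms[of "e / 3"] by auto
    have "dist (x r) (x s) < e" if "dist (x r) L \<le> e / 3" "dist (x s) L \<le> e / 3" for r s
      using that e dist_triangle2[of "x r" "x s" L] by linarith
    thus "\<exists>P. eventually P at_top \<and> (\<forall>r s. P r \<and> P s \<longrightarrow> dist (x r) (x s) < e)"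
      using L by blast
  qed
  moreover have "filtermap x at_top \<noteq> bot" by (simp add: filtermap_bot_iff)
  ultimately obtain L where "filtermap x at_top \<le> nhds L"
    using complete_UNIV complete_uniform[of "UNIV :: 'b set"] by auto
  thus ?thesis unfolding filterlim_def by blast
qed

text \<open>The map y -> \<open>\<beta>\<close> y + e (1 - \<open>\<beta>\<close>) has fixed point
  \<open>e\<close> and contracts by \<open>\<beta>\<close>. A radius beyond R b^n can be divided by
  \<open>b\<close> n times without leaving the good range, and boundedness controls the starting
  value.\<close>

lemma eventually_le_if_contracting:
  fixes Y :: "real \<Rightarrow> real"
  assumes b: "b > 1" and \<beta>: "0 \<le> \<beta>" "\<beta> < 1" and \<epsilon>: "\<epsilon> > 0"
    and step: "\<forall>\<^sub>F r in at_top. Y (b * r) \<le> \<beta> * Y r + e * (1 - \<beta>)"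
    and bdd: "\<forall>\<^sub>F r in at_top. Y r \<le> B"
  shows "\<forall>\<^sub>F r in at_top. Y r \<le> e + \<epsilon>"
proof -
  have "\<forall>\<^sub>F r in at_top. Y (b * r) \<le> \<beta> * Y r + e * (1 - \<beta>) \<and> Y r \<le> B \<and> 0 < r"
    using step bdd eventually_gt_at_top[of 0] by eventually_elim auto
  then obtain R where R: "\<And>r. r \<ge> R \<Longrightarrow> Y (b * r) \<le> \<beta> * Y r + e * (1 - \<beta>) \<and> Y r \<le> B \<and> 0 < r"
    unfolding eventually_at_top_linorder by blast
  define C where "C = \<bar>B - e\<bar>"
  have *: "Y r \<le> e + \<beta> ^ n * C" if "r \<ge> R * b ^ n" for n r
    using that
  proof (induction n arbitrary: r)
    case 0
    hence "Y r \<le> B" using R[of r] by simp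
    thus ?case unfolding C_def power_0 mult_1 by linarith
  next
    case (Suc n)
    define r' where "r' = r / b"
    have r: "r = b * r'" using b by (simp add: r'_def)
    have r': "r' \<ge> R * b ^ n" using Suc.prems b by (simp add: r'_def field_simps)
    have "R \<le> R * b ^ n" using R[of R] b by simp
    hence "R \<le> r'" using r' by linarith
    hence "Y r \<le> \<beta> * Y r' + e * (1 - \<beta>)" unfolding r using R by blast
    also have "\<dots> \<le> \<beta> * (e + \<beta> ^ n * C) + e * (1 - \<beta>)"
      using Suc.IH[OF r'] \<beta> by (intro add_right_mono mult_left_mono) auto
    also have "\<dots> = e + \<beta> ^ Suc n * C" by (simp add: algebra_simps)
    finally show ?case .
  qed
  have "(\<lambda>n. \<beta> ^ n * C) \<longlonglongrightarrow> 0 * C" using \<beta> by (intro tendsto_intros LIMSEQ_realpow_zero) auto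
  hence "eventually (\<lambda>n. \<beta> ^ n * C < \<epsilon>) sequentially" using \<epsilon> by (simp add: order_tendstoD)
  then obtain n where n: "\<beta> ^ n * C < \<epsilon>" by (auto simp: eventually_sequentially)
  show ?thesis using eventually_ge_at_top[of "R * b ^ n"]
    by eventually_elim (use * n in force)
qed

lemma exp_minus_1_over_tendsto: "((\<lambda>h. (exp (c * h) - 1) / h) \<longlongrightarrow> c) (at_right (0::real))"
proof -
  have "((\<lambda>h. exp (c * h)) has_real_derivative c) (at 0)"
    by (auto intro!: derivative_eq_intros)
  hence "((\<lambda>h. (exp (c * h) - 1) / h) \<longlongrightarrow> c) (at 0)"
    by (simp add: DERIV_def)
  thus ?thesis by (rule filterlim_mono) (auto simp: at_within_le_at)
qed

text \<open>For x = b r / |w|, between 1 and b, the two powers are x^k and x^(-k) times the same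
  unimodular number, and x^k - x^(-k) increases with x.\<close>

lemma norm_linear_pair:
  assumes "r > 0" "r \<le> norm w" "norm w \<le> b * r" "b > 1"
  shows "norm ((of_real (b * r) / w) ^ k - (cnj w / of_real (b * r)) ^ k) \<le> b ^ k - 1 / b ^ k"
proof -
  define x where "x = b * r / norm w"
  have w: "norm w > 0" using assms by linarith
  have x: "1 \<le> x" "x \<le> b" using assms w by (auto simp: x_def field_simps)
  have e1: "of_real (b * r) / w = of_real x * cnj (sgn w)"
    unfolding x_def by (rule of_real_div_eq_sgn)
  have e2: "cnj w / of_real (b * r) = of_real (1 / x) * cnj (sgn w)"
    using w by (simp add: x_def sgn_div_norm scaleR_conv_of_real)
  have "(of_real (b * r) / w) ^ k - (cnj w / of_real (b * r)) ^ k = of_real (x ^ k - (1 / x) ^ k) * cnj (sgn w) ^ k"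
    unfolding e1 e2 by (simp add: power_mult_distrib left_diff_distrib power_divide)
  hence "norm ((of_real (b * r) / w) ^ k - (cnj w / of_real (b * r)) ^ k) = \<bar>x ^ k - (1 / x) ^ k\<bar>"
    using w by (simp add: norm_mult norm_power norm_sgn del: of_real_diff of_real_power)
  also have "\<dots> = x ^ k - (1 / x) ^ k"
  proof -
    have "(1 / x) ^ k \<le> x ^ k" using x by (intro power_mono order.trans[of "1/x" 1 x]) auto
    thus ?thesis by simp
  qed
  also have "\<dots> \<le> b ^ k - (1 / b) ^ k"
    using x by (intro diff_mono power_mono divide_left_mono) auto
  finally show ?thesis by (simp add: power_divide)
qed

lemma power_gap_small:
  fixes D :: real
  assumes "\<epsilon> > 0"
  obtains b where "b > 1" "(b ^ k - 1) * D < \<epsilon>"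
proof -
  have "((\<lambda>b. (b ^ k - 1) * D) \<longlongrightarrow> (1 ^ k - 1) * D) (at_right 1)"
    by (intro tendsto_intros tendsto_ident_at)
  hence "\<forall>\<^sub>F b in at_right 1. (b ^ k - 1) * D < \<epsilon>"
    using assms by (intro order_tendstoD(2)) auto
  hence "\<forall>\<^sub>F b in at_right 1. (b ^ k - 1) * D < \<epsilon> \<and> 1 < b"
    using eventually_at_right_less by (rule eventually_conj)
  thus ?thesis using that eventually_happens'[OF trivial_limit_at_right_real] by blast
qed

text \<open>From here on only the normalised limits of the Fourier coefficients matter; the
  exponential form of \<open>f\<close> is forgotten.\<close>

locale zero_asymptotics = enumerated_zeros f I a
  for f :: "complex \<Rightarrow> complex" and I :: "'i set" and a +
  fixes q :: nat and h0 :: real and H :: "nat \<Rightarrow> complex"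
  assumes q: "q > 0" and h0: "h0 > 0"
    and lim0: "((\<lambda>r. (\<integral>t. ln_mod f r t \<partial>circ) / r ^ q) \<longlongrightarrow> h0) at_top"
    and limk: "\<And>k. ((\<lambda>r. fourier_log f k r /\<^sub>R r ^ q) \<longlongrightarrow> H k) at_top"
begin

definition cnt :: "real \<Rightarrow> real" where
  "cnt r = real (card (below r))"

lemma below_mono: "r \<le> s \<Longrightarrow> below r \<subseteq> below s"
  by (auto simp: below_def)

lemma cnt_diff: "r \<le> s \<Longrightarrow> real (card (below s - below r)) = cnt s - cnt r"
  unfolding cnt_def using card_Diff_subset[OF finite_below below_mono] card_mono[OF finite_below below_mono]
  by (simp add: of_nat_diff)

text \<open>The Jensen sum behaves like h0 r^q, and r times its derivative is the counting function,
  which suggests q h0.\<close>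

definition density :: real where
  "density = real q * h0"

lemma density_pos: "density > 0"
  using q h0 by (simp add: density_def)

lemma jensen_sum_limit: "((\<lambda>r. (\<Sum>i\<in>below r. ln (r / norm (a i))) /\<^sub>R r ^ q) \<longlongrightarrow> h0) at_top"
proof -
  have 1: "((\<lambda>r::real. ln r / r ^ q) \<longlongrightarrow> 0) at_top"
  proof (rule tendsto_sandwich[of "\<lambda>_. 0" _ _ "\<lambda>r::real. ln r / r"])
    show "\<forall>\<^sub>F r::real in at_top. ln r / r ^ q \<le> ln r / r"
      using eventually_ge_at_top[of 1]
    proof eventually_elim
      case (elim r)
      have "r ^ 1 \<le> r ^ q" using elim q by (intro power_increasing) auto
      thus ?case using elim by (intro divide_left_mono) auto
    qed
    show "\<forall>\<^sub>F r::real in at_top. 0 \<le> ln r / r ^ q"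
      using eventually_ge_at_top[of 1] by eventually_elim auto
  qed (auto intro: lim_ln_over_power[of 1, simplified] ln_x_over_x_tendsto_0)
  have 2: "((\<lambda>r::real. ln (norm lead) / r ^ q) \<longlongrightarrow> 0) at_top"
    by (rule tendsto_divide_0[OF tendsto_const]) (use filterlim_power_at_top_real[OF q] filterlim_at_top_imp_at_infinity in blast)
  have "((\<lambda>r. (\<integral>t. ln_mod f r t \<partial>circ) / r ^ q - real mult0 * (ln r / r ^ q) - ln (norm lead) / r ^ q) \<longlongrightarrow> h0 - real mult0 * 0 - 0) at_top"
    by (intro tendsto_intros lim0 1 2)
  moreover have "\<forall>\<^sub>F r in at_top. (\<integral>t. ln_mod f r t \<partial>circ) / r ^ q - real mult0 * (ln r / r ^ q) - ln (norm lead) / r ^ q =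
      (\<Sum>i\<in>below r. ln (r / norm (a i))) /\<^sub>R r ^ q"
    using eventually_gt_at_top[of 0]
  proof eventually_elim
    case (elim r)
    have "(A * x + B + S) / \<rho> - A * (x / \<rho>) - B / \<rho> = S /\<^sub>R \<rho>" for A x B S \<rho> :: real
      by (simp add: divide_inverse_commute ring_distribs)
    thus ?case unfolding jensen[OF elim] .
  qed
  ultimately show ?thesis
    using Lim_transform_eventually by fastforce
qed

text \<open>A Tauberian argument: since the counting function increases, the growth of the Jensen
  sum from r to b r lies between ln b times the counts at r and at b r. Writing b = exp h and
  letting h tend to 0, both bounds tend to the density.\<close>

lemma cnt_limit: "((\<lambda>r. cnt r /\<^sub>R r ^ q) \<longlongrightarrow> density) at_top"
proof -
  define N where "N = (\<lambda>r. \<Sum>i\<in>below r. ln (r / norm (a i)))"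
  have Nlim: "((\<lambda>r. N r /\<^sub>R r ^ q) \<longlongrightarrow> h0) at_top"
    using jensen_sum_limit by (simp add: N_def)
  have N_bounds: "cnt r * ln b \<le> N (b * r) - N r" "N (b * r) - N r \<le> cnt (b * r) * ln b" if r: "r > 0" and b: "b > 1" for r b
  proof -
    have rb: "r \<le> b * r" using r b by simp
    have eq: "N (b * r) = N r + cnt r * ln b + (\<Sum>i\<in>below (b * r) - below r. ln (b * r / norm (a i)))"
    proof -
      have "N (b * r) = (\<Sum>i\<in>below (b * r) - below r. ln (b * r / norm (a i))) + (\<Sum>i\<in>below r. ln (b * r / norm (a i)))"
        unfolding N_def by (rule sum.subset_diff[OF below_mono[OF rb] finite_below])
      also have "(\<Sum>i\<in>below r. ln (b * r / norm (a i))) = (\<Sum>i\<in>below r. ln b + ln (r / norm (a i)))"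
        using r b by (intro sum.cong refl) (auto simp: below_def ln_mult ln_div)
      finally show ?thesis by (simp add: N_def sum.distrib cnt_def)
    qed
    have "0 \<le> (\<Sum>i\<in>below (b * r) - below r. ln (b * r / norm (a i)))"
      by (intro sum_nonneg) (auto simp: below_def)
    thus "cnt r * ln b \<le> N (b * r) - N r" using eq by simp
    have "(\<Sum>i\<in>below (b * r) - below r. ln (b * r / norm (a i))) \<le> (\<Sum>i\<in>below (b * r) - below r. ln b)"
      using r b by (intro sum_mono) (auto simp: below_def field_simps)
    also have "\<dots> = (cnt (b * r) - cnt r) * ln b" using cnt_diff[OF rb] by simp
    finally show "N (b * r) - N r \<le> cnt (b * r) * ln b" using eq by (simp add: algebra_simps)
  qed
  have Ndiff: "((\<lambda>r. (N (b * r) - N r) /\<^sub>R r ^ q / ln b) \<longlongrightarrow> (b ^ q - 1) * h0 / ln b) at_top" if b: "b > 1" for b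
  proof -
    have "((\<lambda>r. (N (b * r) /\<^sub>R r ^ q - N r /\<^sub>R r ^ q) / ln b) \<longlongrightarrow> (b ^ q *\<^sub>R h0 - h0) / ln b) at_top"
      using b by (intro tendsto_intros tendsto_at_top_scale_power Nlim) auto
    thus ?thesis by (simp add: algebra_simps)
  qed
  have lim_up: "((\<lambda>h. (exp h ^ q - 1) * h0 / ln (exp h)) \<longlongrightarrow> density) (at_right 0)"
    unfolding density_def using tendsto_mult_right[OF exp_minus_1_over_tendsto[of "real q"], of h0]
    by (simp add: exp_of_nat_mult)
  have "((\<lambda>h. exp h ^ q) \<longlongrightarrow> exp 0 ^ q) (at_right (0::real))"
    by (intro tendsto_intros tendsto_ident_at)
  from tendsto_divide[OF lim_up this]
  have lim_low: "((\<lambda>h. ((exp h ^ q - 1) * h0 / ln (exp h)) / exp h ^ q) \<longlongrightarrow> density) (at_right 0)"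
    by simp
  have pick: "\<exists>b>1. P b" if "\<forall>\<^sub>F h in at_right 0. P (exp h)" for P :: "real \<Rightarrow> bool"
    using eventually_happens'[OF trivial_limit_at_right_real eventually_conj[OF that eventually_at_right_less]]
    by (metis one_less_exp_iff)
  show ?thesis
  proof (rule order_tendstoI)
    fix y assume y: "y < density"
    obtain b where b: "b > 1" "y < ((b ^ q - 1) * h0 / ln b) / b ^ q"
      using pick[OF order_tendstoD(1)[OF lim_low y]] by blast
    hence "y * b ^ q < (b ^ q - 1) * h0 / ln b" by (simp add: field_simps)
    from order_tendstoD(1)[OF Ndiff[OF b(1)] this] eventually_gt_at_top[of 0]
    have ev: "\<forall>\<^sub>F r in at_top. y * b ^ q < cnt (b * r) /\<^sub>R r ^ q"
    proof eventually_elim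
      case (elim r)
      have "(N (b * r) - N r) /\<^sub>R r ^ q / ln b \<le> (cnt (b * r) * ln b) /\<^sub>R r ^ q / ln b"
        using N_bounds(2)[OF elim(2) b(1)] elim b by (intro divide_right_mono scaleR_left_mono) auto
      thus ?case using elim b by simp
    qed
    have "filterlim (\<lambda>r. inverse b * r) at_top at_top"
      using b by (intro filterlim_tendsto_pos_mult_at_top[OF tendsto_const] filterlim_ident) auto
    hence "filterlim (\<lambda>r. r / b) at_top at_top" by (simp add: divide_inverse_commute)
    from eventually_compose_filterlim[OF ev this]
    show "\<forall>\<^sub>F r in at_top. y < cnt r /\<^sub>R r ^ q"
    proof eventually_elim
      case (elim r)
      hence "b ^ q * y < b ^ q * (cnt r /\<^sub>R r ^ q)" using b by (simp add: power_divide field_simps)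
      thus ?case using b by (subst (asm) mult_less_cancel_left_pos) auto
    qed
  next
    fix y assume y: "density < y"
    obtain b where b: "b > 1" "(b ^ q - 1) * h0 / ln b < y"
      using pick[OF order_tendstoD(2)[OF lim_up y]] by blast
    from order_tendstoD(2)[OF Ndiff[OF b(1)] b(2)] eventually_gt_at_top[of 0]
    show "\<forall>\<^sub>F r in at_top. cnt r /\<^sub>R r ^ q < y"
    proof eventually_elim
      case (elim r)
      have "(cnt r * ln b) /\<^sub>R r ^ q / ln b \<le> (N (b * r) - N r) /\<^sub>R r ^ q / ln b"
        using N_bounds(1)[OF elim(2) b(1)] elim b by (intro divide_right_mono scaleR_left_mono) auto
      thus ?case using elim b by simp
    qed
  qed
qed

lemma cnt_annulus_limit:
  assumes "b > 0"
  shows "((\<lambda>r. (cnt (b * r) - cnt r) /\<^sub>R r ^ q) \<longlongrightarrow> (b ^ q - 1) * density) at_top"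
proof -
  have "((\<lambda>r. cnt (b * r) /\<^sub>R r ^ q - cnt r /\<^sub>R r ^ q) \<longlongrightarrow> b ^ q *\<^sub>R density - density) at_top"
    by (intro tendsto_intros tendsto_at_top_scale_power cnt_limit assms)
  thus ?thesis by (simp add: algebra_simps)
qed

definition conj_power_sum :: "nat \<Rightarrow> real \<Rightarrow> complex" where
  "conj_power_sum k r = (\<Sum>i\<in>below r. (cnj (a i) / of_real r) ^ k)"

text \<open>The combination of the Fourier coefficients at radii \<open>r\<close> and \<open>b r\<close> that kills the harmonic term
  \<open>\<alpha> r\<^sup>k\<close> and the growing parts of all zeros in the disc of radius \<open>r\<close>.\<close>

lemma conj_power_sum_approx:
  assumes k: "k > 0" and b: "b > 1" and r: "r > 0"
  defines "s \<equiv> b ^ k - 1 / b ^ k"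
  shows "norm (conj_power_sum k r - (2 * of_nat k / of_real s) * (fourier_log f k (b * r) - of_real (b ^ k) * fourier_log f k r)) \<le> cnt (b * r) - cnt r"
proof -
  obtain \<alpha> where \<alpha>: "\<And>r. 0 < r \<Longrightarrow> fourier_log f k r = 
     \<alpha> * of_real r ^ k + (\<Sum>i\<in>below r. ((of_real r / a i) ^ k - (cnj (a i) / of_real r) ^ k) / (2 * of_nat k))"
    by (rule fourier_log_formula[OF k]) blast
  have rb: "r \<le> b * r" "0 < b * r" using r b by auto
  have s: "s > 0"
  proof -
    have "1 < b ^ k" using b k by simp
    moreover have "1 / b ^ k < 1" using \<open>1 < b ^ k\<close> by simp
    ultimately show ?thesis unfolding s_def by linarith
  qed
  define G where "G = (\<lambda>r i. (of_real r / a i) ^ k - (cnj (a i) / of_real r) ^ k)"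
  define A where "A = below (b * r) - below r"
  \<comment> \<open>The zeros of the annulus enter at radius b r but not at r. Each contributes at
    most \<open>s\<close>, so after division by \<open>s\<close> the error is just their
    number.\<close>
  define T where "T = (\<Sum>i\<in>A. G (b * r) i)"
  have sumG: "fourier_log f k r' = \<alpha> * of_real r' ^ k + (\<Sum>i\<in>below r'. G r' i) / (2 * of_nat k)" if "r' > 0" for r'
    unfolding \<alpha>[OF that] G_def by (simp add: sum_divide_distrib)
  have "(\<Sum>i\<in>below (b * r). G (b * r) i) = T + (\<Sum>i\<in>below r. G (b * r) i)"
    unfolding T_def A_def by (rule sum.subset_diff[OF below_mono[OF rb(1)] finite_below])
  moreover have "G (b * r) i = of_real (b ^ k) * G r i + of_real s * (cnj (a i) / of_real r) ^ k" for i
    using b r by (simp add: G_def s_def power_mult_distrib power_divide field_simps)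
  ultimately have "(\<Sum>i\<in>below (b * r). G (b * r) i) = T + of_real (b ^ k) * (\<Sum>i\<in>below r. G r i) + of_real s * conj_power_sum k r"
    by (simp add: sum.distrib sum_distrib_left conj_power_sum_def)
  hence "2 * of_nat k * (fourier_log f k (b * r) - of_real (b ^ k) * fourier_log f k r) = T + of_real s * conj_power_sum k r"
    unfolding sumG[OF r] sumG[OF rb(2)] using k by (simp add: field_simps power_mult_distrib)
  hence "conj_power_sum k r - (2 * of_nat k / of_real s) * (fourier_log f k (b * r) - of_real (b ^ k) * fourier_log f k r) = - T / of_real s"
    using s by (simp add: field_simps)
  hence "norm (conj_power_sum k r - (2 * of_nat k / of_real s) * (fourier_log f k (b * r) - of_real (b ^ k) * fourier_log f k r)) = norm T / s"
    using s by (simp add: norm_divide)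
  also have "norm T \<le> (\<Sum>i\<in>A. s)"
    unfolding T_def
  proof (rule order.trans[OF norm_sum sum_mono])
    fix i assume i: "i \<in> A"
    show "norm (G (b * r) i) \<le> s" unfolding G_def s_def
      by (rule norm_linear_pair) (use i r b in \<open>auto simp: A_def below_def\<close>)
  qed
  also have "(\<Sum>i\<in>A. s) = (cnt (b * r) - cnt r) * s" using cnt_diff[OF rb(1)] by (simp add: A_def)
  finally show ?thesis using s by (simp add: divide_right_mono)
qed

lemma small_annulus:
  assumes "\<epsilon> > 0"
  obtains b where "b > 1" "\<forall>\<^sub>F r in at_top. (cnt (b * r) - cnt r) /\<^sub>R r ^ q \<le> \<epsilon>"
proof -
  obtain b where b: "1 < b" "(b ^ q - 1) * density < \<epsilon>"
    using power_gap_small[OF assms] by blast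
  have "\<forall>\<^sub>F r in at_top. (cnt (b * r) - cnt r) /\<^sub>R r ^ q < \<epsilon>"
    by (rule order_tendstoD(2)[OF cnt_annulus_limit b(2)]) (use b in simp)
  hence "\<forall>\<^sub>F r in at_top. (cnt (b * r) - cnt r) /\<^sub>R r ^ q \<le> \<epsilon>"
    by eventually_elim simp
  thus ?thesis using that b by auto
qed

text \<open>For k = 0 the sum counts the zeros. Otherwise each fixed ratio \<open>b\<close> gives a
  convergent approximation whose error is the share of the annulus.\<close>

lemma conj_power_sum_limit: "\<exists>L. ((\<lambda>r. conj_power_sum k r /\<^sub>R r ^ q) \<longlongrightarrow> L) at_top"
proof (cases "k = 0")
  case True
  have "((\<lambda>r. complex_of_real (cnt r /\<^sub>R r ^ q)) \<longlongrightarrow> of_real density) at_top"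
    by (intro tendsto_of_real cnt_limit)
  moreover have "complex_of_real (cnt r /\<^sub>R r ^ q) = conj_power_sum k r /\<^sub>R r ^ q" for r
    by (simp add: True conj_power_sum_def cnt_def scaleR_conv_of_real)
  ultimately show ?thesis by auto
next
  case False
  hence k: "k > 0" by simp
  show ?thesis
  proof (rule convergent_at_top_if_approx)
    fix \<epsilon> :: real assume \<epsilon>: "\<epsilon> > 0"
    obtain b where b: "b > 1" "\<forall>\<^sub>F r in at_top. (cnt (b * r) - cnt r) /\<^sub>R r ^ q \<le> \<epsilon> / 2"
      using small_annulus[of "\<epsilon> / 2"] \<epsilon> by auto
    define c where "c = 2 * of_nat k / complex_of_real (b ^ k - 1 / b ^ k)"
    define Y where "Y = (\<lambda>r. c * (fourier_log f k (b * r) - of_real (b ^ k) * fourier_log f k r))"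
    define L where "L = c * (b ^ q *\<^sub>R H k - of_real (b ^ k) * H k)"
    have "((\<lambda>r. c * (fourier_log f k (b * r) /\<^sub>R r ^ q - of_real (b ^ k) * (fourier_log f k r /\<^sub>R r ^ q))) \<longlongrightarrow> L) at_top"
      unfolding L_def using b by (intro tendsto_intros tendsto_at_top_scale_power limk) auto
    also have "(\<lambda>r. c * (fourier_log f k (b * r) /\<^sub>R r ^ q - of_real (b ^ k) * (fourier_log f k r /\<^sub>R r ^ q))) = (\<lambda>r. Y r /\<^sub>R r ^ q)"
      by (simp add: Y_def scaleR_conv_of_real algebra_simps fun_eq_iff)
    finally have Y: "((\<lambda>r. Y r /\<^sub>R r ^ q) \<longlongrightarrow> L) at_top" .
    have "\<forall>\<^sub>F r in at_top. dist (Y r /\<^sub>R r ^ q) L < \<epsilon> / 2" using tendstoD[OF Y, of "\<epsilon> / 2"] \<epsilon> by simp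
    hence "\<forall>\<^sub>F r in at_top. dist (conj_power_sum k r /\<^sub>R r ^ q) L \<le> \<epsilon>"
      using b(2) eventually_gt_at_top[of 0]
    proof eventually_elim
      case (elim r)
      have "dist (conj_power_sum k r /\<^sub>R r ^ q) (Y r /\<^sub>R r ^ q) = norm (conj_power_sum k r - Y r) /\<^sub>R r ^ q"
        using elim by (simp add: dist_norm flip: scaleR_diff_right)
      also have "\<dots> \<le> (cnt (b * r) - cnt r) /\<^sub>R r ^ q"
        unfolding Y_def c_def using conj_power_sum_approx[OF k b(1), of r] elim
        by (intro scaleR_left_mono) auto
      also have "\<dots> \<le> \<epsilon> / 2" by (rule elim)
      finally show ?case using elim(1) dist_triangle[of "conj_power_sum k r /\<^sub>R r ^ q" L "Y r /\<^sub>R r ^ q"] by linarith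
    qed
    thus "\<exists>L. \<forall>\<^sub>F r in at_top. dist (conj_power_sum k r /\<^sub>R r ^ q) L \<le> \<epsilon>" by blast
  qed
qed

text \<open>At index q the harmonic term is \<open>\<alpha>\<close> r^q, so dividing by r^q leaves
  the constant \<open>\<alpha>\<close>, Lindeloef's sum and the normalised conjugate sum. The last
  converges and the whole converges, hence so does the middle.\<close>

lemma lindeloef_sum_limit: "\<exists>L. ((\<lambda>r. \<Sum>i\<in>below r. a i powi (- int q)) \<longlongrightarrow> L) at_top"
proof -
  obtain \<alpha> where \<alpha>: "\<And>r. 0 < r \<Longrightarrow> fourier_log f q r = 
     \<alpha> * of_real r ^ q + (\<Sum>i\<in>below r. ((of_real r / a i) ^ q - (cnj (a i) / of_real r) ^ q) / (2 * of_nat q))"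
    by (rule fourier_log_formula[OF q]) blast
  obtain L where L: "((\<lambda>r. conj_power_sum q r /\<^sub>R r ^ q) \<longlongrightarrow> L) at_top" using conj_power_sum_limit by blast
  have t1: "((\<lambda>r. 2 * of_nat q * (fourier_log f q r /\<^sub>R r ^ q - \<alpha>) + conj_power_sum q r /\<^sub>R r ^ q) \<longlongrightarrow>
      2 * of_nat q * (H q - \<alpha>) + L) at_top"
    by (intro tendsto_intros limk L)
  have t2: "\<forall>\<^sub>F r in at_top. 2 * of_nat q * (fourier_log f q r /\<^sub>R r ^ q - \<alpha>) + conj_power_sum q r /\<^sub>R r ^ q
       = (\<Sum>i\<in>below r. a i powi (- int q))"
    using eventually_gt_at_top[of 0]
  proof eventually_elim
    case (elim r)
    have eq: "fourier_log f q r = \<alpha> * of_real r ^ q + (of_real r ^ q * (\<Sum>i\<in>below r. a i powi (- int q)) - conj_power_sum q r) / (2 * of_nat q)"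
    proof -
      have "(of_real r / a i) ^ q = of_real r ^ q * a i powi (- int q)" for i
        by (simp add: power_int_minus divide_inverse power_mult_distrib power_inverse)
      thus ?thesis unfolding \<alpha>[OF elim] conj_power_sum_def
        by (simp only: sum_divide_distrib[symmetric] sum_subtractf sum_distrib_left)
    qed
    have "(\<alpha> * R + (R * S - c) / (2 * of_nat q)) / R = \<alpha> + (S - c / R) / (2 * of_nat q)" if "R \<noteq> 0" for R S c :: complex
      using that q by (simp add: field_simps)
    hence 1: "fourier_log f q r / of_real r ^ q = 
        \<alpha> + ((\<Sum>i\<in>below r. a i powi (- int q)) - conj_power_sum q r / of_real r ^ q) / (2 * of_nat q)"
      unfolding eq using elim by simp
    have 2: "x /\<^sub>R r ^ q = x / of_real r ^ q" for x :: complex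
      by (simp add: scaleR_conv_of_real divide_inverse_commute)
    show ?case unfolding 2 1 using q by simp
  qed
  show ?thesis by (rule exI, rule Lim_transform_eventually[OF t1 t2])
qed

text \<open>The trigonometric moments of the directions, each zero having weight 1 whatever its
  modulus.\<close>

definition phase_sum :: "nat \<Rightarrow> real \<Rightarrow> complex" where
  "phase_sum k r = (\<Sum>i\<in>below r. cnj (sgn (a i)) ^ k)"

text \<open>The combination of conjugate sums is the sum of (conj a / r)^k over the annulus. There
  |a| / r lies between 1 and b, so each summand differs from its phase by at most b^k - 1.\<close>

lemma phase_sum_annulus:
  assumes b: "b > 1" and r: "r > 0"
  shows "norm (phase_sum k (b * r) - phase_sum k r - (of_real (b ^ k) * conj_power_sum k (b * r) - conj_power_sum k r))
     \<le> (b ^ k - 1) * (cnt (b * r) - cnt r)"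
proof -
  have rb: "r \<le> b * r" using r b by auto
  define A where "A = below (b * r) - below r"
  have "phase_sum k (b * r) = (\<Sum>i\<in>A. cnj (sgn (a i)) ^ k) + phase_sum k r"
    unfolding phase_sum_def A_def by (rule sum.subset_diff[OF below_mono[OF rb] finite_below])
  moreover have "of_real (b ^ k) * conj_power_sum k (b * r) = (\<Sum>i\<in>A. (cnj (a i) / of_real r) ^ k) + conj_power_sum k r"
  proof -
    have "of_real (b ^ k) * conj_power_sum k (b * r) = (\<Sum>i\<in>below (b * r). (cnj (a i) / of_real r) ^ k)"
      unfolding conj_power_sum_def sum_distrib_left using b
      by (intro sum.cong refl) (simp add: power_divide power_mult_distrib)
    thus ?thesis unfolding conj_power_sum_def A_def 
      using sum.subset_diff[OF below_mono[OF rb] finite_below, of "\<lambda>i. (cnj (a i) / of_real r) ^ k"] by simp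
  qed
  ultimately have "norm (phase_sum k (b * r) - phase_sum k r - (of_real (b ^ k) * conj_power_sum k (b * r) - conj_power_sum k r))
     = norm (\<Sum>i\<in>A. cnj (sgn (a i)) ^ k - (cnj (a i) / of_real r) ^ k)"
    by (simp add: sum_subtractf)
  also have "\<dots> \<le> (\<Sum>i\<in>A. b ^ k - 1)"
  proof (rule order.trans[OF norm_sum sum_mono])
    fix i assume i: "i \<in> A"
    define x where "x = norm (a i) / r"
    have x: "1 \<le> x" "x \<le> b" using i r b by (auto simp: x_def A_def below_def field_simps)
    have ai: "a i \<noteq> 0" using i by (auto simp: A_def below_def)
    have "cnj (a i) / of_real r = of_real x * cnj (sgn (a i))"
      using ai by (simp add: x_def sgn_div_norm scaleR_conv_of_real)
    hence "cnj (sgn (a i)) ^ k - (cnj (a i) / of_real r) ^ k = of_real (1 - x ^ k) * cnj (sgn (a i)) ^ k"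
      by (simp add: power_mult_distrib left_diff_distrib)
    hence "norm (cnj (sgn (a i)) ^ k - (cnj (a i) / of_real r) ^ k) = \<bar>1 - x ^ k\<bar>"
      using ai by (simp add: norm_mult norm_power norm_sgn del: of_real_diff of_real_power)
    also have "\<dots> = x ^ k - 1" using x by simp
    also have "\<dots> \<le> b ^ k - 1" using x by (simp add: power_mono)
    finally show "norm (cnj (sgn (a i)) ^ k - (cnj (a i) / of_real r) ^ k) \<le> b ^ k - 1" .
  qed
  also have "\<dots> = (b ^ k - 1) * (cnt (b * r) - cnt r)" using cnt_diff[OF rb] by (simp add: A_def)
  finally show ?thesis .
qed

text \<open>Passing from radius \<open>r\<close> to \<open>b r\<close> contracts the distance of the normalised sum to its limit by
  the factor \<open>b\<close> to the power \<open>- q\<close>, up to an error that is small for \<open>b\<close> near 1.\<close>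

lemma phase_sum_limit: "\<exists>L. ((\<lambda>r. phase_sum k r /\<^sub>R r ^ q) \<longlongrightarrow> L) at_top"
proof (rule convergent_at_top_if_approx)
  fix \<epsilon> :: real assume \<epsilon>: "\<epsilon> > 0"
  obtain L where L: "((\<lambda>r. conj_power_sum k r /\<^sub>R r ^ q) \<longlongrightarrow> L) at_top" using conj_power_sum_limit by blast
  obtain b where b: "1 < b" "(b ^ k - 1) * density < \<epsilon> / 4"
    by (rule power_gap_small[of "\<epsilon> / 4" k density]) (use \<epsilon> in auto)
  define \<beta> where "\<beta> = 1 / b ^ q"
  have bq: "b ^ q > 1" using b q by simp
  have \<beta>: "0 \<le> \<beta>" "\<beta> < 1" "\<beta> > 0" using bq by (auto simp: \<beta>_def)
  define D where "D = of_real (b ^ k) * (b ^ q *\<^sub>R L) - L"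
  \<comment> \<open>The fixed point of the limiting recursion: b^q L' = L' + D.\<close>
  define L' where "L' = D / of_real (b ^ q - 1)"
  define e where "e = \<epsilon> / 2"
  define Y where "Y = (\<lambda>r. norm (phase_sum k r /\<^sub>R r ^ q - L'))"
  \<comment> \<open>Chosen so that the total error 2 d, divided by b^q, is exactly e (1 -
    \<open>\<beta>\<close>) for e = \<open>\<epsilon>\<close> / 2.\<close>
  define d where "d = (b ^ q - 1) * (\<epsilon> / 4)"
  have d: "d > 0" using bq \<epsilon> by (simp add: d_def)
  have lim1: "((\<lambda>r. of_real (b ^ k) * (conj_power_sum k (b * r) /\<^sub>R r ^ q) - conj_power_sum k r /\<^sub>R r ^ q) \<longlongrightarrow> D) at_top"
    unfolding D_def using b by (intro tendsto_intros tendsto_at_top_scale_power L) auto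
  have lim2: "((\<lambda>r. (b ^ k - 1) * ((cnt (b * r) - cnt r) /\<^sub>R r ^ q)) \<longlongrightarrow> (b ^ k - 1) * ((b ^ q - 1) * density)) at_top"
    using b by (intro tendsto_intros cnt_annulus_limit) auto
  have "(b ^ k - 1) * ((b ^ q - 1) * density) < d"
    using mult_strict_left_mono[OF b(2), of "b ^ q - 1"] bq by (simp add: d_def mult_ac)
  from order_tendstoD(2)[OF lim2 this]
  have ev2: "\<forall>\<^sub>F r in at_top. (b ^ k - 1) * ((cnt (b * r) - cnt r) /\<^sub>R r ^ q) < d" .
  have step: "\<forall>\<^sub>F r in at_top. Y (b * r) \<le> \<beta> * Y r + e * (1 - \<beta>)"
    using tendstoD[OF lim1 d] ev2 eventually_gt_at_top[of 0]
  proof eventually_elim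
    case (elim r)
    define p1 p0 c1 c0 where "p1 = phase_sum k (b * r) /\<^sub>R r ^ q" and "p0 = phase_sum k r /\<^sub>R r ^ q" 
      and "c1 = of_real (b ^ k) * (conj_power_sum k (b * r) /\<^sub>R r ^ q)" and "c0 = conj_power_sum k r /\<^sub>R r ^ q"
    have "norm (p1 - p0 - (c1 - c0)) = norm (phase_sum k (b * r) - phase_sum k r - (of_real (b ^ k) * conj_power_sum k (b * r) - conj_power_sum k r)) /\<^sub>R r ^ q"
    proof -
      have "p1 - p0 - (c1 - c0) = (phase_sum k (b * r) - phase_sum k r - (of_real (b ^ k) * conj_power_sum k (b * r) - conj_power_sum k r)) /\<^sub>R r ^ q"
        by (simp add: p1_def p0_def c1_def c0_def algebra_simps)
      thus ?thesis using elim by simp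
    qed
    also have "\<dots> \<le> ((b ^ k - 1) * (cnt (b * r) - cnt r)) /\<^sub>R r ^ q"
      using elim by (intro scaleR_left_mono phase_sum_annulus b(1)) auto
    also have "\<dots> < d" using elim by (simp add: mult_ac)
    finally have 1: "norm (p1 - p0 - (c1 - c0)) < d" .
    have 2: "norm (c1 - c0 - D) < d" using elim by (simp add: c1_def c0_def dist_norm)
    have "norm (p1 - p0 - D) \<le> norm (p1 - p0 - (c1 - c0)) + norm (c1 - c0 - D)"
      using norm_triangle_ineq[of "p1 - p0 - (c1 - c0)" "c1 - c0 - D"] unfolding diff_add_cancel
      by (simp add: algebra_simps)
    hence 3: "norm (p1 - p0 - D) < 2 * d" using 1 2 by simp
    have "of_real (b ^ q - 1) \<noteq> (0::complex)" using bq by (subst of_real_eq_0_iff) simp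
    hence "D = of_real (b ^ q - 1) * L'" by (simp add: L'_def)
    hence D: "D = of_real (b ^ q) * L' - L'" by (simp add: left_diff_distrib)
    have 4: "norm (p1 - of_real (b ^ q) * L') \<le> norm (p1 - p0 - D) + norm (p0 - L')"
      using norm_triangle_ineq[of "p1 - p0 - D" "p0 - L'"] by (simp add: D)
    have p1_eq: "p1 = of_real (b ^ q) * (phase_sum k (b * r) /\<^sub>R (b * r) ^ q)"
      using b elim by (simp add: p1_def power_mult_distrib scaleR_conv_of_real field_simps)
    have "norm (p1 - of_real (b ^ q) * L') = b ^ q * Y (b * r)"
      using b by (simp only: p1_eq Y_def right_diff_distrib[symmetric] norm_mult norm_of_real) simp
    hence "b ^ q * Y (b * r) \<le> 2 * d + Y r" using 3 4 by (simp add: Y_def p0_def)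
    hence "Y (b * r) \<le> (2 * d + Y r) / b ^ q" using bq by (simp add: field_simps)
    also have "\<dots> = \<beta> * Y r + e * (1 - \<beta>)"
    proof -
      have "(2 * ((X - 1) * (\<epsilon> / 4)) + y) / X = 1 / X * y + \<epsilon> / 2 * (1 - 1 / X)" if "X > 1" for X y :: real
        using that by (simp add: add_divide_distrib diff_divide_distrib algebra_simps)
      from this[OF bq] show ?thesis by (simp add: \<beta>_def e_def d_def)
    qed
    finally show ?case .
  qed
  have bdd: "\<forall>\<^sub>F r in at_top. Y r \<le> density + 1 + norm L'"
    using order_tendstoD(2)[OF cnt_limit less_add_one] eventually_gt_at_top[of 0]
  proof eventually_elim
    case (elim r)
    have "norm (phase_sum k r) \<le> (\<Sum>i\<in>below r. 1)" unfolding phase_sum_def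
      by (rule order.trans[OF norm_sum sum_mono]) (auto simp: norm_power norm_sgn below_nonzero)
    also have "\<dots> = cnt r" by (simp add: cnt_def)
    finally have "norm (phase_sum k r /\<^sub>R r ^ q) \<le> cnt r /\<^sub>R r ^ q" using elim by (simp add: mult_left_mono)
    thus ?case unfolding Y_def using norm_triangle_ineq4[of "phase_sum k r /\<^sub>R r ^ q" L'] elim by linarith
  qed
  have "\<forall>\<^sub>F r in at_top. Y r \<le> e + \<epsilon> / 2"
    by (rule eventually_le_if_contracting[OF b(1) \<beta>(1,2) _ step bdd]) (use \<epsilon> in auto)
  thus "\<exists>L. \<forall>\<^sub>F r in at_top. dist (phase_sum k r /\<^sub>R r ^ q) L \<le> \<epsilon>"
    by (intro exI[of _ L']) (simp add: Y_def dist_norm e_def)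
qed

end

subsection \<open>Angular density\<close>

text \<open>Restricted to the unit circle these are the trigonometric polynomials; keeping both
  exponents unreduced makes multiplication immediate.\<close>

inductive trig_poly :: "(complex \<Rightarrow> complex) \<Rightarrow> bool" where
  trig_mono: "trig_poly (\<lambda>w. c * w ^ m * cnj w ^ n)"
| trig_add: "trig_poly p \<Longrightarrow> trig_poly q \<Longrightarrow> trig_poly (\<lambda>w. p w + q w)"

lemma trig_poly_mult_mono: "trig_poly p \<Longrightarrow> trig_poly (\<lambda>w. c * w ^ m * cnj w ^ n * p w)"
proof (induction rule: trig_poly.induct)
  case (trig_mono c' m' n')
  have "(\<lambda>w. c * w ^ m * cnj w ^ n * (c' * w ^ m' * cnj w ^ n')) = (\<lambda>w. (c * c') * w ^ (m + m') * cnj w ^ (n + n'))"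
    by (simp add: power_add mult_ac fun_eq_iff)
  thus ?case using trig_poly.trig_mono by metis
next
  case (trig_add p1 p2)
  thus ?case using trig_poly.trig_add by (simp add: ring_distribs)
qed

lemma trig_poly_mult: "trig_poly p \<Longrightarrow> trig_poly q \<Longrightarrow> trig_poly (\<lambda>w. p w * q w)"
proof (induction rule: trig_poly.induct)
  case (trig_mono c m n)
  thus ?case by (rule trig_poly_mult_mono)
next
  case (trig_add p1 p2)
  thus ?case using trig_poly.trig_add by (simp add: ring_distribs)
qed

lemma trig_poly_real_polynomial:
  "real_polynomial_function g \<Longrightarrow> trig_poly (\<lambda>w. complex_of_real (g w))"
proof (induction rule: real_polynomial_function.induct)
  case (linear g)
  interpret bounded_linear g by fact
  \<comment> \<open>The coefficients come from Re w = (w + conj w) / 2 and Im w = (w - conj w) / (2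
    i).\<close>
  define c d where "c = (complex_of_real (g 1) - \<i> * complex_of_real (g \<i>)) / 2"
    and "d = (complex_of_real (g 1) + \<i> * complex_of_real (g \<i>)) / 2"
  have "(\<lambda>w. complex_of_real (g w)) = (\<lambda>w. c * w ^ 1 * cnj w ^ 0 + d * w ^ 0 * cnj w ^ 1)"
  proof
    fix w :: complex
    have "w = Re w *\<^sub>R 1 + Im w *\<^sub>R \<i>" by (simp add: complex_eq_iff)
    hence "g w = Re w * g 1 + Im w * g \<i>" by (metis add scaleR real_scaleR_def)
    thus "complex_of_real (g w) = c * w ^ 1 * cnj w ^ 0 + d * w ^ 0 * cnj w ^ 1"
      by (simp add: c_def d_def complex_eq_iff field_simps)
  qed
  thus ?case using trig_add[OF trig_mono trig_mono] by metis
next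
  case (const c)
  show ?case using trig_mono[of "complex_of_real c" 0 0] by simp
next
  case (add p1 p2)
  thus ?case using trig_add by simp
next
  case (mult p1 p2)
  thus ?case using trig_poly_mult by simp
qed

text \<open>A tent of height 1 over \<open>p\<close>: a continuous test function for the mass near
  \<open>p\<close>.\<close>

definition bump :: "complex \<Rightarrow> real \<Rightarrow> complex \<Rightarrow> real" where
  "bump p \<delta> w = max 0 (1 - dist w p / \<delta>)"

lemma bump_nonneg: "0 \<le> bump p \<delta> w"
  by (simp add: bump_def)

lemma bump_le_1: "\<delta> > 0 \<Longrightarrow> bump p \<delta> w \<le> 1"
  by (simp add: bump_def)

lemma bump_mono: "0 < \<delta> \<Longrightarrow> \<delta> \<le> \<delta>' \<Longrightarrow> bump p \<delta> w \<le> bump p \<delta>' w"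
  unfolding bump_def by (intro max.mono order.refl diff_left_mono divide_left_mono) auto

lemma continuous_on_bump: "\<delta> > 0 \<Longrightarrow> continuous_on A (bump p \<delta>)"
  unfolding bump_def[abs_def] by (intro continuous_intros) auto

text \<open>Tents of radius \<open>\<delta>\<close> around points at least 2 \<open>\<delta>\<close>
  apart have disjoint supports.\<close>

lemma sum_bump_le_1:
  assumes "finite S" "\<delta> > 0" "\<And>p p'. p \<in> S \<Longrightarrow> p' \<in> S \<Longrightarrow> p \<noteq> p' \<Longrightarrow> 2 * \<delta> \<le> dist p p'"
  shows "(\<Sum>p\<in>S. bump p \<delta> w) \<le> 1"
proof (cases "\<exists>p\<in>S. bump p \<delta> w \<noteq> 0")
  case True
  then obtain p where p: "p \<in> S" "bump p \<delta> w \<noteq> 0" by blast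
  have "bump p' \<delta> w = 0" if "p' \<in> S - {p}" for p'
  proof (rule ccontr)
    assume "bump p' \<delta> w \<noteq> 0"
    hence "dist w p' < \<delta>" using assms(2) by (auto simp: bump_def max_def field_simps split: if_splits)
    moreover have "dist w p < \<delta>" using p assms(2) by (auto simp: bump_def max_def field_simps split: if_splits)
    ultimately have "dist p p' < 2 * \<delta>" using dist_triangle3[of p p' w] by linarith
    thus False using assms(3)[of p p'] p that by auto
  qed
  hence "(\<Sum>p\<in>S. bump p \<delta> w) = bump p \<delta> w"
    using assms(1) p(1) by (simp add: sum.remove)
  thus ?thesis using bump_le_1[OF assms(2)] by simp
qed simp

lemma finite_set_separated:
  fixes S :: "'b :: metric_space set"
  assumes "finite S"
  obtains \<delta> where "\<delta> > 0" "\<And>p p'. p \<in> S \<Longrightarrow> p' \<in> S \<Longrightarrow> p \<noteq> p' \<Longrightarrow> 2 * \<delta> \<le> dist p p'"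
proof -
  have "\<forall>p. \<exists>d>0. \<forall>x\<in>S. x \<noteq> p \<longrightarrow> d \<le> dist p x" using finite_set_avoid[OF assms] by blast
  then obtain d where d: "\<And>p. d p > 0" "\<And>p x. x \<in> S \<Longrightarrow> x \<noteq> p \<Longrightarrow> d p \<le> dist p x" by metis
  \<comment> \<open>The entry 1 keeps the minimum meaningful when \<open>S\<close> is empty.\<close>
  define \<delta> where "\<delta> = Min (insert 1 (d ` S)) / 2"
  have "\<delta> > 0" using assms d(1) by (auto simp: \<delta>_def)
  moreover have "2 * \<delta> \<le> dist p p'" if "p \<in> S" "p' \<in> S" "p \<noteq> p'" for p p'
  proof -
    have "2 * \<delta> \<le> d p" unfolding \<delta>_def using assms that by simp
    thus ?thesis using d(2)[of p' p] that by auto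
  qed
  ultimately show ?thesis using that by blast
qed

text \<open>Carries a countable set of points on the circle over to real angles: every point has
  only the translates of one angle by multiples of 2 pi.\<close>

lemma countable_cis_vimage:
  assumes "countable P"
  shows "countable {x. cis x \<in> P}"
proof -
  have "countable {x. cis x = p}" for p
  proof (cases "\<exists>x0. cis x0 = p")
    case True
    then obtain x0 where x0: "cis x0 = p" by blast
    have "{x. cis x = p} \<subseteq> range (\<lambda>n::int. x0 + 2 * of_int n * pi)"
    proof
      fix x assume "x \<in> {x. cis x = p}"
      hence "exp (\<i> * of_real x) = exp (\<i> * of_real x0)" using x0 by (simp add: cis_conv_exp)
      then obtain n :: int where "\<i> * of_real x = \<i> * of_real x0 + (of_int (2 * n) * pi) * \<i>"
        unfolding exp_eq by auto
      hence "complex_of_real x = of_real (x0 + 2 * of_int n * pi)"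
        by (auto simp: complex_eq_iff)
      hence "x = x0 + 2 * of_int n * pi" by (simp only: of_real_eq_iff)
      thus "x \<in> range (\<lambda>n::int. x0 + 2 * of_int n * pi)" by blast
    qed
    thus ?thesis by (rule countable_subset) simp
  qed auto
  hence "countable (\<Union>p\<in>P. {x. cis x = p})" using assms by blast
  thus ?thesis by (rule countable_subset[rotated]) auto
qed

lemma sphere_eq_arcs:
  "sphere 0 1 \<subseteq> cis ` {\<alpha>..\<beta>} \<union> cis ` {\<beta>..\<alpha> + 2 * pi}" if "\<alpha> \<le> \<beta>"
proof
  fix w :: complex assume w: "w \<in> sphere 0 1"
  define s where "s = Arg2pi (w * cis (- \<alpha>))"
  have s: "0 \<le> s" "s < 2 * pi" using Arg2pi[of "w * cis (- \<alpha>)"] by (auto simp: s_def)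
  have "w * cis (- \<alpha>) = cis s"
    using Arg2pi_eq[of "w * cis (- \<alpha>)"] w by (simp add: s_def norm_mult cis_conv_exp)
  hence "w * (cis (- \<alpha>) * cis \<alpha>) = cis s * cis \<alpha>" by (metis mult.assoc)
  hence "w = cis (\<alpha> + s)" by (simp add: cis_mult add.commute)
  moreover have "\<alpha> + s \<in> {\<alpha>..\<beta>} \<or> \<alpha> + s \<in> {\<beta>..\<alpha> + 2 * pi}" using s by auto
  ultimately show "w \<in> cis ` {\<alpha>..\<beta>} \<union> cis ` {\<beta>..\<alpha> + 2 * pi}" by blast
qed

lemma cis_neq: "cis s \<noteq> cis t" if "0 < t - s" "t - s < 2 * pi"
proof
  assume "cis s = cis t"
  hence "cis (t - s) = 1" by (simp add: cis_divide[symmetric])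
  hence "cos (t - s) = 1" by (simp add: complex_eq_iff)
  then obtain n :: int where n: "t - s = of_int n * (2 * pi)" by (auto simp: cos_one_2pi_int mult_ac)
  have "0 < of_int n * (2 * pi)" "of_int n * (2 * pi) < 1 * (2 * pi)" using that n by auto
  hence "0 < real_of_int n" "real_of_int n < 1"
    unfolding mult_less_cancel_right zero_less_mult_iff by auto
  thus False by simp
qed

text \<open>The formula vanishes at both end points of the arc, so it glues continuously with 0 on
  the complementary closed arc.\<close>

lemma continuous_on_arc_cutoff:
  assumes \<alpha>\<beta>: "\<alpha> \<le> \<beta>" "\<beta> - \<alpha> \<le> 2 * pi" and \<delta>: "\<delta> > 0"
  shows "continuous_on (sphere 0 1) (\<lambda>w. if w \<in> cis ` {\<alpha><..<\<beta>} then min 1 (min (dist w (cis \<alpha>)) (dist w (cis \<beta>)) / \<delta>) else 0)"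
    (is "continuous_on _ ?\<psi>")
proof -
  let ?d = "\<lambda>w. min 1 (min (dist w (cis \<alpha>)) (dist w (cis \<beta>)) / \<delta>)"
  have cont_cis: "continuous_on A cis" for A
    unfolding cis_conv_exp by (intro continuous_intros)
  have closed: "closed (cis ` {u..v})" for u v :: real
    by (intro compact_imp_closed compact_continuous_image cont_cis) simp
  have "continuous_on (cis ` {\<alpha>..\<beta>}) ?\<psi>"
  proof (rule continuous_on_eq[of _ ?d])
    show "continuous_on (cis ` {\<alpha>..\<beta>}) ?d" using \<delta> by (intro continuous_intros) auto
    fix w assume "w \<in> cis ` {\<alpha>..\<beta>}"
    then obtain s where s: "s \<in> {\<alpha>..\<beta>}" "w = cis s" by blast
    show "?d w = ?\<psi> w"
    proof (cases "s = \<alpha> \<or> s = \<beta>")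
      case True
      hence "?d w = 0" using s by auto
      thus ?thesis by simp
    next
      case False
      hence "w \<in> cis ` {\<alpha><..<\<beta>}" using s by auto
      thus ?thesis by simp
    qed
  qed
  moreover have "continuous_on (cis ` {\<beta>..\<alpha> + 2 * pi}) ?\<psi>"
  proof (rule continuous_on_eq[of _ "\<lambda>_. 0"])
    fix w assume "w \<in> cis ` {\<beta>..\<alpha> + 2 * pi}"
    then obtain t where t: "t \<in> {\<beta>..\<alpha> + 2 * pi}" "w = cis t" by blast
    have "w \<noteq> cis s" if "s \<in> {\<alpha><..<\<beta>}" for s
      using cis_neq[of t s] t that by auto
    hence "w \<notin> cis ` {\<alpha><..<\<beta>}" by blast
    thus "0 = ?\<psi> w" by simp
  qed simp
  ultimately have "continuous_on (cis ` {\<alpha>..\<beta>} \<union> cis ` {\<beta>..\<alpha> + 2 * pi}) ?\<psi>"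
    by (intro continuous_on_closed_Un closed)
  thus ?thesis by (rule continuous_on_subset[OF _ sphere_eq_arcs[OF \<alpha>\<beta>(1)]])
qed

section \<open>The limit distribution of the directions and its atoms\<close>

context zero_asymptotics
begin

definition wsum :: "(complex \<Rightarrow> real) \<Rightarrow> real \<Rightarrow> real" where
  "wsum \<phi> r = (\<Sum>i\<in>below r. \<phi> (sgn (a i)))"

lemma sgn_in_sphere: "i \<in> below r \<Longrightarrow> sgn (a i) \<in> sphere 0 1"
  using below_nonzero by (simp add: norm_sgn)

lemma wsum_mono: "(\<And>w. w \<in> sphere 0 1 \<Longrightarrow> \<phi> w \<le> \<psi> w) \<Longrightarrow> wsum \<phi> r \<le> wsum \<psi> r"
  unfolding wsum_def by (intro sum_mono) (use sgn_in_sphere in blast)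

lemma wsum_const: "wsum (\<lambda>_. c) r = c * cnt r"
  by (simp add: wsum_def cnt_def)

text \<open>As w times its conjugate is 1 on the circle, a monomial reduces to a power of the
  conjugate or of w, giving a phase sum or the conjugate of one.\<close>

lemma trig_poly_limit: "trig_poly p \<Longrightarrow> \<exists>L. ((\<lambda>r. (\<Sum>i\<in>below r. p (sgn (a i))) /\<^sub>R r ^ q) \<longlongrightarrow> L) at_top"
proof (induction rule: trig_poly.induct)
  case (trig_mono c m n)
  have unit: "w * cnj w = 1" if "w \<in> sphere 0 1" for w
    using that complex_norm_square[of w] by simp
  show ?case
  proof (cases "m \<le> n")
    case True
    obtain L where L: "((\<lambda>r. phase_sum (n - m) r /\<^sub>R r ^ q) \<longlongrightarrow> L) at_top" using phase_sum_limit by blast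
    have "c * w ^ m * cnj w ^ n = c * cnj w ^ (n - m)" if "w \<in> sphere 0 1" for w
    proof -
      have "w ^ m * cnj w ^ n = (w * cnj w) ^ m * cnj w ^ (n - m)"
        using True by (simp add: power_mult_distrib flip: power_add)
      thus ?thesis by (simp add: unit[OF that] mult.assoc)
    qed
    hence "(\<Sum>i\<in>below r. c * sgn (a i) ^ m * cnj (sgn (a i)) ^ n) = c * phase_sum (n - m) r" for r
      unfolding phase_sum_def sum_distrib_left using sgn_in_sphere by (intro sum.cong) auto
    moreover have "((\<lambda>r. c * (phase_sum (n - m) r /\<^sub>R r ^ q)) \<longlongrightarrow> c * L) at_top"
      by (intro tendsto_intros L)
    ultimately show ?thesis by auto
  next
    case False
    obtain L where L: "((\<lambda>r. phase_sum (m - n) r /\<^sub>R r ^ q) \<longlongrightarrow> L) at_top" using phase_sum_limit by blast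
    have "c * w ^ m * cnj w ^ n = c * cnj (cnj w ^ (m - n))" if "w \<in> sphere 0 1" for w
    proof -
      have "w ^ m * cnj w ^ n = (w * cnj w) ^ n * w ^ (m - n)"
        using False by (simp add: power_mult_distrib mult.commute flip: power_add)
      thus ?thesis by (simp add: unit[OF that] mult.assoc)
    qed
    hence "(\<Sum>i\<in>below r. c * sgn (a i) ^ m * cnj (sgn (a i)) ^ n) = c * cnj (phase_sum (m - n) r)" for r
      unfolding phase_sum_def cnj_sum sum_distrib_left using sgn_in_sphere by (intro sum.cong) auto
    moreover have "((\<lambda>r. c * cnj (phase_sum (m - n) r /\<^sub>R r ^ q)) \<longlongrightarrow> c * cnj L) at_top"
      by (intro tendsto_intros L)
    ultimately show ?thesis by auto
  qed
next
  case (trig_add p1 p2)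
  then obtain L1 L2 where "((\<lambda>r. (\<Sum>i\<in>below r. p1 (sgn (a i))) /\<^sub>R r ^ q) \<longlongrightarrow> L1) at_top"
     "((\<lambda>r. (\<Sum>i\<in>below r. p2 (sgn (a i))) /\<^sub>R r ^ q) \<longlongrightarrow> L2) at_top" by blast
  from tendsto_add[OF this] show ?case by (auto simp: sum.distrib scaleR_add_right)
qed

lemma eventually_cnt_le: "\<forall>\<^sub>F r in at_top. cnt r /\<^sub>R r ^ q \<le> density + 1"
  using order_tendstoD(2)[OF cnt_limit less_add_one] by eventually_elim simp

text \<open>Weak convergence of the normalised counting measures of the directions, by
  Stone-Weierstrass from the moments.\<close>

lemma wsum_limit:
  assumes "continuous_on (sphere 0 1) \<phi>"
  shows "\<exists>L. ((\<lambda>r. wsum \<phi> r /\<^sub>R r ^ q) \<longlongrightarrow> L) at_top"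
proof (rule convergent_at_top_if_approx)
  fix \<epsilon> :: real assume \<epsilon>: "\<epsilon> > 0"
  \<comment> \<open>The uniform error is multiplied by the normalised count, eventually at most
    density + 1; one more \<open>e\<close> pays for the distance of the polynomial sum from its
    limit.\<close>
  define e where "e = \<epsilon> / (density + 2)"
  have "e * (density + 2) = \<epsilon>" using density_pos by (simp add: e_def)
  moreover have "e > 0" using \<epsilon> density_pos by (simp add: e_def)
  ultimately have e: "e > 0" "e * (density + 1) + e = \<epsilon>" by (simp_all add: algebra_simps)
  obtain g where g: "real_polynomial_function g" "\<And>w. w \<in> sphere 0 1 \<Longrightarrow> \<bar>\<phi> w - g w\<bar> < e"
    using Stone_Weierstrass_real_polynomial_function[OF compact_sphere assms e(1)] by blast
  obtain L where "((\<lambda>r. (\<Sum>i\<in>below r. complex_of_real (g (sgn (a i)))) /\<^sub>R r ^ q) \<longlongrightarrow> L) at_top"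
    using trig_poly_limit[OF trig_poly_real_polynomial[OF g(1)]] by blast
  from tendsto_Re[OF this] have "((\<lambda>r. wsum g r /\<^sub>R r ^ q) \<longlongrightarrow> Re L) at_top"
    by (simp add: wsum_def)
  hence "\<forall>\<^sub>F r in at_top. dist (wsum g r /\<^sub>R r ^ q) (Re L) < e" using e(1) by (rule tendstoD)
  hence "\<forall>\<^sub>F r in at_top. dist (wsum \<phi> r /\<^sub>R r ^ q) (Re L) \<le> \<epsilon>"
    using eventually_cnt_le eventually_gt_at_top[of 0]
  proof eventually_elim
    case (elim r)
    have "\<bar>wsum \<phi> r - wsum g r\<bar> \<le> (\<Sum>i\<in>below r. \<bar>\<phi> (sgn (a i)) - g (sgn (a i))\<bar>)"
      unfolding wsum_def sum_subtractf[symmetric] by (rule sum_abs)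
    also have "\<dots> \<le> (\<Sum>i\<in>below r. e)"
      using g(2)[OF sgn_in_sphere] by (intro sum_mono) (meson less_imp_le)
    also have "\<dots> = e * cnt r" by (simp add: cnt_def)
    finally have "\<bar>wsum \<phi> r - wsum g r\<bar> /\<^sub>R r ^ q \<le> (e * cnt r) /\<^sub>R r ^ q"
      using elim by (intro scaleR_left_mono) auto
    moreover have "dist (wsum \<phi> r /\<^sub>R r ^ q) (wsum g r /\<^sub>R r ^ q) = \<bar>wsum \<phi> r - wsum g r\<bar> /\<^sub>R r ^ q"
      using elim by (simp add: dist_real_def abs_mult flip: right_diff_distrib)
    moreover have "(e * cnt r) /\<^sub>R r ^ q \<le> e * (density + 1)"
      using mult_left_mono[OF elim(2), of e] e by (simp add: mult_ac)
    ultimately have "dist (wsum \<phi> r /\<^sub>R r ^ q) (wsum g r /\<^sub>R r ^ q) \<le> e * (density + 1)" by linarith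
    thus ?case using elim(1) e dist_triangle[of "wsum \<phi> r /\<^sub>R r ^ q" "Re L" "wsum g r /\<^sub>R r ^ q"] by linarith
  qed
  thus "\<exists>L. \<forall>\<^sub>F r in at_top. dist (wsum \<phi> r /\<^sub>R r ^ q) L \<le> \<epsilon>" by blast
qed

text \<open>Detects concentrated mass of the limit distribution at \<open>p\<close> through tents,
  without constructing the limit measure.\<close>

definition heavy :: "real \<Rightarrow> complex set" where
  "heavy \<epsilon> = {p. norm p = 1 \<and> (\<forall>\<delta>>0. \<not> (\<forall>\<^sub>F r in at_top. wsum (bump p \<delta>) r /\<^sub>R r ^ q \<le> \<epsilon>))}"

text \<open>Disjoint tents over finitely many heavy points each have limit at least
  \<open>\<epsilon>\<close>, and together at most the density. This bounds their number.\<close>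

lemma finite_heavy:
  assumes "\<epsilon> > 0"
  shows "finite (heavy \<epsilon>)"
proof (rule finite_if_finite_subsets_card_bdd[THEN conjunct1])
  fix S assume S: "S \<subseteq> heavy \<epsilon>" "finite S"
  obtain \<delta> where \<delta>: "\<delta> > 0" "\<And>p p'. p \<in> S \<Longrightarrow> p' \<in> S \<Longrightarrow> p \<noteq> p' \<Longrightarrow> 2 * \<delta> \<le> dist p p'"
    using finite_set_separated[OF S(2)] by blast
  have "\<exists>L. ((\<lambda>r. wsum (bump p \<delta>) r /\<^sub>R r ^ q) \<longlongrightarrow> L) at_top" for p
    by (rule wsum_limit[OF continuous_on_bump[OF \<delta>(1)]])
  then obtain L where L: "\<And>p. ((\<lambda>r. wsum (bump p \<delta>) r /\<^sub>R r ^ q) \<longlongrightarrow> L p) at_top" by metis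
  have L_ge: "L p \<ge> \<epsilon>" if "p \<in> S" for p
  proof (rule ccontr)
    assume "\<not> L p \<ge> \<epsilon>"
    hence "\<forall>\<^sub>F r in at_top. wsum (bump p \<delta>) r /\<^sub>R r ^ q < \<epsilon>" by (intro order_tendstoD(2)[OF L]) auto
    hence "\<forall>\<^sub>F r in at_top. wsum (bump p \<delta>) r /\<^sub>R r ^ q \<le> \<epsilon>" by eventually_elim simp
    thus False using S(1) that \<delta>(1) by (auto simp: heavy_def)
  qed
  have "(\<Sum>p\<in>S. L p) \<le> density"
  proof (rule tendsto_le[OF trivial_limit_at_top_linorder cnt_limit])
    show "((\<lambda>r. \<Sum>p\<in>S. wsum (bump p \<delta>) r /\<^sub>R r ^ q) \<longlongrightarrow> (\<Sum>p\<in>S. L p)) at_top"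
      by (intro tendsto_sum L)
    show "\<forall>\<^sub>F r in at_top. (\<Sum>p\<in>S. wsum (bump p \<delta>) r /\<^sub>R r ^ q) \<le> cnt r /\<^sub>R r ^ q"
      using eventually_gt_at_top[of 0]
    proof eventually_elim
      case (elim r)
      have "(\<Sum>p\<in>S. wsum (bump p \<delta>) r) = wsum (\<lambda>w. \<Sum>p\<in>S. bump p \<delta> w) r"
        unfolding wsum_def by (rule sum.swap)
      also have "\<dots> \<le> wsum (\<lambda>_. 1) r" by (intro wsum_mono sum_bump_le_1 S \<delta>)
      finally have "(\<Sum>p\<in>S. wsum (bump p \<delta>) r) /\<^sub>R r ^ q \<le> cnt r /\<^sub>R r ^ q"
        using elim by (intro scaleR_left_mono) (auto simp: wsum_const)
      thus ?case by (simp add: sum_distrib_left)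
    qed
  qed
  moreover have "(\<Sum>p\<in>S. \<epsilon>) \<le> (\<Sum>p\<in>S. L p)" using L_ge by (intro sum_mono) auto
  ultimately have "card S * \<epsilon> \<le> density" by simp
  hence "card S \<le> density / \<epsilon>" using assms by (simp add: field_simps)
  thus "card S \<le> nat \<lceil>density / \<epsilon>\<rceil>" by linarith
qed

definition atoms :: "complex set" where
  "atoms = (\<Union>n. heavy (inverse (real (Suc n))))"

lemma countable_atoms: "countable atoms"
  unfolding atoms_def by (rule countable_UN) (auto intro!: countable_finite finite_heavy)

text \<open>Allowing all smaller radii lets the two sides of a sector share one
  \<open>\<delta>\<close>.\<close>

lemma not_atom:
  assumes "norm p = 1" "p \<notin> atoms" "\<epsilon> > 0"
  obtains \<delta> where "\<delta> > 0" "\<And>\<delta>'. 0 < \<delta>' \<Longrightarrow> \<delta>' \<le> \<delta> \<Longrightarrow> \<forall>\<^sub>F r in at_top. wsum (bump p \<delta>') r /\<^sub>R r ^ q \<le> \<epsilon>"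
proof -
  obtain n where n: "inverse (real (Suc n)) < \<epsilon>" using reals_Archimedean[OF assms(3)] by blast
  have "p \<notin> heavy (inverse (real (Suc n)))" using assms(2) by (auto simp: atoms_def)
  then obtain \<delta> where \<delta>: "\<delta> > 0" "\<forall>\<^sub>F r in at_top. wsum (bump p \<delta>) r /\<^sub>R r ^ q \<le> inverse (real (Suc n))"
    using assms(1) unfolding heavy_def by blast
  show ?thesis
  proof (rule that[OF \<delta>(1)])
    fix \<delta>' assume \<delta>': "0 < \<delta>'" "\<delta>' \<le> \<delta>"
    show "\<forall>\<^sub>F r in at_top. wsum (bump p \<delta>') r /\<^sub>R r ^ q \<le> \<epsilon>"
      using \<delta>(2) eventually_gt_at_top[of 0]
    proof eventually_elim
      case (elim r)
      have "wsum (bump p \<delta>') r /\<^sub>R r ^ q \<le> wsum (bump p \<delta>) r /\<^sub>R r ^ q"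
        using elim by (intro scaleR_left_mono wsum_mono bump_mono \<delta>') auto
      thus ?case using elim n by linarith
    qed
  qed
qed

text \<open>The indicator of the arc lies between the continuous cutoff \<open>\<psi>\<close> and
  \<open>\<psi>\<close> plus the tents over the two end points. The cutoff has a limit, and the
  tents are negligible because the end points are not atoms.\<close>

lemma arc_count_limit:
  assumes ab: "\<alpha> < \<beta>" and na: "cis \<alpha> \<notin> atoms" "cis \<beta> \<notin> atoms"
  shows "\<exists>L. ((\<lambda>r. wsum (indicator (cis ` {\<alpha><..<\<beta>})) r /\<^sub>R r ^ q) \<longlongrightarrow> L) at_top"
proof (cases "\<beta> - \<alpha> \<le> 2 * pi")
  case False
  have "sphere 0 1 \<subseteq> cis ` {\<alpha><..<\<beta>}"
  proof
    fix w :: complex assume w: "w \<in> sphere 0 1"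
    \<comment> \<open>A full closed turn centred at the midpoint fits inside the open interval,
      which is longer than 2 pi.\<close>
    define \<alpha>' where "\<alpha>' = (\<alpha> + \<beta>) / 2 - pi"
    have "w \<in> cis ` {\<alpha>'..\<alpha>'} \<union> cis ` {\<alpha>'..\<alpha>' + 2 * pi}" using sphere_eq_arcs[of \<alpha>' \<alpha>'] w by auto
    hence "w \<in> cis ` {\<alpha>'..\<alpha>' + 2 * pi}" by auto
    moreover have "{\<alpha>'..\<alpha>' + 2 * pi} \<subseteq> {\<alpha><..<\<beta>}" using False by (auto simp: \<alpha>'_def field_simps)
    ultimately show "w \<in> cis ` {\<alpha><..<\<beta>}" by blast
  qed
  hence "wsum (indicator (cis ` {\<alpha><..<\<beta>})) r = wsum (\<lambda>_. 1) r" for r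
    unfolding wsum_def using sgn_in_sphere by (intro sum.cong refl) (auto simp: indicator_def)
  thus ?thesis using wsum_limit[of "\<lambda>_. 1"] by simp
next
  case True
  let ?A = "cis ` {\<alpha><..<\<beta>}"
  show ?thesis
  proof (rule convergent_at_top_if_approx)
    fix \<epsilon> :: real assume \<epsilon>: "\<epsilon> > 0"
    obtain \<delta>1 where \<delta>1: "\<delta>1 > 0" "\<And>\<delta>'. 0 < \<delta>' \<Longrightarrow> \<delta>' \<le> \<delta>1 \<Longrightarrow> \<forall>\<^sub>F r in at_top. wsum (bump (cis \<alpha>) \<delta>') r /\<^sub>R r ^ q \<le> \<epsilon> / 3"
      by (rule not_atom[OF norm_cis na(1), of "\<epsilon> / 3"]) (use \<epsilon> in auto)
    obtain \<delta>2 where \<delta>2: "\<delta>2 > 0" "\<And>\<delta>'. 0 < \<delta>' \<Longrightarrow> \<delta>' \<le> \<delta>2 \<Longrightarrow> \<forall>\<^sub>F r in at_top. wsum (bump (cis \<beta>) \<delta>') r /\<^sub>R r ^ q \<le> \<epsilon> / 3"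
      by (rule not_atom[OF norm_cis na(2), of "\<epsilon> / 3"]) (use \<epsilon> in auto)
    define \<delta> where "\<delta> = min \<delta>1 \<delta>2"
    have \<delta>: "\<delta> > 0" "\<delta> \<le> \<delta>1" "\<delta> \<le> \<delta>2" using \<delta>1 \<delta>2 by (auto simp: \<delta>_def)
    define \<psi> where "\<psi> = (\<lambda>w. if w \<in> ?A then min 1 (min (dist w (cis \<alpha>)) (dist w (cis \<beta>)) / \<delta>) else 0)"
    have "continuous_on (sphere 0 1) \<psi>" unfolding \<psi>_def
      by (rule continuous_on_arc_cutoff) (use ab True \<delta> in auto)
    then obtain L where L: "((\<lambda>r. wsum \<psi> r /\<^sub>R r ^ q) \<longlongrightarrow> L) at_top" using wsum_limit by blast
    have le1: "\<psi> w \<le> indicator ?A w" for w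
      by (simp add: \<psi>_def)
    have le2: "indicator ?A w \<le> \<psi> w + (bump (cis \<alpha>) \<delta> w + bump (cis \<beta>) \<delta> w)" for w
    proof (cases "w \<in> ?A")
      case True
      have "1 \<le> min 1 (min x y / \<delta>) + (max 0 (1 - x / \<delta>) + max 0 (1 - y / \<delta>))" for x y :: real
        by (auto simp: min_def max_def)
      thus ?thesis using True by (simp add: \<psi>_def bump_def)
    qed (simp add: \<psi>_def bump_nonneg)
    have "\<forall>\<^sub>F r in at_top. dist (wsum \<psi> r /\<^sub>R r ^ q) L < \<epsilon> / 3" using tendstoD[OF L, of "\<epsilon> / 3"] \<epsilon> by simp
    hence "\<forall>\<^sub>F r in at_top. dist (wsum (indicator ?A) r /\<^sub>R r ^ q) L \<le> \<epsilon>"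
      using \<delta>1(2)[OF \<delta>(1,2)] \<delta>2(2)[OF \<delta>(1,3)] eventually_gt_at_top[of 0]
    proof eventually_elim
      case (elim r)
      have "wsum (indicator ?A) r \<le> wsum (\<lambda>w. \<psi> w + (bump (cis \<alpha>) \<delta> w + bump (cis \<beta>) \<delta> w)) r"
        by (intro wsum_mono le2)
      also have "\<dots> = wsum \<psi> r + (wsum (bump (cis \<alpha>) \<delta>) r + wsum (bump (cis \<beta>) \<delta>) r)"
        by (simp add: wsum_def sum.distrib)
      finally have "wsum (indicator ?A) r /\<^sub>R r ^ q \<le> (wsum \<psi> r + (wsum (bump (cis \<alpha>) \<delta>) r + wsum (bump (cis \<beta>) \<delta>) r)) /\<^sub>R r ^ q"
        using elim by (intro scaleR_left_mono) auto
      hence 1: "wsum (indicator ?A) r /\<^sub>R r ^ q \<le> wsum \<psi> r /\<^sub>R r ^ q + wsum (bump (cis \<alpha>) \<delta>) r /\<^sub>R r ^ q + wsum (bump (cis \<beta>) \<delta>) r /\<^sub>R r ^ q"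
        by (simp add: scaleR_add_right ring_distribs)
      have 2: "wsum \<psi> r /\<^sub>R r ^ q \<le> wsum (indicator ?A) r /\<^sub>R r ^ q"
        using elim by (intro scaleR_left_mono wsum_mono le1) auto
      show ?case using elim 1 2 unfolding dist_real_def by linarith
    qed
    thus "\<exists>L. \<forall>\<^sub>F r in at_top. dist (wsum (indicator ?A) r /\<^sub>R r ^ q) L \<le> \<epsilon>" by blast
  qed
qed

end

subsection \<open>Regular distribution of the zero sequence\<close>

lemma is_Arg_iff_sgn:
  assumes "z \<noteq> 0"
  shows "is_Arg z t \<longleftrightarrow> sgn z = cis t"
proof -
  have "sgn z * of_real (norm z) = z" using assms by (simp add: sgn_div_norm scaleR_conv_of_real)
  thus ?thesis unfolding is_Arg_def cis_conv_exp[symmetric] using assms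
    by (metis mult.commute mult_right_cancel norm_eq_zero of_real_eq_0_iff)
qed

locale zero_sequence_asymptotics = zero_asymptotics f "UNIV :: nat set" z q h0 H for f z q h0 H +
  assumes incseq_norm: "incseq (\<lambda>n. norm (z n))"
begin

lemma powr_minus_q: "r > 0 \<Longrightarrow> r powr - real q = inverse (r ^ q)"
  by (simp add: powr_minus powr_realpow)

lemma finite_norm_le: "finite {n. norm (z n) \<le> r}"
  using finite_le[of r] by simp

text \<open>\<open>count_disc\<close> uses the closed disc and \<open>below\<close> the open one
  without the origin; doubling the radius bridges the boundary, and \<open>mult0\<close> accounts
  for the origin.\<close>

lemma count_disc_le:
  assumes "r > 0"
  shows "real (count_disc z r) \<le> mult0 + cnt (2 * r)"
proof -
  have "{n. norm (z n) \<le> r} \<subseteq> {n. z n = 0} \<union> below (2 * r)"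
    using assms by (auto simp: below_def)
  hence "card {n. norm (z n) \<le> r} \<le> card ({n. z n = 0} \<union> below (2 * r))"
    using finite_fibre[of 0] by (intro card_mono) auto
  also have "\<dots> \<le> card {n. z n = 0} + card (below (2 * r))" by (rule card_Un_le)
  finally show ?thesis by (simp add: count_disc_def mult0_def cnt_def)
qed

lemma eventually_count_disc_le:
  obtains C where "C > 0" "\<forall>\<^sub>F r in at_top. real (count_disc z r) \<le> C * r ^ q"
proof (rule that[of "real mult0 + 2 ^ q * (density + 1)"])
  show "real mult0 + 2 ^ q * (density + 1) > 0"
    using density_pos by (intro add_nonneg_pos mult_pos_pos) auto
  have "filterlim (\<lambda>r::real. 2 * r) at_top at_top"
    by (rule filterlim_tendsto_pos_mult_at_top[OF tendsto_const]) (auto intro: filterlim_ident)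
  from eventually_compose_filterlim[OF eventually_cnt_le this]
  show "\<forall>\<^sub>F r in at_top. real (count_disc z r) \<le> (real mult0 + 2 ^ q * (density + 1)) * r ^ q"
    using eventually_ge_at_top[of 1]
  proof eventually_elim
    case (elim r)
    have "cnt (2 * r) \<le> (density + 1) * (2 * r) ^ q" using elim by (simp add: field_simps)
    moreover have "real mult0 \<le> mult0 * r ^ q" using elim by (simp add: mult_le_cancel_left1)
    ultimately show ?case using count_disc_le[of r] elim by (simp add: power_mult_distrib algebra_simps)
  qed
qed

section \<open>The exponent of convergence\<close>

lemma z_at_top: "\<forall>\<^sub>F n in sequentially. norm (z n) > r"
proof -
  have "\<forall>\<^sub>F n in cofinite. n \<notin> {n. norm (z n) \<le> r}"
    using finite_norm_le[of r] by (auto simp: eventually_cofinite)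
  thus ?thesis by (simp add: cofinite_eq_sequentially not_le)
qed

lemma norm_z_tendsto: "filterlim (\<lambda>n. norm (z n)) at_top sequentially"
  unfolding filterlim_at_top_dense using z_at_top by blast

text \<open>By the ordering, n is at most the count at radius |z_n|, hence at most C |z_n|^q. This
  compares the series with the sum of n^(-s) for s = (q + e) / q > 1.\<close>

lemma summable_convergence:
  assumes "0 < e"
  shows "(\<lambda>n. norm (z n) powr - (real q + e)) summable_on {n. z n \<noteq> 0}"
proof -
  obtain C where C: "C > 0" "\<forall>\<^sub>F r in at_top. real (count_disc z r) \<le> C * r ^ q"
    using eventually_count_disc_le by blast
  define s where "s = (real q + e) / real q"
  have s: "s > 1" using assms q by (simp add: s_def field_simps)
  have "summable (\<lambda>n. norm (norm (z n) powr - (real q + e)))"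
  proof (rule summable_comparison_test_ev)
    have "summable (\<lambda>n. real n powr - s)" using s by (simp add: summable_real_powr_iff)
    thus "summable (\<lambda>n. C powr s * real n powr - s)" by (rule summable_mult)
    show "\<forall>\<^sub>F n in sequentially. norm (norm (norm (z n) powr - (real q + e))) \<le> C powr s * real n powr - s"
      using eventually_compose_filterlim[OF C(2) norm_z_tendsto] z_at_top[of 0] eventually_gt_at_top[of 0]
    proof eventually_elim
      case (elim n)
      define x where "x = norm (z n)"
      have x: "x > 0" using elim by (simp add: x_def)
      have "{..<n} \<subseteq> {m. norm (z m) \<le> x}"
        using incseq_norm by (auto simp: x_def incseq_def)
      hence "card {..<n} \<le> card {m. norm (z m) \<le> x}" by (intro card_mono finite_norm_le)
      hence "real n \<le> C * x ^ q" using elim by (simp add: count_disc_def x_def)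
      hence "real n / C \<le> x powr real q" using C x by (simp add: powr_realpow field_simps)
      hence "(x powr real q) powr - s \<le> (real n / C) powr - s"
        using elim C s by (intro powr_mono2') auto
      also have "(x powr real q) powr - s = x powr - (real q + e)"
        using q by (simp add: powr_powr s_def)
      also have "(real n / C) powr - s = C powr s * real n powr - s"
        using C by (simp add: powr_divide powr_minus field_simps)
      finally show ?case by (simp add: x_def)
    qed
  qed
  hence "(\<lambda>n. norm (z n) powr - (real q + e)) summable_on UNIV"
    by (rule norm_summable_imp_summable_on)
  thus ?thesis by (rule summable_on_subset_banach) auto
qed

text \<open>The indices counted strictly inside radius |z_n| are all smaller than n, so D |z_n|^q <=
  n eventually, and the comparison runs the other way with s < 1.\<close>

lemma not_summable_divergence:
  assumes "0 < e" "e < real q"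
  shows "\<not> (\<lambda>n. norm (z n) powr - (real q - e)) summable_on {n. z n \<noteq> 0}"
proof
  assume "(\<lambda>n. norm (z n) powr - (real q - e)) summable_on {n. z n \<noteq> 0}"
  \<comment> \<open>Zeros at the origin are neutral because \<open>0 powr x\<close> is 0 for every
    \<open>x\<close>.\<close>
  hence "(\<lambda>n. norm (z n) powr - (real q - e)) summable_on UNIV"
    by (rule summable_on_cong_neutral[THEN iffD1, rotated -1]) auto
  hence summ: "summable (\<lambda>n. norm (z n) powr - (real q - e))"
    by (simp add: summable_on_UNIV_nonneg_real_iff)
  define s where "s = (real q - e) / real q"
  have s: "0 < s" "s < 1" using assms q by (auto simp: s_def field_simps)
  define D where "D = density / 2"
  have D: "D > 0" "D < density" using density_pos by (auto simp: D_def)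
  have ev: "\<forall>\<^sub>F r in at_top. D < cnt r /\<^sub>R r ^ q" by (rule order_tendstoD(1)[OF cnt_limit D(2)])
  have "summable (\<lambda>n. D powr s * real n powr - s)"
  proof (rule summable_comparison_test_ev[OF _ summ])
    show "\<forall>\<^sub>F n in sequentially. norm (D powr s * real n powr - s) \<le> norm (z n) powr - (real q - e)"
      using eventually_compose_filterlim[OF ev norm_z_tendsto] z_at_top[of 0] eventually_gt_at_top[of 0]
    proof eventually_elim
      case (elim n)
      define x where "x = norm (z n)"
      have x: "x > 0" using elim by (simp add: x_def)
      have "below x \<subseteq> {..<n}"
      proof
        fix m assume "m \<in> below x"
        hence "norm (z m) < norm (z n)" by (simp add: below_def x_def)
        thus "m \<in> {..<n}" using incseqD[OF incseq_norm, of n m] by force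
      qed
      hence "card (below x) \<le> card {..<n}" by (intro card_mono) auto
      hence "cnt x \<le> real n" by (simp add: cnt_def)
      moreover have "D * x ^ q < cnt x" using elim x by (simp add: x_def field_simps)
      ultimately have "x powr real q \<le> real n / D" using D x by (simp add: powr_realpow field_simps)
      hence "(real n / D) powr - s \<le> (x powr real q) powr - s"
        using x s by (intro powr_mono2') auto
      also have "(x powr real q) powr - s = x powr - (real q - e)"
        using q by (simp add: powr_powr s_def)
      also have "(real n / D) powr - s = D powr s * real n powr - s"
        using D by (simp add: powr_divide powr_minus field_simps)
      finally show ?case by (simp add: x_def)
    qed
  qed
  hence "summable (\<lambda>n. real n powr - s)" using D by (simp add: summable_cmult_iff)
  thus False using s by (simp add: summable_real_powr_iff)
qed

lemma exponent_of_convergence: "has_exponent_of_convergence z (real q)"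
  unfolding has_exponent_of_convergence_def no_finite_limit_point_def
proof (intro conjI allI impI)
  show "0 < real q" using q by simp
  fix w
  have "{n. dist (z n) w < 1} \<subseteq> {n. norm (z n) \<le> norm w + 1}"
  proof
    fix n assume "n \<in> {n. dist (z n) w < 1}"
    thus "n \<in> {n. norm (z n) \<le> norm w + 1}" using norm_triangle_sub[of "z n" w] by (simp add: dist_norm)
  qed
  hence "finite {n. dist (z n) w < 1}" using finite_norm_le finite_subset by blast
  thus "\<exists>e>0. finite {n. dist (z n) w < e}" using zero_less_one by blast
qed (use summable_convergence not_summable_divergence in blast)+

lemma finite_type: "finite_type z (real q)"
proof -
  obtain C where C: "C > 0" "\<forall>\<^sub>F r in at_top. real (count_disc z r) \<le> C * r ^ q"
    using eventually_count_disc_le by blast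
  have "\<forall>\<^sub>F r in at_top. ereal (r powr - real q * real (count_disc z r)) \<le> ereal C"
    using C(2) eventually_gt_at_top[of 0] by eventually_elim (simp add: powr_minus_q field_simps)
  hence "Limsup at_top (\<lambda>r::real. ereal (r powr - real q * real (count_disc z r))) \<le> ereal C"
    by (rule Limsup_bounded)
  thus ?thesis unfolding finite_type_def by (rule le_less_trans) simp
qed

lemma count_sector_eq: "real (count_sector z r \<alpha> \<beta>) = wsum (indicator (cis ` {\<alpha><..<\<beta>})) r"
proof -
  have "{n. z n \<noteq> 0 \<and> norm (z n) < r \<and> (\<exists>t. \<alpha> < t \<and> t < \<beta> \<and> is_Arg (z n) t)} = {i \<in> below r. sgn (z i) \<in> cis ` {\<alpha><..<\<beta>}}"
    using is_Arg_iff_sgn by (auto simp: below_def)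
  thus ?thesis by (simp add: count_sector_def wsum_def indicator_def sum.If_cases Int_def)
qed

lemma angular_density: "has_angular_density z (real q)"
  unfolding has_angular_density_def
proof (intro exI[of _ "{x. cis x \<in> atoms}"] conjI allI impI)
  show "countable {x. cis x \<in> atoms}" by (rule countable_cis_vimage[OF countable_atoms])
  fix \<alpha> \<beta> assume "\<alpha> \<notin> {x. cis x \<in> atoms} \<and> \<beta> \<notin> {x. cis x \<in> atoms} \<and> \<alpha> < \<beta>"
  then obtain L where L: "((\<lambda>r. wsum (indicator (cis ` {\<alpha><..<\<beta>})) r /\<^sub>R r ^ q) \<longlongrightarrow> L) at_top"
    using arc_count_limit[of \<alpha> \<beta>] by auto
  have "\<forall>\<^sub>F r in at_top. wsum (indicator (cis ` {\<alpha><..<\<beta>})) r /\<^sub>R r ^ q = r powr - real q * real (count_sector z r \<alpha> \<beta>)"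
    using eventually_gt_at_top[of 0] by eventually_elim (simp add: powr_minus_q count_sector_eq)
  from Lim_transform_eventually[OF L this]
  show "\<exists>d. ((\<lambda>r. r powr - real q * real (count_sector z r \<alpha> \<beta>)) \<longlongrightarrow> d) at_top" by blast
qed

lemma regularly_distributed: "regularly_distributed z"
  unfolding regularly_distributed_def
proof (intro exI[of _ "real q"] conjI exponent_of_convergence incseq_norm finite_type angular_density disjI2 exI[of _ q] refl)
  have "{n. 0 < norm (z n) \<and> norm (z n) < r} = below r" for r by (auto simp: below_def)
  thus "\<exists>L. ((\<lambda>r. \<Sum>n | 0 < norm (z n) \<and> norm (z n) < r. z n powi - int q) \<longlongrightarrow> L) at_top"
    using lindeloef_sum_limit by simp
qed

end

subsection \<open>Reduction of exponential polynomials\<close>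

lemma log_growth_less_mult:
  assumes "log_growth_less q f" "log_growth_less q g"
  shows "log_growth_less q (\<lambda>z. f z * g z)"
  unfolding log_growth_less_def
proof (intro allI impI)
  fix \<delta> :: real assume "\<delta> > 0"
  then obtain C D where C: "\<And>z. norm (f z) \<le> C * exp (\<delta> / 2 * norm z ^ q)"
    and D: "\<And>z. norm (g z) \<le> D * exp (\<delta> / 2 * norm z ^ q)"
    using assms unfolding log_growth_less_def by (meson half_gt_zero)
  have "norm (f z * g z) \<le> (C * D) * exp (\<delta> * norm z ^ q)" for z
  proof -
    have "norm (f z * g z) \<le> (C * exp (\<delta> / 2 * norm z ^ q)) * (D * exp (\<delta> / 2 * norm z ^ q))"
      unfolding norm_mult by (intro mult_mono C D order.trans[OF norm_ge_zero C] norm_ge_zero)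
    also have "\<dots> = (C * D) * (exp (\<delta> / 2 * norm z ^ q) * exp (\<delta> / 2 * norm z ^ q))" by simp
    also have "\<dots> = (C * D) * exp (\<delta> * norm z ^ q)" by (simp flip: exp_add)
    finally show ?thesis .
  qed
  thus "\<exists>C. \<forall>z. norm (f z * g z) \<le> C * exp (\<delta> * norm z ^ q)" by blast
qed

lemma log_growth_less_const: "log_growth_less q (\<lambda>_. c)"
  unfolding log_growth_less_def by (intro allI impI exI[of _ "norm c"]) (simp add: mult_le_cancel_left1)

lemma log_growth_less_add:
  assumes "log_growth_less q f" "log_growth_less q g"
  shows "log_growth_less q (\<lambda>z. f z + g z)"
  unfolding log_growth_less_def
proof (intro allI impI)
  fix \<delta> :: real assume "\<delta> > 0"
  then obtain C D where C: "\<And>z. norm (f z) \<le> C * exp (\<delta> * norm z ^ q)"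
    and D: "\<And>z. norm (g z) \<le> D * exp (\<delta> * norm z ^ q)"
    using assms unfolding log_growth_less_def by meson
  have "norm (f z + g z) \<le> (C + D) * exp (\<delta> * norm z ^ q)" for z
    using norm_triangle_ineq[of "f z" "g z"] C[of z] D[of z] by (simp add: ring_distribs)
  thus "\<exists>C. \<forall>z. norm (f z + g z) \<le> C * exp (\<delta> * norm z ^ q)" by blast
qed

lemma log_growth_less_sum:
  assumes "finite J" "\<And>j. j \<in> J \<Longrightarrow> log_growth_less q (g j)"
  shows "log_growth_less q (\<lambda>z. \<Sum>j\<in>J. g j z)"
  using assms by (induction J rule: finite_induct) (auto intro: log_growth_less_add log_growth_less_const)

lemma log_growth_less_ident:
  assumes "q > 0"
  shows "log_growth_less q (\<lambda>z. z)"
  unfolding log_growth_less_def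
proof (intro allI impI exI)
  fix \<delta> :: real and z :: complex assume \<delta>: "\<delta> > 0"
  define x where "x = norm z ^ q"
  have 1: "norm z \<le> 1 + x"
  proof (cases "norm z \<le> 1")
    case False
    hence "norm z ^ 1 \<le> x" unfolding x_def using assms by (intro power_increasing) auto
    thus ?thesis by simp
  qed (simp add: x_def add_increasing2)
  have 2: "1 \<le> exp (\<delta> * x)" using \<delta> by (simp add: x_def)
  have "\<delta> * x \<le> exp (\<delta> * x)" using exp_ge_add_one_self[of "\<delta> * x"] by linarith
  hence "x \<le> 1 / \<delta> * exp (\<delta> * x)" using \<delta> by (simp add: field_simps)
  with 1 2 have "norm z \<le> exp (\<delta> * x) + 1 / \<delta> * exp (\<delta> * x)" by linarith
  thus "norm z \<le> (1 + 1 / \<delta>) * exp (\<delta> * norm z ^ q)"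
    by (simp add: x_def ring_distribs)
qed

lemma log_growth_less_poly: "q > 0 \<Longrightarrow> log_growth_less q (poly p)"
proof (induction p)
  case 0
  have "poly 0 = (\<lambda>_::complex. 0)" by (simp add: fun_eq_iff)
  thus ?case using log_growth_less_const[of q 0] by simp
next
  case (pCons a p)
  hence "log_growth_less q (\<lambda>z. a + z * poly p z)"
    by (intro log_growth_less_add log_growth_less_mult log_growth_less_const log_growth_less_ident) auto
  moreover have "poly (pCons a p) = (\<lambda>z. a + z * poly p z)" by (simp add: fun_eq_iff)
  ultimately show ?case by simp
qed

text \<open>Outside a disc the polynomial is at most \<open>\<delta>\<close> times the next higher
  power of |z|, and inside it is bounded; the bound becomes the constant factor exp m.\<close>

lemma log_growth_less_exp_poly:
  assumes "degree p < q"
  shows "log_growth_less q (\<lambda>z. exp (poly p z))"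
  unfolding log_growth_less_def
proof (intro allI impI)
  fix \<delta> :: real assume \<delta>: "\<delta> > 0"
  obtain R where R: "\<And>z. norm z \<ge> R \<Longrightarrow> norm (poly p z) \<le> \<delta> * norm z ^ Suc (degree p)"
    using polyfun_extremal_lemma[OF \<delta>, of "coeff p" "degree p"] unfolding poly_altdef by blast
  obtain m where m: "m > 0" "\<And>z. norm z \<le> max 1 R \<Longrightarrow> norm (poly p z) \<le> m"
    using poly_bound_exists[of "max 1 R" p] by blast
  have "norm (poly p z) \<le> m + \<delta> * norm z ^ q" for z
  proof (cases "norm z \<le> max 1 R")
    case False
    hence "norm z ^ Suc (degree p) \<le> norm z ^ q" using assms by (intro power_increasing) auto
    hence "\<delta> * norm z ^ Suc (degree p) \<le> \<delta> * norm z ^ q" using \<delta> by (intro mult_left_mono) auto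
    thus ?thesis using R[of z] False m(1) by linarith
  next
    case True
    have "0 \<le> \<delta> * norm z ^ q" using \<delta> by simp
    thus ?thesis using m(2)[OF True] by linarith
  qed
  hence "Re (poly p z) \<le> m + \<delta> * norm z ^ q" for z
    using complex_Re_le_cmod order.trans by blast
  hence "norm (exp (poly p z)) \<le> exp m * exp (\<delta> * norm z ^ q)" for z
    by (simp flip: exp_add)
  thus "\<exists>C. \<forall>z. norm (exp (poly p z)) \<le> C * exp (\<delta> * norm z ^ q)" by blast
qed

text \<open>In the second alternative 0 lies in \<open>K\<close> by the locale, so the non-zero
  \<open>w\<close> means two distinct exponents.\<close>

definition reduced_exponential_sum :: "(complex \<Rightarrow> complex) \<Rightarrow> bool" where
  "reduced_exponential_sum f \<longleftrightarrow>
     (\<exists>p. p \<noteq> 0 \<and> f = poly p) \<or> (\<exists>q K F. leading_exponents q K F f \<and> (\<exists>w\<in>K. w \<noteq> 0))"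

text \<open>The terms are grouped by their coefficient of z^q, where q is the top degree allowed. If
  one group survives, its common exponential is factored out and the degree bound drops. If several
  survive, one exponent is shifted to 0 and the sum is reduced. The index set varies because the
  induction passes to a group.\<close>

lemma exponential_sum_reduction:
  fixes P Q :: "nat \<Rightarrow> complex poly"
  assumes "finite J" "\<And>j. j \<in> J \<Longrightarrow> degree (Q j) \<le> d" "\<And>z. g z = (\<Sum>j\<in>J. poly (P j) z * exp (poly (Q j) z))" "\<exists>z. g z \<noteq> 0"
  shows "\<exists>R f. (\<forall>z. g z = exp (poly R z) * f z) \<and>
    reduced_exponential_sum f"
  using assms
proof (induction d arbitrary: J Q g)
  case 0
  define p where "p = (\<Sum>j\<in>J. smult (exp (coeff (Q j) 0)) (P j))"
  have g: "g z = poly p z" for z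
  proof -
    have "poly (Q j) z = coeff (Q j) 0" if "j \<in> J" for j
    proof -
      obtain c where "Q j = [:c:]" using 0(2)[OF \<open>j \<in> J\<close>] degree_eq_zeroE by blast
      thus ?thesis by simp
    qed
    thus ?thesis by (simp add: 0(3) p_def poly_sum mult.commute)
  qed
  hence "p \<noteq> 0" using 0(4) by auto
  thus ?case using g
    by (intro exI[of _ 0] exI[of _ "poly p"]) (auto simp: reduced_exponential_sum_def)
next
  case (Suc d)
  define q where "q = Suc d"
  define lc where "lc = (\<lambda>j. coeff (Q j) q)"
  define Q' where "Q' = (\<lambda>j. Q j - monom (lc j) q)"
  define F where "F = (\<lambda>w z. \<Sum>j\<in>{j\<in>J. lc j = w}. poly (P j) z * exp (poly (Q' j) z))"
  have deg: "degree (Q' j) \<le> d" if "j \<in> J" for j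
  proof (rule degree_le, intro allI impI)
    fix i assume "d < i"
    thus "coeff (Q' j) i = 0" using Suc.prems(2)[OF that]
      by (cases "i = q") (auto simp: Q'_def lc_def q_def coeff_eq_0)
  qed
  have g: "g z = (\<Sum>w\<in>lc ` J. F w z * exp (w * z ^ q))" for z
  proof -
    have eq: "poly (P j) z * exp (poly (Q j) z) = poly (P j) z * exp (poly (Q' j) z) * exp (lc j * z ^ q)" for j
      by (simp add: Q'_def poly_monom exp_diff)
    have "g z = (\<Sum>j\<in>J. poly (P j) z * exp (poly (Q' j) z) * exp (lc j * z ^ q))"
      unfolding Suc.prems(3) by (rule sum.cong[OF refl eq])
    also have "\<dots> = (\<Sum>w\<in>lc ` J. \<Sum>j\<in>{j\<in>J. lc j = w}. poly (P j) z * exp (poly (Q' j) z) * exp (lc j * z ^ q))"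
      by (rule sum.group[symmetric]) (use Suc.prems(1) in auto)
    also have "\<dots> = (\<Sum>w\<in>lc ` J. F w z * exp (w * z ^ q))"
      unfolding F_def by (intro sum.cong refl) (simp add: sum_distrib_right)
    finally show ?thesis .
  qed
  \<comment> \<open>A group may cancel identically, so only those with a non-zero coefficient
    function are kept.\<close>
  define K0 where "K0 = {w \<in> lc ` J. \<exists>z. F w z \<noteq> 0}"
  have K0: "finite K0" using Suc.prems(1) by (simp add: K0_def)
  have gK: "g z = (\<Sum>w\<in>K0. F w z * exp (w * z ^ q))" for z
    unfolding g K0_def using Suc.prems(1) by (intro sum.mono_neutral_right) auto
  have "K0 \<noteq> {}" using Suc.prems(4) gK by auto
  then obtain w0 where w0: "w0 \<in> K0" by blast
  show ?case
  proof (cases "K0 = {w0}")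
    case True
    have "\<exists>R f. (\<forall>z. F w0 z = exp (poly R z) * f z) \<and>
      reduced_exponential_sum f"
      by (rule Suc.IH[of "{j\<in>J. lc j = w0}" Q']) (use Suc.prems(1) deg w0 in \<open>auto simp: F_def K0_def\<close>)
    then obtain R f where Rf: "\<And>z. F w0 z = exp (poly R z) * f z"
      "reduced_exponential_sum f" by blast
    have "g z = exp (poly (R + monom w0 q) z) * f z" for z
    proof -
      have "g z = F w0 z * exp (w0 * z ^ q)" by (subst gK, subst True) simp
      also have "\<dots> = exp (poly R z) * exp (w0 * z ^ q) * f z" by (simp only: Rf(1) mult_ac)
      also have "\<dots> = exp (poly (R + monom w0 q) z) * f z"
        by (simp only: poly_add poly_monom exp_add)
      finally show ?thesis .
    qed
    thus ?thesis using Rf(2) by blast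
  next
    case False
    then obtain w1 where w1: "w1 \<in> K0" "w1 \<noteq> w0" using w0 by blast
    \<comment> \<open>Subtracting \<open>w0\<close> from all exponents puts 0 into the exponent set;
      the difference \<open>w1 - w0\<close> is the non-zero member.\<close>
    define f where "f = (\<lambda>z. \<Sum>v\<in>(\<lambda>w. w - w0) ` K0. F (v + w0) z * exp (v * z ^ q))"
    have "leading_exponents q ((\<lambda>w. w - w0) ` K0) (\<lambda>v. F (v + w0)) f"
    proof
      show "q > 0" by (simp add: q_def)
      show "finite ((\<lambda>w. w - w0) ` K0)" using K0 by simp
      show "0 \<in> (\<lambda>w. w - w0) ` K0" using w0 by force
      fix v assume "v \<in> (\<lambda>w. w - w0) ` K0"
      then obtain w where w: "w \<in> K0" "v + w0 = w" by auto
      show "F (v + w0) holomorphic_on UNIV" unfolding F_def by (intro holomorphic_intros)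
      show "\<exists>z. F (v + w0) z \<noteq> 0" using w by (auto simp: K0_def)
      show "log_growth_less q (F (v + w0))" unfolding F_def
        by (intro log_growth_less_sum log_growth_less_mult log_growth_less_poly log_growth_less_exp_poly)
           (use Suc.prems(1) deg in \<open>auto simp: q_def less_Suc_eq_le\<close>)
    qed (simp add: f_def)
    moreover have "w1 - w0 \<in> (\<lambda>w. w - w0) ` K0" "w1 - w0 \<noteq> 0" using w1 by auto
    moreover have "g z = exp (poly (monom w0 q) z) * f z" for z
    proof -
      have "f z = (\<Sum>w\<in>K0. F w z * exp ((w - w0) * z ^ q))"
        unfolding f_def by (subst sum.reindex) (auto simp: inj_on_def)
      thus ?thesis
        by (simp add: gK poly_monom sum_distrib_left left_diff_distrib exp_diff)
    qed
    ultimately show ?thesis unfolding reduced_exponential_sum_def by blast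
  qed
qed

section \<open>Limits of the Fourier coefficients of a reduced exponential sum\<close>

context leading_exponents
begin

text \<open>If the mean were 0, the non-negative indicator would vanish almost everywhere, so Re (w
  e^(iqt)) would be non-positive. Its mean is 0 as q > 0, hence it would vanish almost everywhere,
  which only finitely many directions allow.\<close>

lemma integral_indicator_fun_pos:
  assumes w: "w \<in> K" "w \<noteq> 0"
  shows "(\<integral>t. indicator_fun t \<partial>circ) > 0"
proof (rule ccontr)
  assume "\<not> (\<integral>t. indicator_fun t \<partial>circ) > 0"
  moreover have "(\<integral>t. indicator_fun t \<partial>circ) \<ge> 0"
    by (intro integral_nonneg_AE AE_I2 indicator_fun_nonneg)
  ultimately have "(\<integral>t. indicator_fun t \<partial>circ) = 0" by simp
  hence "AE t in circ. indicator_fun t = 0"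
    using integral_nonneg_eq_0_iff_AE[OF integrable_indicator_fun] indicator_fun_nonneg by simp
  hence neg: "AE t in circ. 0 \<le> - Re (w * circle_pt t ^ q)"
  proof eventually_elim
    case (elim t)
    thus ?case using indicator_fun_ge[OF w(1), of t] by simp
  qed
  have int: "integrable circ (\<lambda>t. w * circle_pt t ^ q)"
    by (intro integrable_circ_continuous continuous_intros)
  have "(\<integral>t. circle_pt t ^ q \<partial>circ) = 0"
    using integral_circ_holomorphic[of "\<lambda>z. z ^ q" 2 1 0] q by (simp add: holomorphic_on_power)
  hence "(\<integral>t. w * circle_pt t ^ q \<partial>circ) = 0" by simp
  hence "(\<integral>t. - Re (w * circle_pt t ^ q) \<partial>circ) = 0"
    by (simp only: Bochner_Integration.integral_minus integral_Re[OF int]) simp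
  moreover have "integrable circ (\<lambda>t. - Re (w * circle_pt t ^ q))"
    by (intro integrable_circ_continuous continuous_intros)
  ultimately have "AE t in circ. - Re (w * circle_pt t ^ q) = 0"
    using integral_nonneg_eq_0_iff_AE[OF _ neg] by blast
  hence "AE t in circ. False"
    using AE_Re_circle_pt_power_nonzero[OF w(2) q] by eventually_elim simp
  hence "emeasure circ (space circ) = 0"
    by (subst (asm) AE_iff_measurable[OF sets.top]) auto
  hence "measure circ (space circ) = 0" by (simp add: measure_def)
  thus False by simp
qed

text \<open>The characters have modulus 1, so the distance in L^1 bounds the error of every Fourier
  coefficient.\<close>

lemma zero_asymptotics:
  assumes "enumerated_zeros f I a" "w \<in> K" "w \<noteq> 0"
  shows "zero_asymptotics f I a q (\<integral>t. indicator_fun t \<partial>circ) (\<lambda>k. \<integral>t. of_real (indicator_fun t) * cnj (circle_pt t) ^ k \<partial>circ)"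
proof -
  interpret enumerated_zeros f I a by fact
  let ?X = "\<lambda>r t. ln_mod f r t / r ^ q"
  have L1: "((\<lambda>r. \<integral>t. \<bar>?X r t - indicator_fun t\<bar> \<partial>circ) \<longlongrightarrow> 0) at_top"
    by (rule ln_f_converges_L1[OF nonzero])
  have intX: "integrable circ (?X r)" if "r > 0" for r
    by (intro integrable_divide integrable_ln_norm that)
  have limk: "((\<lambda>r. fourier_log f k r /\<^sub>R r ^ q) \<longlongrightarrow> (\<integral>t. of_real (indicator_fun t) * cnj (circle_pt t) ^ k \<partial>circ)) at_top" for k
  proof (rule Lim_null[THEN iffD2], rule Lim_null_comparison[OF _ L1])
    show "\<forall>\<^sub>F r in at_top. norm (fourier_log f k r /\<^sub>R r ^ q - (\<integral>t. of_real (indicator_fun t) * cnj (circle_pt t) ^ k \<partial>circ))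
       \<le> (\<integral>t. \<bar>?X r t - indicator_fun t\<bar> \<partial>circ)"
      using eventually_gt_at_top[of 0]
    proof eventually_elim
      case (elim r)
      have "fourier_log f k r /\<^sub>R r ^ q = (\<integral>t. of_real (?X r t) * cnj (circle_pt t) ^ k \<partial>circ)"
        unfolding fourier_log_def 
        by (subst integral_scaleR_right[symmetric]) (simp add: scaleR_conv_of_real divide_inverse mult_ac)
      hence "fourier_log f k r /\<^sub>R r ^ q - (\<integral>t. of_real (indicator_fun t) * cnj (circle_pt t) ^ k \<partial>circ)
         = (\<integral>t. of_real (?X r t) * cnj (circle_pt t) ^ k - of_real (indicator_fun t) * cnj (circle_pt t) ^ k \<partial>circ)"
        using integrable_mult_circle_pt_power[OF intX[OF elim], of k] integrable_mult_circle_pt_power[OF integrable_indicator_fun, of k]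
        by simp
      also have "norm \<dots> \<le> (\<integral>t. norm (of_real (?X r t) * cnj (circle_pt t) ^ k - of_real (indicator_fun t) * cnj (circle_pt t) ^ k) \<partial>circ)"
        by (rule integral_norm_bound)
      also have "\<dots> = (\<integral>t. \<bar>?X r t - indicator_fun t\<bar> \<partial>circ)"
      proof -
        have "norm (of_real x * cnj (circle_pt t) ^ k - of_real y * cnj (circle_pt t) ^ k) = \<bar>x - y\<bar>" for x y t
        proof -
          have "of_real x * cnj (circle_pt t) ^ k - of_real y * cnj (circle_pt t) ^ k = of_real (x - y) * cnj (circle_pt t) ^ k"
            by (simp add: left_diff_distrib)
          thus ?thesis by (simp only: norm_mult norm_of_real norm_power complex_mod_cnj norm_circle_pt power_one mult_1_right)
        qed
        thus ?thesis by (simp only:)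
      qed
      finally show ?case .
    qed
  qed
  have "((\<lambda>r. (\<integral>t. ln_mod f r t \<partial>circ) / r ^ q) \<longlongrightarrow> (\<integral>t. indicator_fun t \<partial>circ)) at_top"
  proof -
    have "((\<lambda>r. Re (fourier_log f 0 r /\<^sub>R r ^ q)) \<longlongrightarrow> Re (\<integral>t. of_real (indicator_fun t) * cnj (circle_pt t) ^ 0 \<partial>circ)) at_top"
      by (intro tendsto_Re limk)
    thus ?thesis by (simp add: fourier_log_def divide_inverse_commute)
  qed
  thus ?thesis
    by unfold_locales (use q limk integral_indicator_fun_pos[OF assms(2,3)] in auto)
qed

end

theorem lemma3p9:
  fixes f :: "complex \<Rightarrow> complex" and z :: "nat \<Rightarrow> complex"
  assumes "exponential_polynomial f"
    and "\<exists>w. f w \<noteq> 0"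
    and "zero_sequence f z"
  shows "regularly_distributed z"
proof -
  obtain m :: nat and P Q :: "nat \<Rightarrow> complex poly"
    where f: "\<And>z. f z = (\<Sum>j=1..m. poly (P j) z * exp (poly (Q j) z))"
    using assms(1) unfolding exponential_polynomial_def by blast
  \<comment> \<open>Inserting 0 keeps the maximum meaningful for an empty index range.\<close>
  define d where "d = Max (insert 0 ((\<lambda>j. degree (Q j)) ` {1..m}))"
  have "degree (Q j) \<le> d" if "j \<in> {1..m}" for j
    unfolding d_def using that by (intro Max_ge) auto
  from exponential_sum_reduction[OF finite_atLeastAtMost this f assms(2)]
  obtain R f' where f': "\<And>z. f z = exp (poly R z) * f' z"
    "reduced_exponential_sum f'" by blast
  have zeros: "f w = 0 \<longleftrightarrow> f' w = 0" for w by (simp add: f'(1))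
  have holo: "f holomorphic_on UNIV" 
    unfolding f[abs_def] by (intro holomorphic_intros)
  have holo': "f' holomorphic_on UNIV"
  proof -
    have "f' = (\<lambda>z. exp (- poly R z) * f z)" by (simp add: f'(1) fun_eq_iff exp_minus)
    thus ?thesis using holo by (auto intro!: holomorphic_intros)
  qed
  have range: "range z = {w. f' w = 0}" and inc: "incseq (\<lambda>n. norm (z n))"
    and mult: "\<And>w. f w = 0 \<Longrightarrow> int (card {n. z n = w}) = zorder f w"
    using assms(3) zeros by (auto simp: zero_sequence_def)
  \<comment> \<open>The exponential factor is analytic without zeros, so it has order 0 everywhere
    and multiplicities are unchanged.\<close>
  have zorder: "zorder f w = zorder f' w" for w
  proof -
    have an: "f' analytic_on {w}" using holo' analytic_at by blast
    have "(\<lambda>v. exp (poly R v)) holomorphic_on UNIV" by (intro holomorphic_intros)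
    hence an_exp: "(\<lambda>v. exp (poly R v)) analytic_on {w}" using analytic_at by blast
    have "\<exists>v. f' v \<noteq> 0" using assms(2) zeros by blast
    hence ev: "\<forall>\<^sub>F v in at w. f' v \<noteq> 0"
      using non_zero_neighbour_alt[OF holo' open_UNIV connected_UNIV UNIV_I UNIV_I] by auto
    have "zorder (\<lambda>v. exp (poly R v) * f' v) w = zorder (\<lambda>v. exp (poly R v)) w + zorder f' w"
    proof (rule zorder_times_analytic)
      show "\<forall>\<^sub>F v in at w. exp (poly R v) * f' v \<noteq> 0" using ev by eventually_elim simp
    qed (rule an_exp an)+
    moreover have "zorder (\<lambda>v. exp (poly R v)) w = 0"
      by (rule zorder_eq_0I) (use an_exp in auto)
    ultimately show ?thesis by (simp add: f'(1)[abs_def])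
  qed
  interpret enumerated_zeros f' UNIV z
  proof
    show "\<exists>w. f' w \<noteq> 0" using assms(2) zeros by blast
    show "f' (z n) = 0" for n using range by auto
    show "int (card {n \<in> UNIV. z n = w}) = zorder f' w" if "f' w = 0" for w
      using mult[of w] zeros zorder that by simp
  qed (rule holo')
  from f'(2) show ?thesis unfolding reduced_exponential_sum_def
  proof (elim disjE exE conjE bexE)
    fix p assume p: "p \<noteq> 0" "f' = poly p"
    \<comment> \<open>A polynomial has finitely many roots, each with a finite fibre, whereas the
      zero-sequence uses all natural numbers as indices: this case is contradictory.\<close>
    have "finite (\<Union>w\<in>{w. poly p w = 0}. {n\<in>UNIV. z n = w})"
      using poly_roots_finite[OF p(1)] finite_fibre by blast
    moreover have "(\<Union>w\<in>{w. poly p w = 0}. {n\<in>UNIV. z n = w}) = UNIV"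
      using range p(2) by auto
    ultimately show ?thesis using infinite_UNIV_nat by simp
  next
    fix q K F w assume "leading_exponents q K F f'" and w: "w \<in> K" "w \<noteq> 0"
    then interpret L: leading_exponents q K F f' by simp
    interpret zero_asymptotics f' UNIV z q "\<integral>t. L.indicator_fun t \<partial>circ" "\<lambda>k. \<integral>t. of_real (L.indicator_fun t) * cnj (circle_pt t) ^ k \<partial>circ"
      by (rule L.zero_asymptotics[OF enumerated_zeros_axioms w])
    interpret zero_sequence_asymptotics f' z q "\<integral>t. L.indicator_fun t \<partial>circ" "\<lambda>k. \<integral>t. of_real (L.indicator_fun t) * cnj (circle_pt t) ^ k \<partial>circ"
      by unfold_locales (rule inc)
    show ?thesis by (rule regularly_distributed)
  qed
qed

end
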